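(* Let $\alpha$ be a real number with $\frac12<\alpha\le 1$, and for $T>0$ let $N(\alpha,T)$ be the number of zeros $\rho=\beta+i\gamma$ of $\mathcal{R}(s)$, counted with multiplicity, with $\alpha\le\beta\le 1$ and $0<\gamma\le T$. Then \[N(\alpha,T)\ll T^{\frac32-\alpha}(\log T)^3,\] that is, there is a constant $C>0$ such that $N(\alpha,T)\le C\,T^{\frac32-\alpha}(\log T)^3$ for all $T\ge 2$.
   Context: $\mathcal{R}(s)$ denotes Riemann's auxiliary function (found by Siegel in Riemann's papers). It is the entire function \[\mathcal{R}(s)=\int_{L}\frac{x^{-s}e^{\pi i x^2}}{e^{\pi i x}-e^{-\pi i x}}\,dx,\] where $L$ is the straight line $x(u)=\frac12-u\,e^{\pi i/4}$, $u$ running from $-\infty$ to $+\infty$ (a line of slope $1$ crossing the real axis between $0$ and $1$, traversed from upper right to lower left), and $x^{-s}=e^{-s\log x}$ with the principal branch of the logarithm. It satisfies $e^{i\vartheta(t)}\zeta(\frac12+it)=2\,\mathrm{Re}\{e^{i\vartheta(t)}\mathcal{R}(\frac12+it)\}$ for real $t$, where $\vartheta$ is the Riemann-Siegel theta function. *)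

theory Defs
  imports "HOL-Complex_Analysis.Complex_Analysis"
begin

definition siegel_line :: "real \<Rightarrow> complex" where
  "siegel_line u = 1 / 2 - of_real u * exp (\<i> * of_real (pi / 4))"

definition siegel_integrand :: "complex \<Rightarrow> complex \<Rightarrow> complex" where
  "siegel_integrand s x =
     x powr (- s) * exp (of_real pi * \<i> * x ^ 2)
       / (exp (of_real pi * \<i> * x) - exp (- (of_real pi * \<i> * x)))"

text \<open>
  The integral over the infinite line is written as a Lebesgue integral over its parameter;
  the factor \<open>- exp (\<i> * pi / 4)\<close> is the derivative of \<open>siegel_line\<close>. The complex \<open>powr\<close> uses the
  principal logarithm, whose branch cut the line does not meet.
\<close>

definition riemann_aux :: "complex \<Rightarrow> complex" where
  "riemann_aux s =
     (LINT u|lborel. siegel_integrand s (siegel_line u) * (- exp (\<i> * of_real (pi / 4))))"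

definition riemann_aux_zeros :: "real \<Rightarrow> real \<Rightarrow> complex set" where
  "riemann_aux_zeros \<alpha> T =
     {\<rho>. riemann_aux \<rho> = 0 \<and> \<alpha> \<le> Re \<rho> \<and> Re \<rho> \<le> 1 \<and> 0 < Im \<rho> \<and> Im \<rho> \<le> T}"

text \<open>
  Each zero is weighted by its order. A sum over an infinite set is \<open>0\<close>, so a bound on
  \<open>riemann_aux_N \<alpha> T\<close> bounds the number of zeros only together with the finiteness of
  \<open>riemann_aux_zeros \<alpha> T\<close>.
\<close>

definition riemann_aux_N :: "real \<Rightarrow> real \<Rightarrow> nat" where
  "riemann_aux_N \<alpha> T = (\<Sum>\<rho>\<in>riemann_aux_zeros \<alpha> T. nat (zorder riemann_aux \<rho>))"

end

theory Submission
  imports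
    Defs
    "HOL-Probability.Distributions"
    "HOL-Real_Asymp.Real_Asymp"
    "HOL-Computational_Algebra.Squarefree"
begin

text \<open>
  Write \<open>R\<close> for the auxiliary function \<open>riemann_aux\<close> and \<open>s = \<sigma> + i t\<close>. The proof is a zero density argument:
  after multiplication by a mollifier \<open>R\<close> is close to \<open>1\<close> in mean square to the right of the
  critical line, and a function that is close to \<open>1\<close> in mean square has few zeros.

  Approximation. Moving the line of integration from \<open>1 / 2\<close> to \<open>N + 1 / 2\<close> crosses the poles
  \<open>1, \<dots>, N\<close>, whose residues give \<open>n\<^sup>-\<^sup>s\<close> (\<open>siegel_line_shift\<close>). The remaining integral has its
  saddle point at \<open>sqrt (t / 2\<pi>)\<close>; if \<open>N\<close> is the integral part of that number, it is
  \<open>O(t\<^sup>-\<^sup>\<sigma>\<^sup>/\<^sup>2)\<close> (\<open>siegel_tail_bound\<close>). Hence \<open>R(s)\<close> is a sum of \<open>n\<^sup>-\<^sup>s\<close> over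
  \<open>n \<le> sqrt (t / 2\<pi>)\<close>, up to an error that is negligible here.

  Mollification. Put \<open>\<alpha> = 1 / 2 + 2g\<close>, so that \<open>T\<close> to the power \<open>1 - 2g\<close> is the bound that is
  wanted. Let \<open>M\<close> be the sum of \<open>\<mu>(d) d\<^sup>-\<^sup>s\<close> over \<open>d \<le> X\<close> with \<open>X\<close> equal to \<open>T\<close> to the power
  \<open>1 / 2 + g / 4\<close>, and let \<open>f = R M - 1\<close>. For \<open>t\<close> of order \<open>T\<close> the coefficient of \<open>k\<^sup>-\<^sup>s\<close> in the
  Dirichlet polynomial that approximates \<open>f\<close> vanishes for \<open>k \<le> Y\<close>, where \<open>Y\<close> has order \<open>sqrt T\<close>,
  and for \<open>k \<le> X\<close> it is at most the number of divisors of \<open>k\<close> that exceed \<open>Y\<close>. Since \<open>X\<close> is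
  longer than \<open>Y\<close> by a power of \<open>T\<close>, the terms with \<open>k > X\<close> save a power of \<open>T\<close> and may be
  estimated crudely, and the others give \<open>T\<close> times \<open>Y\<close> to the power \<open>1 - 2\<sigma>\<close> with one logarithm.
  The polynomial has length \<open>T\<close> to the power \<open>1 + g / 4\<close>, short enough for the non-diagonal terms to
  save a power of \<open>T\<close> as well. So the mean square of \<open>f\<close> over \<open>T / 2 \<le> t \<le> 3 T\<close> is
  \<open>O(T\<^sup>3\<^sup>/\<^sup>2\<^sup>-\<^sup>\<alpha> log T)\<close> uniformly for \<open>\<sigma> \<ge> \<alpha> - 1 / log T\<close>
  (\<open>mean_square_mollified_defect\<close>).

  Zeros. A form of Jensen's inequality in which only \<open>|f|\<^sup>2\<close> appears
  (\<open>weighted_zeros_le_mean_square\<close>) is applied to \<open>1 + f = R M\<close> on discs with centre \<open>3 + i t\<close> that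
  reach \<open>1 / log T\<close> to the left of the line \<open>\<sigma> = \<alpha>\<close>. A zero with real part at least \<open>\<alpha>\<close> has weight
  of order \<open>1 / log T\<close> in each disc whose centre is within \<open>1 / log T\<close> of its height. Integration over
  \<open>T \<le> t \<le> 2 T\<close> therefore costs two logarithms and gives \<open>O(T\<^sup>3\<^sup>/\<^sup>2\<^sup>-\<^sup>\<alpha> log\<^sup>3 T)\<close> zeros with
  \<open>T < \<gamma> \<le> 2 T\<close> (\<open>zeros_in_window_bound\<close>); summation over dyadic windows is a geometric series.
\<close>

section \<open>Counting zeros by a mean square\<close>

text \<open>
  Divisibility in the ring of entire functions. Unlike the order of a zero it passes to multiples of
  \<open>g\<close> with no further argument, which is what the mollifier requires.
\<close>

definition entire_multiple_of_power :: "(complex \<Rightarrow> complex) \<Rightarrow> complex \<Rightarrow> nat \<Rightarrow> bool" where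
  "entire_multiple_of_power g \<rho> m \<longleftrightarrow> (\<exists>h. h holomorphic_on UNIV \<and> (\<forall>z. g z = (z - \<rho>) ^ m * h z))"

text \<open>
  After division by the power of \<open>z - \<rho>\<close> the singularity at \<open>\<rho>\<close> is removable, so the local
  factorisation is a global one.
\<close>

lemma zorder_entire_multiple:
  assumes g: "g holomorphic_on UNIV" and nz: "g w \<noteq> 0"
  shows "entire_multiple_of_power g \<rho> (nat (zorder g \<rho>))"
proof -
  have nz': "\<exists>w\<in>UNIV. g w \<noteq> 0" using nz by blast
  define n where "n = nat (zorder g \<rho>)"
  define p where "p = zor_poly g \<rho>"
  obtain r where r: "r > 0" "p holomorphic_on cball \<rho> r" "\<And>z. z \<in> cball \<rho> r \<Longrightarrow> g z = p z * (z - \<rho>) ^ n"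
    using zorder_exist_zero[OF g open_UNIV connected_UNIV UNIV_I nz', of \<rho>]
    unfolding n_def p_def by blast
  define h where "h z = (if z = \<rho> then p \<rho> else g z / (z - \<rho>) ^ n)" for z
  have "h holomorphic_on (UNIV - {\<rho>})"
  proof (rule holomorphic_transform)
    show "(\<lambda>z. g z / (z - \<rho>) ^ n) holomorphic_on (UNIV - {\<rho>})"
      by (intro holomorphic_intros holomorphic_on_subset[OF g]) auto
  qed (auto simp: h_def)
  moreover have "h holomorphic_on ball \<rho> r"
    by (rule holomorphic_transform[OF holomorphic_on_subset[OF r(2)]]) (auto simp: h_def r(3))
  ultimately have "h holomorphic_on (UNIV - {\<rho>}) \<union> ball \<rho> r"
    by (intro holomorphic_on_Un) auto
  moreover have "(UNIV - {\<rho>}) \<union> ball \<rho> r = UNIV" using r(1) by auto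
  ultimately have "h holomorphic_on UNIV" by simp
  moreover have "g z = (z - \<rho>) ^ n * h z" for z
    using r(1) r(3)[of \<rho>] by (auto simp: h_def)
  ultimately show ?thesis
    unfolding entire_multiple_of_power_def n_def by blast
qed

lemma entire_multiple_mult:
  assumes "entire_multiple_of_power g \<rho> m" "k holomorphic_on UNIV"
  shows "entire_multiple_of_power (\<lambda>z. g z * k z) \<rho> m"
proof -
  obtain h where h: "h holomorphic_on UNIV" "\<And>z. g z = (z - \<rho>) ^ m * h z"
    using assms(1) unfolding entire_multiple_of_power_def by blast
  then show ?thesis
    unfolding entire_multiple_of_power_def
    by (intro exI[of _ "\<lambda>z. h z * k z"]) (auto intro: holomorphic_intros assms(2))
qed

text \<open>
  Powers of \<open>z - \<rho>\<close> for distinct \<open>\<rho>\<close> are coprime: the quotient by the last factor is visibly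
  holomorphic away from \<open>\<rho>\<close>, and the factorisation at \<open>\<rho>\<close> shows that it is holomorphic away from
  the other points.
\<close>

lemma entire_multiple_prod:
  assumes "finite Z" "g holomorphic_on UNIV" "\<And>\<rho>. \<rho> \<in> Z \<Longrightarrow> entire_multiple_of_power g \<rho> (m \<rho>)"
  shows "\<exists>h. h holomorphic_on UNIV \<and> (\<forall>z. g z = (\<Prod>\<rho>\<in>Z. (z - \<rho>) ^ m \<rho>) * h z)"
  using assms(1,3)
proof (induction Z rule: finite_induct)
  case empty
  then show ?case using assms(2) by auto
next
  case (insert \<rho> Z)
  define P where "P z = (\<Prod>\<rho>\<in>Z. (z - \<rho>) ^ m \<rho>)" for z
  obtain h1 where h1: "h1 holomorphic_on UNIV" "\<And>z. g z = P z * h1 z"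
    using insert unfolding P_def by blast
  obtain h2 where h2: "h2 holomorphic_on UNIV" "\<And>z. g z = (z - \<rho>) ^ m \<rho> * h2 z"
    using insert.prems[of \<rho>] unfolding entire_multiple_of_power_def by blast
  have P0: "P z \<noteq> 0" if "z \<notin> Z" for z
    using that insert.hyps by (auto simp: P_def)
  have eq: "P z * h1 z = (z - \<rho>) ^ m \<rho> * h2 z" for z
    using h1(2) h2(2) by metis
  define k where "k z = (if z = \<rho> then h2 \<rho> / P \<rho> else h1 z / (z - \<rho>) ^ m \<rho>)" for z
  have "k holomorphic_on (UNIV - {\<rho>})"
  proof (rule holomorphic_transform)
    show "(\<lambda>z. h1 z / (z - \<rho>) ^ m \<rho>) holomorphic_on (UNIV - {\<rho>})"
      by (intro holomorphic_intros holomorphic_on_subset[OF h1(1)]) auto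
  qed (auto simp: k_def)
  moreover have "k holomorphic_on (UNIV - Z)"
  proof (rule holomorphic_transform)
    show "(\<lambda>z. h2 z / P z) holomorphic_on (UNIV - Z)"
      unfolding P_def using P0 unfolding P_def
      by (intro holomorphic_intros holomorphic_on_subset[OF h2(1)]) auto
    show "h2 z / P z = k z" if "z \<in> UNIV - Z" for z
      using eq[of z] P0[of z] that by (auto simp: k_def field_simps)
  qed
  ultimately have "k holomorphic_on (UNIV - {\<rho>}) \<union> (UNIV - Z)"
    by (intro holomorphic_on_Un) (auto intro: finite_imp_closed insert.hyps)
  moreover have "(UNIV - {\<rho>}) \<union> (UNIV - Z) = UNIV" using insert.hyps by auto
  ultimately have khol: "k holomorphic_on UNIV" by simp
  have "g z = (\<Prod>\<rho>\<in>insert \<rho> Z. (z - \<rho>) ^ m \<rho>) * k z" for z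
  proof (cases "z = \<rho>")
    case True
    then show ?thesis using h2(2)[of \<rho>] insert.hyps P0[of \<rho>]
      by (simp add: k_def flip: P_def)
  next
    case False
    then show ?thesis using h1(2)[of z] insert.hyps
      by (simp add: k_def flip: P_def)
  qed
  then show ?case using khol by blast
qed

lemma mean_value_circle:
  assumes f: "f holomorphic_on UNIV" and r: "r > 0"
  shows "((\<lambda>t. f (circlepath c r t)) has_integral f c) {0..1}"
proof -
  have "((\<lambda>u. f u / (u - c)) has_contour_integral (2 * of_real pi * \<i> * f c)) (circlepath c r)"
    using r by (intro Cauchy_integral_circlepath_simple holomorphic_on_subset[OF f]) auto
  then have "((\<lambda>t. f (circlepath c r t) / (circlepath c r t - c) *
      vector_derivative (circlepath c r) (at t within {0..1})) has_integral (2 * of_real pi * \<i> * f c)) {0..1}"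
    by (simp add: has_contour_integral_def)
  then have "((\<lambda>t. (2 * of_real pi * \<i>) * f (circlepath c r t)) has_integral (2 * of_real pi * \<i> * f c)) {0..1}"
  proof (rule has_integral_eq[rotated])
    fix t :: real assume t: "t \<in> {0..1}"
    have "circlepath c r t - c = r * exp (2 * of_real pi * \<i> * t)" by (simp add: circlepath)
    then show "f (circlepath c r t) / (circlepath c r t - c) *
        vector_derivative (circlepath c r) (at t within {0..1}) = 2 * of_real pi * \<i> * f (circlepath c r t)"
      using r t by (simp add: vector_derivative_circlepath01)
  qed
  then have "((\<lambda>t. 1 / (2 * of_real pi * \<i>) * ((2 * of_real pi * \<i>) * f (circlepath c r t))) has_integral
      1 / (2 * of_real pi * \<i>) * (2 * of_real pi * \<i> * f c)) {0..1}"
    by (rule has_integral_mult_right)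
  then show ?thesis by simp
qed

text \<open>
  On the circle the reflected factor has the modulus of \<open>z - \<rho>\<close>, but at the centre its modulus is
  \<open>r\<close>: exchanging one for the other moves the zero out without changing boundary values.
\<close>

lemma blaschke_factor_norm:
  fixes z \<rho> c :: complex
  assumes "norm (z - c) = r" "r > 0"
  shows "norm ((r\<^sup>2 - cnj (\<rho> - c) * (z - c)) / r) = norm (z - \<rho>)"
proof -
  have "(complex_of_real r)\<^sup>2 = (z - c) * cnj (z - c)"
    unfolding assms(1)[symmetric] by (metis complex_norm_square of_real_power)
  then have "(complex_of_real r)\<^sup>2 - cnj (\<rho> - c) * (z - c) = (z - c) * cnj (z - \<rho>)"
    by (simp add: algebra_simps)
  then show ?thesis using assms by (simp add: norm_mult norm_divide del: complex_cnj_diff)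
qed

text \<open>
  A quadratic form of Jensen's inequality. Exchanging every factor \<open>z - \<rho>\<close> of \<open>g\<close> for its reflected
  factor does not change \<open>|g|\<close> on the circle, but it multiplies \<open>|g c|\<close> by the product of the
  \<open>r / |\<rho> - c|\<close>; the inequality is then the mean value property of the square of the new function.
\<close>

lemma mean_square_times_zeros:
  assumes g: "g holomorphic_on UNIV" and r: "r > 0" and fin: "finite Z"
    and Z: "\<And>\<rho>. \<rho> \<in> Z \<Longrightarrow> entire_multiple_of_power g \<rho> (m \<rho>)" and c: "c \<notin> Z"
  shows "norm (g c) ^ 2 * (\<Prod>\<rho>\<in>Z. (r / norm (\<rho> - c)) ^ (2 * m \<rho>))
           \<le> integral {0..1} (\<lambda>t. norm (g (circlepath c r t)) ^ 2)"
proof -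
  obtain h where h: "h holomorphic_on UNIV" "\<And>z. g z = (\<Prod>\<rho>\<in>Z. (z - \<rho>) ^ m \<rho>) * h z"
    using entire_multiple_prod[OF fin g Z] by blast
  define B where "B z = (\<Prod>\<rho>\<in>Z. ((r\<^sup>2 - cnj (\<rho> - c) * (z - c)) / r) ^ m \<rho>)" for z
  define H where "H z = B z * h z" for z
  have Bhol: "B holomorphic_on UNIV"
    unfolding B_def by (intro holomorphic_intros)  (use r in auto)
  have Hhol: "H holomorphic_on UNIV"
    unfolding H_def by (intro holomorphic_intros Bhol h(1))
  have circ: "norm (circlepath c r t - c) = r" for t
    using r by (simp add: circlepath norm_mult)
  have eq: "norm (H (circlepath c r t)) = norm (g (circlepath c r t))" for t
    unfolding H_def B_def h(2) norm_mult norm_power prod_norm[symmetric]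
    using blaschke_factor_norm[OF circ r, of _ t] by simp
  have int: "((\<lambda>t. H (circlepath c r t) ^ 2) has_integral H c ^ 2) {0..1}"
    by (rule mean_value_circle[where f = "\<lambda>z. H z ^ 2", OF _ r]) (intro holomorphic_intros Hhol)
  have cont: "continuous_on {0..1} (\<lambda>t. norm (g (circlepath c r t)) ^ 2)"
    by (intro continuous_intros continuous_on_compose2[OF holomorphic_on_imp_continuous_on[OF g]])
       (auto simp: circlepath intro!: continuous_intros)
  have "norm (integral {0..1} (\<lambda>t. H (circlepath c r t) ^ 2))
          \<le> integral {0..1} (\<lambda>t. norm (g (circlepath c r t)) ^ 2)"
    by (rule integral_norm_bound_integral)
       (use int cont in \<open>auto intro: integrable_continuous_interval simp: norm_power eq\<close>)
  then have le: "norm (H c) ^ 2 \<le> integral {0..1} (\<lambda>t. norm (g (circlepath c r t)) ^ 2)"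
    using int by (simp add: integral_unique norm_power)
  have "norm (g c) ^ 2 * (\<Prod>\<rho>\<in>Z. (r / norm (\<rho> - c)) ^ (2 * m \<rho>)) =
        (norm (g c) * (\<Prod>\<rho>\<in>Z. (r / norm (\<rho> - c)) ^ m \<rho>)) ^ 2"
    by (simp add: power_mult_distrib prod_power_distrib power_mult[symmetric] mult.commute)
  also have "norm (g c) * (\<Prod>\<rho>\<in>Z. (r / norm (\<rho> - c)) ^ m \<rho>) =
      norm (h c) * (\<Prod>\<rho>\<in>Z. norm (\<rho> - c) ^ m \<rho> * (r / norm (\<rho> - c)) ^ m \<rho>)"
    by (simp add: h(2) norm_mult norm_power prod_norm[symmetric] prod.distrib norm_minus_commute)
  also have "(\<Prod>\<rho>\<in>Z. norm (\<rho> - c) ^ m \<rho> * (r / norm (\<rho> - c)) ^ m \<rho>) = norm (B c)"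
    unfolding B_def prod_norm[symmetric]
    by (intro prod.cong refl) (use r c in \<open>auto simp: norm_power norm_divide field_simps power2_eq_square norm_mult power_mult_distrib\<close>)
  finally show ?thesis
    using le by (simp add: H_def norm_mult mult.commute)
qed

text \<open>
  The mean of \<open>|1 + f|\<^sup>2\<close> over the circle is \<open>1 + 2 Re (f c)\<close> plus the mean of \<open>|f|\<^sup>2\<close>, because the
  linear term has a mean value property of its own. Its quotient by \<open>|1 + f c|\<^sup>2\<close> exceeds \<open>1\<close> by
  at most four times the mean of \<open>|f|\<^sup>2\<close>, so the weighted number of zeros of \<open>1 + f\<close> is
  controlled by \<open>|f|\<^sup>2\<close> alone, without mean values of \<open>log |1 + f|\<close>.
\<close>

lemma weighted_zeros_le_mean_square:
  assumes f: "f holomorphic_on UNIV" and r: "r > 0" and fin: "finite Z"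
    and Z: "\<And>\<rho>. \<rho> \<in> Z \<Longrightarrow> entire_multiple_of_power (\<lambda>z. 1 + f z) \<rho> (m \<rho>)"
    and c: "c \<notin> Z" and fc: "norm (f c) \<le> 1 / 2"
  shows "(\<Sum>\<rho>\<in>Z. real (m \<rho>) * ln ((r / norm (\<rho> - c)) ^ 2))
           \<le> 4 * integral {0..1} (\<lambda>t. norm (f (circlepath c r t)) ^ 2)"
proof -
  define I where "I = integral {0..1} (\<lambda>t. norm (f (circlepath c r t)) ^ 2)"
  define A where "A = (\<Prod>\<rho>\<in>Z. (r / norm (\<rho> - c)) ^ (2 * m \<rho>))"
  have pos: "\<rho> \<in> Z \<Longrightarrow> r / norm (\<rho> - c) > 0" for \<rho> using r c by (auto intro!: divide_pos_pos)
  have Apos: "A > 0" unfolding A_def by (intro prod_pos zero_less_power pos)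
  have lnA: "ln A = (\<Sum>\<rho>\<in>Z. real (m \<rho>) * ln ((r / norm (\<rho> - c)) ^ 2))"
    unfolding A_def using pos fin r c
    by (subst ln_prod) (auto simp: ln_realpow power_mult intro!: sum.cong zero_less_power)
  have cont: "continuous_on {0..1} (\<lambda>t. f (circlepath c r t))"
    by (intro continuous_intros continuous_on_compose2[OF holomorphic_on_imp_continuous_on[OF f]])
       (auto simp: circlepath intro!: continuous_intros)
  have Iint: "((\<lambda>t. norm (f (circlepath c r t)) ^ 2) has_integral I) {0..1}"
    unfolding I_def by (intro integrable_integral integrable_continuous_interval continuous_intros cont)
  have Re_int: "((\<lambda>t. Re (f (circlepath c r t))) has_integral Re (f c)) {0..1}"
    using has_integral_linear[OF mean_value_circle[OF f r] bounded_linear_Re] by (simp add: o_def)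
  have expand: "norm (1 + w) ^ 2 = 1 + 2 * Re w + norm w ^ 2" for w
    unfolding cmod_power2 by (simp add: power2_eq_square algebra_simps)
  have "((\<lambda>t. 1 + 2 * Re (f (circlepath c r t)) + norm (f (circlepath c r t)) ^ 2) has_integral
         (1 + 2 * Re (f c) + I)) {0..1}"
    using has_integral_const_real[of 1 0 1]
    by (intro has_integral_add has_integral_mult_right Re_int Iint) auto
  then have "integral {0..1} (\<lambda>t. norm (1 + f (circlepath c r t)) ^ 2) = 1 + 2 * Re (f c) + I"
    by (simp add: expand integral_unique)
  then have "norm (1 + f c) ^ 2 * A \<le> 1 + 2 * Re (f c) + I"
    using mean_square_times_zeros[where g = "\<lambda>z. 1 + f z", OF _ r fin Z c] f
    by (simp add: A_def holomorphic_intros)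
  also have "\<dots> \<le> norm (1 + f c) ^ 2 + I" using expand[of "f c"] by simp
  finally have le: "norm (1 + f c) ^ 2 * (A - 1) \<le> I" by (simp add: algebra_simps)
  have "norm (1 + f c) \<ge> 1 / 2"
    using norm_triangle_ineq2[of 1 "- f c"] fc by simp
  then have q: "1 / 4 \<le> norm (1 + f c) ^ 2"
    using power_mono[of "1/2" "norm (1 + f c)" 2] by (simp add: power2_eq_square)
  have I0: "I \<ge> 0" unfolding I_def by (rule integral_nonneg) (use Iint in auto)
  have "A - 1 \<le> 4 * I"
  proof (cases "A \<ge> 1")
    case True
    have "1 / 4 * (A - 1) \<le> norm (1 + f c) ^ 2 * (A - 1)"
      by (rule mult_right_mono[OF q]) (use True in auto)
    then show ?thesis using le by simp
  qed (use I0 in auto)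
  then have "ln A \<le> 4 * I" using ln_le_minus_one[OF Apos] by simp
  then show ?thesis by (simp add: lnA I_def)
qed

section \<open>The Siegel integral along lines of slope one\<close>

definition eighth_root :: complex where "eighth_root = exp (\<i> * of_real (pi / 4))"

lemma Re_eighth_root [simp]: "Re eighth_root = sqrt 2 / 2"
  and Im_eighth_root [simp]: "Im eighth_root = sqrt 2 / 2"
  by (simp_all add: eighth_root_def Re_exp Im_exp cos_45 sin_45)

lemma norm_eighth_root [simp]: "norm eighth_root = 1"
  by (simp add: eighth_root_def)

text \<open>
  The line of slope \<open>1\<close> through the real point \<open>y\<close>, from upper right to lower left like the line that
  defines the auxiliary function, which is the case \<open>y = 1 / 2\<close>.
\<close>

definition slanted_line :: "real \<Rightarrow> real \<Rightarrow> complex" where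
  "slanted_line y u = of_real y - of_real u * eighth_root"

definition siegel_line_integral :: "real \<Rightarrow> complex \<Rightarrow> complex" where
  "siegel_line_integral y s = (LINT u|lborel. siegel_integrand s (slanted_line y u) * (- eighth_root))"

lemma riemann_aux_eq: "riemann_aux s = siegel_line_integral (1 / 2) s"
  by (simp add: riemann_aux_def siegel_line_integral_def siegel_line_def slanted_line_def eighth_root_def)

lemma slanted_line_eq: "slanted_line y u = Complex (y - u / sqrt 2) (- u / sqrt 2)"
  by (simp add: complex_eq_iff slanted_line_def real_div_sqrt field_simps)

lemma siegel_denominator: "exp (of_real pi * \<i> * x) - exp (- (of_real pi * \<i> * x)) = 2 * \<i> * sin (of_real pi * x)"
  by (simp add: sin_exp_eq mult_ac)

lemma norm_siegel_integrand:
  assumes "x \<noteq> 0"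
  shows "norm (siegel_integrand s x) =
     exp (- Re s * ln (norm x) + Im s * Arg x - 2 * pi * Re x * Im x) / (2 * norm (sin (of_real pi * x)))"
proof -
  have "norm (exp (of_real pi * \<i> * x ^ 2)) = exp (- 2 * pi * Re x * Im x)"
    by (simp add: power2_eq_square)
  moreover have "norm (x powr (- s)) = exp (- Re s * ln (norm x) + Im s * Arg x)"
    using assms by (simp add: powr_def Arg_eq_Im_Ln)
  ultimately show ?thesis
    unfolding siegel_integrand_def siegel_denominator
    by (simp add: norm_mult norm_divide exp_add[symmetric] mult_ac)
qed

lemma norm_siegel_integrand_le:
  assumes "x \<noteq> 0" "norm (sin (of_real pi * x)) \<ge> 1 / 2" "- Re s * ln (norm x) + Im s * Arg x - 2 * pi * Re x * Im x \<le> E"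
  shows "norm (siegel_integrand s x) \<le> exp E"
proof -
  have "norm (siegel_integrand s x) \<le> exp (- Re s * ln (norm x) + Im s * Arg x - 2 * pi * Re x * Im x) / 1"
    unfolding norm_siegel_integrand[OF assms(1)] using assms(2) by (intro divide_left_mono) auto
  also have "\<dots> \<le> exp E" using assms(3) by simp
  finally show ?thesis .
qed

lemma slanted_line_norm_ge: "y \<ge> 0 \<Longrightarrow> norm (slanted_line y u) \<ge> y / sqrt 2"
proof -
  assume y: "y \<ge> 0"
  define b where "b = u / sqrt 2"
  have "y\<^sup>2 / 2 \<le> (y - b)\<^sup>2 + b\<^sup>2"
    using zero_le_power2[of "y - 2 * b"] by (simp add: power2_eq_square algebra_simps)
  then have "sqrt (y\<^sup>2 / 2) \<le> sqrt ((y - b)\<^sup>2 + b\<^sup>2)" by (rule real_sqrt_le_mono)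
  then show ?thesis using y by (simp add: slanted_line_eq cmod_def b_def real_sqrt_divide)
qed

lemma slanted_line_norm_le: "y \<ge> 0 \<Longrightarrow> norm (slanted_line y u) \<le> y + \<bar>u\<bar>"
  unfolding slanted_line_def using norm_triangle_ineq4[of "of_real y" "of_real u * eighth_root"]
  by (simp add: norm_mult)

lemma slanted_line_nonpos: "y > 0 \<Longrightarrow> slanted_line y u \<notin> \<real>\<^sub>\<le>\<^sub>0"
  by (auto simp: slanted_line_eq complex_nonpos_Reals_iff)

lemma le_sinh: "x \<ge> 0 \<Longrightarrow> x \<le> sinh (x::real)"
  using real_le_x_sinh[of x] by (simp add: sinh_field_def exp_minus)

text \<open>
  On a line through a half-integer \<open>|sin (\<pi> x)|\<^sup>2 = cosh\<^sup>2 v - sin\<^sup>2 v\<close> where \<open>v\<close> is \<open>\<pi> Im x\<close> up to sign. This is at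
  least \<open>1\<close>, since \<open>cosh\<^sup>2 v \<ge> 1 + v\<^sup>2\<close> and \<open>sin\<^sup>2 v \<le> v\<^sup>2\<close>.
\<close>

lemma sin_norm_half_integer:
  "norm (sin (of_real pi * slanted_line (real n + 1 / 2) u)) \<ge> 1 / 2" (is "norm (sin ?x) \<ge> _")
proof -
  define v where "v = pi * (u / sqrt 2)"
  have c: "cos (2 * (pi * (real n + 1 / 2 - u / sqrt 2))) = - cos (2 * v)"
  proof -
    have "2 * (pi * (real n + 1 / 2 - u / sqrt 2)) = (pi - 2 * v) + 2 * real n * pi"
      by (simp add: v_def algebra_simps)
    moreover have "cos ((pi - 2 * v) + 2 * real n * pi) = - cos (2 * v)" by (subst cos_add) simp
    ultimately show ?thesis by simp
  qed
  have "norm (sin ?x) ^ 2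
        = (exp (- 2 * v) + inverse (exp (- 2 * v)) + 2 * cos (2 * v)) / 4"
    unfolding norm_sin_squared using c by (simp add: slanted_line_eq v_def algebra_simps)
  also have "exp (- 2 * v) + inverse (exp (- 2 * v)) = 2 * cosh (2 * v)"
    by (simp add: cosh_def exp_minus scaleR_conv_of_real)
  finally have eq: "norm (sin ?x) ^ 2 = (cosh (2 * v) + cos (2 * v)) / 2"
    by simp
  have "cosh (2 * v) + cos (2 * v) = 2 * (cosh v ^ 2 - sin v ^ 2)"
    by (simp add: cosh_double cos_double sinh_square_eq cos_squared_eq)
  also have "\<dots> \<ge> 1"
  proof -
    have "sin v ^ 2 \<le> v ^ 2" using abs_sin_x_le_abs_x[of v] by (simp add: abs_le_square_iff)
    moreover have "cosh v ^ 2 \<ge> 1 + v ^ 2"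
    proof -
      have "\<bar>v\<bar> \<le> sinh \<bar>v\<bar>" by (rule le_sinh) simp
      then have "v ^ 2 \<le> sinh v ^ 2"
        by (metis abs_ge_zero power2_abs power_mono sinh_real_abs)
      then show ?thesis by (simp add: cosh_square_eq)
    qed
    ultimately have "1 \<le> cosh v ^ 2 - sin v ^ 2" by linarith
    moreover have "1 \<le> a \<Longrightarrow> 1 \<le> 2 * a" for a :: real by simp
    ultimately show ?thesis by blast
  qed
  finally have "(1 / 2) ^ 2 \<le> norm (sin ?x) ^ 2"
    unfolding eq by (simp add: power2_eq_square)
  then show ?thesis by (rule power2_le_imp_le) auto
qed

lemma sin_norm_far:
  assumes "\<bar>Im x\<bar> \<ge> 1"
  shows "norm (sin (of_real pi * x)) \<ge> 1 / 2"
proof -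
  define v where "v = pi * Im x"
  have "norm (sin (of_real pi * x)) ^ 2 = (2 * cosh (2 * v) - 2 * cos (2 * (pi * Re x))) / 4"
    unfolding norm_sin_squared by (simp add: v_def cosh_def exp_minus scaleR_conv_of_real algebra_simps)
  also have "\<dots> \<ge> (2 * cosh (2 * v) - 2) / 4"
    using cos_le_one[of "2 * (pi * Re x)"] by (intro divide_right_mono) linarith+
  also have "(2 * cosh (2 * v) - 2) / 4 = sinh v ^ 2"
    by (simp add: cosh_double cosh_square_eq)
  finally have le: "sinh v ^ 2 \<le> norm (sin (of_real pi * x)) ^ 2" .
  have "1 \<le> \<bar>v\<bar>"
    using mult_mono[of 1 pi 1 "\<bar>Im x\<bar>"] assms pi_ge_two by (simp add: v_def abs_mult)
  also have "\<bar>v\<bar> \<le> sinh \<bar>v\<bar>" by (rule le_sinh) simp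
  finally have "1 ^ 2 \<le> sinh \<bar>v\<bar> ^ 2" by (intro power_mono) auto
  then have "(1 / 2) ^ 2 \<le> sinh v ^ 2" by (simp add: power2_eq_square)
  then have "(1 / 2) ^ 2 \<le> norm (sin (of_real pi * x)) ^ 2" using le by (rule order_trans)
  then show ?thesis by (rule power2_le_imp_le) auto
qed

text \<open>
  A domination that is uniform for \<open>s\<close> and \<open>y\<close> in bounded sets. It serves convergence, analyticity in
  \<open>s\<close> and the decay on the short sides of the contour; its constant is useless for large \<open>Im s\<close>.
\<close>

lemma siegel_integrand_gaussian_bound:
  assumes y: "1 / 2 \<le> y" "y \<le> Q" and s: "norm s \<le> B"
    and sin: "norm (sin (of_real pi * slanted_line y u)) \<ge> 1 / 2"
  shows "norm (siegel_integrand s (slanted_line y u)) \<le> exp (B * (Q + 7) + (B + 5 * Q)\<^sup>2 - u\<^sup>2)"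
proof -
  define x where "x = slanted_line y u"
  have s2: "1 < sqrt 2" by simp
  have s2': "sqrt 2 < 3 / 2" by (rule real_less_lsqrt) (auto simp: power2_eq_square)
  note s2 = s2 s2'
  have lo: "norm x \<ge> 1 / 3"
  proof -
    have "1 / 3 \<le> y / sqrt 2" using y s2 by (simp add: field_simps)
    then show ?thesis using slanted_line_norm_ge[of y u] y unfolding x_def by linarith
  qed
  have hi: "norm x \<le> Q + \<bar>u\<bar>" using slanted_line_norm_le[of y u] y unfolding x_def by linarith
  have B: "\<bar>Re s\<bar> \<le> B" "\<bar>Im s\<bar> \<le> B" "B \<ge> 0"
    using s abs_Re_le_cmod[of s] abs_Im_le_cmod[of s] norm_ge_zero[of s] by linarith+
  have ln: "\<bar>ln (norm x)\<bar> \<le> Q + \<bar>u\<bar> + 3"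
  proof -
    have "ln (norm x) \<le> norm x" using lo by (intro ln_bound) auto
    moreover have "- ln (norm x) \<le> 3"
    proof -
      have "- ln (norm x) = ln (1 / norm x)" using lo by (simp add: ln_div)
      also have "\<dots> \<le> 1 / norm x" using lo by (intro ln_bound) (auto intro!: divide_pos_pos)
      also have "\<dots> \<le> 3" using lo by (auto simp: field_simps divide_le_eq)
      finally show ?thesis .
    qed
    ultimately show ?thesis using hi y by linarith
  qed
  have 1: "- Re s * ln (norm x) \<le> B * (Q + \<bar>u\<bar> + 3)"
  proof -
    have "- Re s * ln (norm x) \<le> \<bar>Re s\<bar> * \<bar>ln (norm x)\<bar>"
      by (metis abs_ge_self abs_minus_cancel abs_mult)
    also have "\<dots> \<le> B * (Q + \<bar>u\<bar> + 3)" by (intro mult_mono B ln) (use B in auto)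
    finally show ?thesis .
  qed
  have 2: "Im s * Arg x \<le> B * 4"
  proof -
    have "Im s * Arg x \<le> \<bar>Im s\<bar> * \<bar>Arg x\<bar>" by (metis abs_ge_self abs_mult)
    also have "\<dots> \<le> B * 4" using mpi_less_Arg[of x] Arg_le_pi[of x] pi_less_4
      by (intro mult_mono B) (use B in auto)
    finally show ?thesis .
  qed
  have 3: "- 2 * pi * Re x * Im x \<le> 5 * Q * \<bar>u\<bar> - 3 * u\<^sup>2"
  proof -
    have "- 2 * pi * Re x * Im x = (pi * sqrt 2) * (y * u) - pi * u\<^sup>2"
      by (simp add: x_def slanted_line_eq field_simps power2_eq_square)
    also have "(pi * sqrt 2) * (y * u) \<le> 5 * (Q * \<bar>u\<bar>)"
    proof -
      have "(pi * sqrt 2) * (y * u) \<le> (pi * sqrt 2) * (Q * \<bar>u\<bar>)"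
        using y by (intro mult_left_mono) (auto intro: order_trans[OF _ mult_right_mono[of y Q "\<bar>u\<bar>"]] simp: mult_left_mono)
      also have "pi * sqrt 2 \<le> 5"
      proof -
        have "pi * sqrt 2 \<le> 3.2 * (3/2)" by (intro mult_mono) (use pi_approx s2 in auto)
        then show ?thesis by simp
      qed
      then have "(pi * sqrt 2) * (Q * \<bar>u\<bar>) \<le> 5 * (Q * \<bar>u\<bar>)" using y by (intro mult_right_mono) auto
      finally show ?thesis .
    qed
    also have "pi * u\<^sup>2 \<ge> 3 * u\<^sup>2" using pi_gt3 by (intro mult_right_mono) auto
    ultimately show ?thesis by linarith
  qed
  have 4: "(B + 5 * Q) * \<bar>u\<bar> \<le> (B + 5 * Q)\<^sup>2 + u\<^sup>2"
  proof -
    have "0 \<le> (B + 5 * Q) * \<bar>u\<bar>" using B y by simp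
    moreover have "2 * (B + 5 * Q) * \<bar>u\<bar> \<le> (B + 5 * Q)\<^sup>2 + u\<^sup>2"
      using sum_squares_bound[of "B + 5 * Q" "\<bar>u\<bar>"] by simp
    ultimately show ?thesis by linarith
  qed
  have x0: "x \<noteq> 0" using lo by auto
  have "- Re s * ln (norm x) \<le> B * Q + B * \<bar>u\<bar> + 3 * B" using 1 by (simp add: algebra_simps)
  moreover have "B * \<bar>u\<bar> + 5 * Q * \<bar>u\<bar> \<le> (B + 5 * Q)\<^sup>2 + u\<^sup>2" using 4 by (simp add: algebra_simps)
  moreover have "B * (Q + 7) = B * Q + 7 * B" by (simp add: algebra_simps)
  ultimately have "- Re s * ln (norm x) + Im s * Arg x - 2 * pi * Re x * Im x \<le> B * (Q + 7) + (B + 5 * Q)\<^sup>2 - u\<^sup>2"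
    using 2 3 zero_le_power2[of u] by linarith
  from norm_siegel_integrand_le[OF x0 _ this] sin show ?thesis by (simp add: x_def)
qed

lemma integrable_gaussian:
  assumes "a > 0" shows "integrable lborel (\<lambda>u::real. exp (K - a * u\<^sup>2))"
proof -
  define \<sigma> where "\<sigma> = sqrt (1 / (2 * a))"
  have s: "2 * \<sigma>\<^sup>2 = 1 / a" using assms by (simp add: \<sigma>_def)
  have "integrable lborel (\<lambda>u. (exp K * sqrt (2 * pi * \<sigma>\<^sup>2)) * normal_density 0 \<sigma> u)"
    by (intro integrable_mult_right integrable_normal_density)
       (use assms in \<open>auto simp: \<sigma>_def\<close>)
  also have "(\<lambda>u. (exp K * sqrt (2 * pi * \<sigma>\<^sup>2)) * normal_density 0 \<sigma> u) = (\<lambda>u. exp (K - a * u\<^sup>2))"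
    using assms s by (auto simp: normal_density_def exp_diff exp_minus fun_eq_iff field_simps \<sigma>_def)
  finally show ?thesis .
qed

lemma integral_interval_eq_lborel:
  fixes f :: "real \<Rightarrow> 'a::euclidean_space"
  assumes "integrable lborel f"
  shows "integral {a..b} f = (LINT u|lborel. indicator {a..b} u *\<^sub>R f u)"
proof -
  have "set_integrable lborel {a..b} f"
    unfolding set_integrable_def by (rule integrable_mult_indicator[OF _ assms]) auto
  from set_borel_integral_eq_integral(2)[OF this] show ?thesis
    by (simp add: set_lebesgue_integral_def)
qed

lemma integral_truncate_tendsto:
  fixes f :: "real \<Rightarrow> 'a::euclidean_space"
  assumes int: "integrable lborel f"
  shows "(\<lambda>n. integral {- real n..real n} f) \<longlonglongrightarrow> (LINT u|lborel. f u)"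
proof -
  have "(\<lambda>n. LINT u|lborel. indicator {- real n..real n} u *\<^sub>R f u) \<longlonglongrightarrow> (LINT u|lborel. f u)"
  proof (rule integral_dominated_convergence[where w = "\<lambda>u. norm (f u)"])
    show "AE u in lborel. (\<lambda>n. indicator {- real n..real n} u *\<^sub>R f u) \<longlonglongrightarrow> f u"
    proof (rule AE_I2, rule tendsto_eventually)
      fix u :: real
      obtain N :: nat where N: "\<bar>u\<bar> \<le> real N" using real_arch_simple by blast
      show "eventually (\<lambda>n. indicator {- real n..real n} u *\<^sub>R f u = f u) sequentially"
        using eventually_ge_at_top[of N] by eventually_elim (use N in \<open>auto simp: indicator_def\<close>)
    qed
  qed (use int in \<open>auto simp: indicator_def\<close>)
  then show ?thesis by (simp only: integral_interval_eq_lborel[OF int])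
qed

section \<open>The auxiliary function is entire\<close>

lemma continuous_on_slanted_line [continuous_intros]:
  "continuous_on A f \<Longrightarrow> continuous_on A (\<lambda>p. slanted_line y (f p))"
  unfolding slanted_line_def by (intro continuous_intros)

lemma continuous_siegel_integrand:
  assumes y: "y > 0" and sin: "\<And>u. sin (of_real pi * slanted_line y u) \<noteq> 0"
    and f: "continuous_on (A :: 'a :: t2_space set) f" and g: "continuous_on A g"
  shows "continuous_on A (\<lambda>p. siegel_integrand (f p) (slanted_line y (g p)))"
  unfolding siegel_integrand_def siegel_denominator
proof (rule continuous_on_divide)
  show "continuous_on A (\<lambda>p. slanted_line y (g p) powr - f p * exp (complex_of_real pi * \<i> * (slanted_line y (g p))\<^sup>2))"
  proof (intro continuous_intros f g)
    show "A \<subseteq> {x. 0 \<le> Re (slanted_line y (g x)) \<or> Im (slanted_line y (g x)) \<noteq> 0}"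
      using y by (auto simp: slanted_line_eq)
    show "0 < Re (- f x)" if "slanted_line y (g x) = 0" for x
      using slanted_line_nonpos[OF y, of "g x"] that by simp
  qed
  show "continuous_on A (\<lambda>p. 2 * \<i> * sin (complex_of_real pi * slanted_line y (g p)))"
    by (intro continuous_on_mult continuous_on_const continuous_on_sin continuous_on_slanted_line g)
  show "\<forall>p\<in>A. 2 * \<i> * sin (complex_of_real pi * slanted_line y (g p)) \<noteq> 0"
    using sin by simp
qed

lemma sin_half_integer_nonzero: "sin (of_real pi * slanted_line (real n + 1 / 2) u) \<noteq> 0"
proof
  assume "sin (of_real pi * slanted_line (real n + 1 / 2) u) = 0"
  then show False using sin_norm_half_integer[of n u] by (simp only: norm_zero)
qed

lemma siegel_integrand_continuous_u:
  "continuous_on A (\<lambda>u. siegel_integrand s (slanted_line (real n + 1 / 2) u))"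
proof -
  have "real n + 1 / 2 > 0" by simp
  from continuous_siegel_integrand[OF this sin_half_integer_nonzero continuous_on_const continuous_on_id]
  show ?thesis .
qed

lemma siegel_integrand_integrable:
  "integrable lborel (\<lambda>u. siegel_integrand s (slanted_line (real n + 1 / 2) u))"
proof (rule Bochner_Integration.integrable_bound)
  define K where "K = norm s * (real n + 1 / 2 + 7) + (norm s + 5 * (real n + 1 / 2))\<^sup>2"
  show "integrable lborel (\<lambda>u::real. exp (K - 1 * u\<^sup>2))" by (rule integrable_gaussian) auto
  show "AE u in lborel. norm (siegel_integrand s (slanted_line (real n + 1 / 2) u)) \<le> norm (exp (K - 1 * u\<^sup>2))"
    using siegel_integrand_gaussian_bound[of "real n + 1/2" "real n + 1/2" s "norm s"] sin_norm_half_integer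
    by (auto simp: K_def)
  show "(\<lambda>u. siegel_integrand s (slanted_line (real n + 1 / 2) u)) \<in> borel_measurable lborel"
    using borel_measurable_continuous_onI[OF siegel_integrand_continuous_u] by simp
qed

text \<open>
  The integrals over \<open>{-n..n}\<close> are entire by differentiation under the integral sign, and they
  converge locally uniformly by the Gaussian domination.
\<close>

lemma riemann_aux_holomorphic: "riemann_aux holomorphic_on UNIV"
proof (rule holomorphic_uniform_sequence)
  define F where "F s u = siegel_integrand s (slanted_line (1 / 2) u) * (- eighth_root)" for s u
  have sin0: "sin (of_real pi * slanted_line (1 / 2) u) \<noteq> 0" for u
    using sin_half_integer_nonzero[of 0 u] by simp
  have nonpos: "slanted_line (1 / 2) u \<notin> \<real>\<^sub>\<le>\<^sub>0" for u by (rule slanted_line_nonpos) simp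
  have nz: "slanted_line (1 / 2) u \<noteq> 0" for u using nonpos[of u] by auto
  have F_cont: "continuous_on A (\<lambda>p. F (fst p) (snd p))" for A
    unfolding F_def by (intro continuous_on_mult continuous_siegel_integrand sin0 continuous_intros) simp
  have F_cont_u: "continuous_on A (F s)" for s A
    unfolding F_def by (intro continuous_on_mult continuous_siegel_integrand sin0 continuous_intros) simp
  have F_int: "integrable lborel (F s)" for s
    using siegel_integrand_integrable[of s 0] unfolding F_def by simp
  show "(\<lambda>s. integral (cbox (- real n) (real n)) (F s)) holomorphic_on UNIV" for n
  proof (rule leibniz_rule_holomorphic)
    show "((\<lambda>s. F s u) has_field_derivative - Ln (slanted_line (1 / 2) u) * F s u) (at s within UNIV)" for s u
      unfolding F_def siegel_integrand_def siegel_denominator using nz[of u] sin0[of u]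
      by (auto intro!: derivative_eq_intros simp: powr_def divide_simps)
    show "F s integrable_on cbox (- real n) (real n)" for s
      using integrable_continuous_interval[OF F_cont_u] by simp
    show "continuous_on (UNIV \<times> cbox (- real n) (real n)) (\<lambda>(s, u). - Ln (slanted_line (1 / 2) u) * F s u)"
    proof -
      have "continuous_on (UNIV \<times> cbox (- real n) (real n)) (\<lambda>p. - Ln (slanted_line (1 / 2) (snd p)))"
        by (intro continuous_intros) (simp add: nonpos)
      from continuous_on_mult[OF this F_cont]
      show ?thesis by (simp add: case_prod_unfold)
    qed
  qed auto
  fix s0 :: complex
  define K where "K = (norm s0 + 1) * (1 / 2 + 7) + (norm s0 + 1 + 5 * (1 / 2))\<^sup>2"
  define g where "g u = exp (K - 1 * u\<^sup>2)" for u :: real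
  have g_int: "integrable lborel g" unfolding g_def by (rule integrable_gaussian) auto
  have g0: "g u \<ge> 0" for u by (simp add: g_def)
  have F_le: "norm (F s u) \<le> g u" if "s \<in> cball s0 1" for s u
  proof -
    have "norm s \<le> norm s0 + 1" using that norm_triangle_ineq2[of s s0] by (simp add: dist_norm norm_minus_commute)
    then show ?thesis
      using siegel_integrand_gaussian_bound[of "1/2" "1/2" s "norm s0 + 1" u] sin_norm_half_integer[of 0 u]
      by (simp add: F_def norm_mult g_def K_def)
  qed
  define e where "e n = (LINT u|lborel. g u) - integral {- real n..real n} g" for n :: nat
  note trunc = integral_interval_eq_lborel
  have ind: "integrable lborel (\<lambda>u. indicator {- real n..real n} u *\<^sub>R f u)"
    if "integrable lborel f" for n and f :: "real \<Rightarrow> 'a::euclidean_space"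
    by (rule integrable_mult_indicator[OF _ that]) auto
  have e0: "e \<longlonglongrightarrow> 0"
  proof -
    have "e \<longlonglongrightarrow> (LINT u|lborel. g u) - (LINT u|lborel. g u)"
      unfolding e_def by (intro tendsto_diff tendsto_const integral_truncate_tendsto g_int)
    then show ?thesis by simp
  qed
  have diff: "norm (riemann_aux s - integral (cbox (- real n) (real n)) (F s)) \<le> e n" if s: "s \<in> cball s0 1" for s n
  proof -
    have "riemann_aux s - integral {- real n..real n} (F s) =
        (LINT u|lborel. F s u) - (LINT u|lborel. indicator {- real n..real n} u *\<^sub>R F s u)"
      unfolding trunc[OF F_int] by (simp add: riemann_aux_eq siegel_line_integral_def F_def)
    also have "\<dots> = (LINT u|lborel. F s u - indicator {- real n..real n} u *\<^sub>R F s u)"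
      by (rule Bochner_Integration.integral_diff[symmetric]) (intro F_int ind)+
    also have "norm \<dots> \<le> (LINT u|lborel. g u - indicator {- real n..real n} u *\<^sub>R g u)"
    proof (rule Bochner_Integration.integral_norm_bound_integral)
      show "norm (F s u - indicator {- real n..real n} u *\<^sub>R F s u) \<le> g u - indicator {- real n..real n} u *\<^sub>R g u" for u
        using F_le[OF s, of u] by (auto simp: indicator_def)
    qed (intro Bochner_Integration.integrable_diff F_int g_int ind)+
    also have "\<dots> = e n"
      unfolding e_def trunc[OF g_int] by (rule Bochner_Integration.integral_diff) (intro g_int ind)+
    finally show ?thesis by simp
  qed
  have "uniform_limit (cball s0 1) (\<lambda>n s. integral (cbox (- real n) (real n)) (F s)) riemann_aux sequentially"
  proof (rule uniform_limitI)
    fix d :: real assume "d > 0"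
    then have "eventually (\<lambda>n. e n < d) sequentially" using e0 by (simp add: order_tendstoD)
    then show "\<forall>\<^sub>F n in sequentially. \<forall>s\<in>cball s0 1. dist (integral (cbox (- real n) (real n)) (F s)) (riemann_aux s) < d"
    proof eventually_elim
      case (elim n)
      show ?case
      proof
        fix s assume "s \<in> cball s0 1"
        from diff[OF this, of n] elim
        show "dist (integral (cbox (- real n) (real n)) (F s)) (riemann_aux s) < d"
          by (simp add: dist_norm norm_minus_commute)
      qed
    qed
  qed
  then show "\<exists>d>0. cball s0 d \<subseteq> UNIV \<and> uniform_limit (cball s0 d) (\<lambda>n s. integral (cbox (- real n) (real n)) (F s)) riemann_aux sequentially"
    by (intro exI[of _ 1]) auto
qed auto

section \<open>Moving the line of integration across the poles\<close>

lemma slanted_line_rotated: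
  "of_real y + cnj eighth_root * Complex p v = slanted_line (y + sqrt 2 * p) (p - v)"
proof -
  have "sqrt 2 * p = 2 * (sqrt 2 / 2 * p)" by simp
  then show ?thesis
    by (simp add: complex_eq_iff slanted_line_def algebra_simps)
qed

lemma sin_pi_slanted_nonzero:
  assumes p: "\<bar>sqrt 2 * p\<bar> < 1" and "sin (of_real pi * slanted_line (real N + sqrt 2 * p) u) = 0"
  shows "p = 0" "u = 0"
proof -
  define x where "x = slanted_line (real N + sqrt 2 * p) u"
  obtain k :: int where k: "of_real pi * x = of_real (of_int k * pi)"
    using assms(2) unfolding x_def[symmetric] sin_eq_0 by blast
  then have "of_real pi * x = of_real pi * of_int k" by (simp add: mult.commute)
  then have xk: "x = of_int k" by simp
  then have "Im x = 0" by simp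
  then show u: "u = 0" by (simp add: x_def slanted_line_eq)
  have "real N + sqrt 2 * p = of_int k"
    using arg_cong[OF xk, of Re] by (simp add: x_def slanted_line_eq u)
  then have eq: "sqrt 2 * p = of_int (k - int N)" by simp
  then have "\<bar>real_of_int (k - int N)\<bar> < 1" using p by simp
  then have "k - int N = 0" by linarith
  then show "p = 0" using eq by simp
qed

lemma open_vertical_strip: "open {w. \<bar>Re w\<bar> < c}"
  unfolding abs_less_iff by (intro open_Collect_conj open_Collect_less continuous_intros)

lemma convex_vertical_strip: "convex {w. \<bar>Re w\<bar> < c}"
proof -
  have "{w. \<bar>Re w\<bar> < c} = {w. Re w < c} \<inter> {w. Re w > - c}" by auto
  then show ?thesis by (auto intro: convex_Int convex_halfspace_Re_lt convex_halfspace_Re_gt)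
qed

text \<open>
  The residue theorem for the rectangles with corners \<open>\<plusminus> h \<plusminus> i n\<close>; by the decay of \<open>G\<close> the
  horizontal sides do not matter in the limit.
\<close>

lemma strip_integrals_residue:
  assumes h: "0 < h" "h < c" and G: "G holomorphic_on {w. \<bar>Re w\<bar> < c} - {0}"
    and decay: "\<And>p v n. \<bar>p\<bar> \<le> h \<Longrightarrow> \<bar>v\<bar> = real n \<Longrightarrow> n \<ge> 2 \<Longrightarrow> norm (G (Complex p v)) \<le> exp (C - real n)"
  shows "(\<lambda>n. \<i> * integral {- real n..real n} (\<lambda>v. G (Complex h v)) - \<i> * integral {- real n..real n} (\<lambda>v. G (Complex (- h) v)))
    \<longlonglongrightarrow> 2 * pi * \<i> * residue G 0"
proof -
  define S where "S = {w. \<bar>Re w\<bar> < c}"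
  have S: "open S" "convex S" unfolding S_def by (rule open_vertical_strip convex_vertical_strip)+
  define I where "I a b = contour_integral (linepath a b) G" for a b
  define side where "side p n = \<i> * integral {- real n..real n} (\<lambda>v. G (Complex p v))" for p n
  define bl br tr tl where "bl n = Complex (- h) (- real n)" and "br n = Complex h (- real n)"
    and "tr n = Complex h (real n)" and "tl n = Complex (- h) (real n)" for n
  note corner = bl_def br_def tr_def tl_def
  have total: "I (bl n) (br n) + side h n + I (tr n) (tl n) - side (- h) n = 2 * pi * \<i> * residue G 0"
    and horizontal: "n \<ge> 2 \<Longrightarrow> norm (I (bl n) (br n) + I (tr n) (tl n)) \<le> exp (C - real n) * (4 * h)" if n: "n > 0" for n
  proof -
    have rect: "rectpath (bl n) (tr n) = linepath (bl n) (br n) +++ linepath (br n) (tr n) +++ linepath (tr n) (tl n) +++ linepath (tl n) (bl n)"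
      by (simp add: rectpath_def corner Let_def)
    have pimg: "path_image (rectpath (bl n) (tr n)) \<subseteq> S - {0}"
      using h n by (subst path_image_rectpath) (auto simp: corner S_def)
    have seg: "closed_segment (bl n) (br n) \<subseteq> S - {0}" "closed_segment (br n) (tr n) \<subseteq> S - {0}"
      "closed_segment (tr n) (tl n) \<subseteq> S - {0}" "closed_segment (tl n) (bl n) \<subseteq> S - {0}"
      using pimg unfolding rect by (auto simp: path_image_join)
    have integ: "G contour_integrable_on linepath a b" if "closed_segment a b \<subseteq> S - {0}" for a b
      by (rule contour_integrable_continuous_linepath)
         (rule continuous_on_subset[OF holomorphic_on_imp_continuous_on[OF G[folded S_def]] that])
    have res: "contour_integral (rectpath (bl n) (tr n)) G
        = 2 * pi * \<i> * (\<Sum>p\<in>{0}. winding_number (rectpath (bl n) (tr n)) p * residue G p)"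
    proof (rule Residue_theorem[OF S(1) convex_connected[OF S(2)]])
      show "\<forall>z. z \<notin> S \<longrightarrow> winding_number (rectpath (bl n) (tr n)) z = 0"
        using winding_number_zero_outside[OF _ S(2), of "rectpath (bl n) (tr n)"] pimg by auto
    qed (use pimg G in \<open>auto simp: S_def\<close>)
    have "winding_number (rectpath (bl n) (tr n)) 0 = 1"
      by (rule winding_number_rectpath) (use h n in \<open>auto simp: in_box_complex_iff corner\<close>)
    with res have "contour_integral (rectpath (bl n) (tr n)) G = 2 * pi * \<i> * residue G 0" by simp
    then have "I (bl n) (br n) + I (br n) (tr n) + I (tr n) (tl n) + I (tl n) (bl n) = 2 * pi * \<i> * residue G 0"
      unfolding rect I_def using integ seg by (simp add: add.assoc)
    moreover have up: "I (Complex p (- real n)) (Complex p (real n)) = side p n" for p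
      unfolding I_def side_def using n by (intro contour_integral_linepath_same_Re) auto
    moreover have "I (tl n) (bl n) = - side (- h) n"
      using up[of "- h"] contour_integral_reversepath[of "linepath (bl n) (tl n)" G] by (simp add: I_def corner)
    ultimately show "I (bl n) (br n) + side h n + I (tr n) (tl n) - side (- h) n = 2 * pi * \<i> * residue G 0"
      by (simp add: corner)
    assume n2: "n \<ge> 2"
    have bound: "norm (I a b) \<le> exp (C - real n) * (2 * h)"
      if ab: "Im a = v" "Im b = v" "\<bar>Re a\<bar> = h" "\<bar>Re b\<bar> = h" "Re b = - Re a" "\<bar>v\<bar> = real n" "closed_segment a b \<subseteq> S - {0}" for a b v
    proof -
      have "norm (I a b) \<le> exp (C - real n) * norm (b - a)"
        unfolding I_def
      proof (rule contour_integral_bound_linepath[OF integ[OF ab(7)]])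
        fix z assume "z \<in> closed_segment a b"
        then have "\<bar>Re z\<bar> \<le> h \<and> Im z = v"
          using ab by (subst (asm) closed_segment_same_Im) (auto simp: closed_segment_eq_real_ivl split: if_splits)
        then show "norm (G z) \<le> exp (C - real n)"
          using decay[of "Re z" "Im z" n] n2 ab(6) by (simp only: complex_surj) auto
      qed auto
      also have "b - a = of_real (- 2 * Re a)" using ab by (simp add: complex_eq_iff)
      also have "norm (of_real (- 2 * Re a) :: complex) = 2 * h" using ab by (simp add: abs_mult del: of_real_mult)
      finally show ?thesis .
    qed
    have "norm (I (bl n) (br n)) \<le> exp (C - real n) * (2 * h)"
      by (rule bound[OF _ _ _ _ _ _ seg(1), of "- real n"]) (use h in \<open>simp_all add: corner\<close>)
    moreover have "norm (I (tr n) (tl n)) \<le> exp (C - real n) * (2 * h)"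
      by (rule bound[OF _ _ _ _ _ _ seg(3), of "real n"]) (use h in \<open>simp_all add: corner\<close>)
    ultimately show "norm (I (bl n) (br n) + I (tr n) (tl n)) \<le> exp (C - real n) * (4 * h)"
      using norm_triangle_ineq[of "I (bl n) (br n)" "I (tr n) (tl n)"] by simp
  qed
  have "(\<lambda>n. I (bl n) (br n) + I (tr n) (tl n)) \<longlonglongrightarrow> 0"
  proof (rule Lim_null_comparison)
    show "eventually (\<lambda>n. norm (I (bl n) (br n) + I (tr n) (tl n)) \<le> exp (C - real n) * (4 * h)) sequentially"
      using eventually_ge_at_top[of 2] by eventually_elim (rule horizontal, auto)
    show "(\<lambda>n. exp (C - real n) * (4 * h)) \<longlonglongrightarrow> 0" by real_asymp
  qed
  then have "(\<lambda>n. 2 * pi * \<i> * residue G 0 - (I (bl n) (br n) + I (tr n) (tl n))) \<longlonglongrightarrow> 2 * pi * \<i> * residue G 0 - 0"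
    by (intro tendsto_diff tendsto_const)
  moreover have "eventually (\<lambda>n. 2 * pi * \<i> * residue G 0 - (I (bl n) (br n) + I (tr n) (tl n)) = side h n - side (- h) n) sequentially"
    using eventually_gt_at_top[of 0]
  proof eventually_elim
    case (elim n)
    show ?case unfolding total[OF elim, symmetric] by simp
  qed
  ultimately show ?thesis
    unfolding side_def diff_0_right by (rule Lim_transform_eventually)
qed

text \<open>
  The difference is \<open>2\<pi>i\<close> times the residue of the integrand at \<open>x = m + 1\<close>. There both
  \<open>e\<^bsup>\<pi>ix\<^sup>2\<^esup>\<close> and \<open>cos (\<pi> x)\<close> are equal to \<open>(-1)\<^bsup>m+1\<^esup>\<close>, so the signs cancel.
\<close>

lemma siegel_line_shift:
  "siegel_line_integral (real m + 1 / 2) s - siegel_line_integral (real (Suc m) + 1 / 2) s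
     = of_nat (Suc m) powr (- s)"
proof -
  define N where "N = Suc m"
  define q where "q = cnj eighth_root"
  define c where "c = sqrt 2 / 2"
  define h where "h = sqrt 2 / 4"
  \<comment> \<open>In the coordinate \<open>w\<close> both lines are vertical, at distance \<open>h\<close> from \<open>0\<close>, and the pole is at \<open>w = 0\<close>;
    the strip \<open>|Re w| < c\<close> is bounded by the lines through the next integers, so it avoids the other
    poles and the branch cut.\<close>
  define x where "x w = of_nat N + q * w" for w
  define G where "G w = q * siegel_integrand s (x w)" for w
  define side where "side p n = \<i> * integral {- real n..real n} (\<lambda>v. G (Complex p v))" for p n
  define S where "S = {w. \<bar>Re w\<bar> < c}"
  have N: "N \<ge> 1" by (simp add: N_def)
  have h: "0 < h" "h < c" "h \<le> 1 / 2" "sqrt 2 * h = 1 / 2"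
    by (auto simp: h_def c_def field_simps real_le_lsqrt)
  have sq: "sqrt 2 * c = 1" by (simp add: c_def)
  have x_line: "x (Complex p v) = slanted_line (real N + sqrt 2 * p) (p - v)" for p v
    using slanted_line_rotated[of "real N" p v] by (simp add: x_def q_def)
  have strip: "\<bar>sqrt 2 * p\<bar> < 1" if "\<bar>p\<bar> < c" for p
    using mult_strict_left_mono[OF that, of "sqrt 2"] sq by (simp add: abs_mult)
  have x_nonpos: "x w \<notin> \<real>\<^sub>\<le>\<^sub>0" if "w \<in> S" for w
  proof -
    have "real N + sqrt 2 * Re w > 0"
      using strip[of "Re w"] that N by (simp add: S_def)
    from slanted_line_nonpos[OF this] show ?thesis
      using x_line[of "Re w" "Im w"] by simp
  qed
  have x_sin: "w = 0" if "w \<in> S" "sin (of_real pi * x w) = 0" for w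
  proof -
    have "Re w = 0" "Re w - Im w = 0"
      using sin_pi_slanted_nonzero[of "Re w" N "Re w - Im w"] strip[of "Re w"] that x_line[of "Re w" "Im w"]
      by (simp_all add: S_def)
    then show ?thesis by (simp add: complex_eq_iff)
  qed
  define f where "f w = q * (x w powr (- s) * exp (of_real pi * \<i> * x w ^ 2))" for w
  define g where "g w = exp (of_real pi * \<i> * x w) - exp (- (of_real pi * \<i> * x w))" for w
  have G_eq: "G w = f w / g w" for w
    by (simp add: G_def f_def g_def siegel_integrand_def)
  have S_open: "open S" unfolding S_def by (rule open_vertical_strip)
  have S_convex: "convex S" unfolding S_def by (rule convex_vertical_strip)
  have f_hol: "f holomorphic_on S"
    unfolding f_def using x_nonpos unfolding x_def by (auto intro!: holomorphic_intros)
  have g_hol: "g holomorphic_on S"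
    unfolding g_def x_def by (intro holomorphic_intros)
  have g_nz: "g w \<noteq> 0" if "w \<in> S - {0}" for w
    using x_sin[of w] that unfolding g_def siegel_denominator by auto
  have G_hol: "G holomorphic_on S - {0}"
    unfolding G_eq using g_nz
    by (intro holomorphic_on_divide holomorphic_on_subset[OF f_hol] holomorphic_on_subset[OF g_hol]) auto
  have zero_S: "0 \<in> S" using h by (simp add: S_def)
  have q_nz: "q \<noteq> 0" by (metis norm_eighth_root q_def complex_mod_cnj norm_zero zero_neq_one)
  have residue: "residue G 0 = of_nat N powr (- s) / (2 * of_real pi * \<i>)"
  proof -
    have cosN: "exp (of_real pi * \<i> * of_nat N) = (-1) ^ N"
      by (metis exp_pi_i exp_of_nat_mult mult.assoc mult.commute)
    have cosN': "exp (- (of_real pi * \<i> * of_nat N)) = (-1) ^ N"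
      unfolding exp_minus cosN by (simp add: power_inverse[symmetric])
    have sqN: "exp (of_real pi * \<i> * of_nat N ^ 2) = (-1) ^ N"
    proof -
      have "exp (of_real pi * \<i> * of_nat N ^ 2) = exp (of_nat N * (of_real pi * \<i> * of_nat N))"
        by (simp add: power2_eq_square mult_ac)
      also have "\<dots> = ((-1) ^ N) ^ N" by (simp only: exp_of_nat_mult cosN)
      also have "\<dots> = (-1) ^ N" by (cases "even N") auto
      finally show ?thesis .
    qed
    have deriv: "(g has_field_derivative (2 * of_real pi * \<i> * q * (-1) ^ N)) (at 0)"
      unfolding g_def x_def
      by (rule derivative_eq_intros refl | simp add: cosN cosN')+
    have "residue G 0 = f 0 / (2 * of_real pi * \<i> * q * (-1) ^ N)"
      unfolding G_eq
      by (rule residue_simple_pole_deriv[OF f_hol g_hol S_open convex_connected[OF S_convex] zero_S deriv])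
         (use N q_nz in \<open>auto simp: f_def g_def x_def cosN cosN'\<close>)
    also have "\<dots> = of_nat N powr (- s) / (2 * of_real pi * \<i>)"
      using q_nz by (simp add: f_def x_def sqN)
    finally show ?thesis .
  qed
  define C where "C = norm s * (real N + 1 / 2 + 7) + (norm s + 5 * (real N + 1 / 2))\<^sup>2"
  \<comment> \<open>On the short sides of the rectangle the factor \<open>exp (- u\<^sup>2)\<close> of the Gaussian bound is at most
    \<open>exp (- n)\<close>.\<close>
  have small: "norm (G (Complex p v)) \<le> exp (C - real n)"
    if p: "\<bar>p\<bar> \<le> h" and v: "\<bar>v\<bar> = real n" and n: "n \<ge> 2" for p v n
  proof -
    define u where "u = p - v"
    have u: "\<bar>u\<bar> \<ge> real n - 1 / 2" using p v h unfolding u_def by linarith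
    then have "(real n - 1 / 2)\<^sup>2 \<le> \<bar>u\<bar>\<^sup>2" using n by (intro power_mono) auto
    then have "(real n - 1 / 2)\<^sup>2 \<le> u\<^sup>2" by simp
    moreover have "real n \<le> (real n - 1 / 2)\<^sup>2"
    proof -
      have "0 \<le> real n * (real n - 2)" using n by simp
      then show ?thesis by (simp add: power2_eq_square algebra_simps)
    qed
    ultimately have un: "real n \<le> u\<^sup>2" by linarith
    have "sqrt 2 * \<bar>p\<bar> \<le> 1 / 2" using mult_left_mono[OF p, of "sqrt 2"] h by simp
    then have p2: "\<bar>sqrt 2 * p\<bar> \<le> 1 / 2" by (simp add: abs_mult)
    have "sqrt 2 \<le> 3 / 2" by (rule real_le_lsqrt) (auto simp: power2_eq_square)
    then have "sqrt 2 \<le> \<bar>u\<bar>" using u n by linarith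
    then have "\<bar>Im (slanted_line (real N + sqrt 2 * p) u)\<bar> \<ge> 1"
      by (simp add: slanted_line_eq abs_divide)
    then have sin: "norm (sin (of_real pi * slanted_line (real N + sqrt 2 * p) u)) \<ge> 1 / 2"
      by (rule sin_norm_far)
    have "norm (siegel_integrand s (slanted_line (real N + sqrt 2 * p) u)) \<le> exp (C - u\<^sup>2)"
      unfolding C_def by (rule siegel_integrand_gaussian_bound[OF _ _ order_refl sin]) (use p2 N in linarith)+
    also have "\<dots> \<le> exp (C - real n)" using un by simp
    finally show ?thesis by (simp add: G_def x_line norm_mult q_def u_def)
  qed
  have iq: "\<i> * q = eighth_root" by (simp add: q_def complex_eq_iff)
  have vertical: "side p \<longlonglongrightarrow> - siegel_line_integral (real k + 1 / 2) s"
    if "real N + sqrt 2 * p = real k + 1 / 2" for p k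
  proof -
    define F where "F u = siegel_integrand s (slanted_line (real k + 1 / 2) u) * (- eighth_root)" for u
    have F_int: "integrable lborel F"
      unfolding F_def using siegel_integrand_integrable[of s k] by simp
    have eq: "side p n = - integral {- real n..real n} (\<lambda>v. F (p + (-1) * v))" for n
    proof -
      have "\<i> * G (Complex p v) = - F (p + (-1) * v)" for v
        unfolding G_def x_line that F_def mult.assoc[symmetric] iq by simp
      then have "integral {- real n..real n} (\<lambda>v. \<i> * G (Complex p v)) = integral {- real n..real n} (\<lambda>v. - F (p + (-1) * v))"
        by presburger
      then show ?thesis unfolding integral_mult_right integral_neg side_def .
    qed
    have "(\<lambda>n. integral {- real n..real n} (\<lambda>v. F (p + (-1) * v))) \<longlonglongrightarrow> (LINT v|lborel. F (p + (-1) * v))"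
      using lborel_integrable_real_affine[OF F_int, of "-1" p] by (intro integral_truncate_tendsto) simp
    also have "(LINT v|lborel. F (p + (-1) * v)) = (LINT u|lborel. F u)"
      using lborel_integral_real_affine[of "-1" F p] by simp
    also have "\<dots> = siegel_line_integral (real k + 1 / 2) s"
      by (simp add: siegel_line_integral_def F_def)
    finally show ?thesis unfolding eq[abs_def] by (rule tendsto_minus)
  qed
  have "(\<lambda>n. side h n - side (- h) n) \<longlonglongrightarrow> - siegel_line_integral (real N + 1 / 2) s - - siegel_line_integral (real m + 1 / 2) s"
    by (intro tendsto_diff vertical) (use h in \<open>simp_all add: N_def\<close>)
  moreover have "(\<lambda>n. side h n - side (- h) n) \<longlonglongrightarrow> 2 * pi * \<i> * residue G 0"
    unfolding side_def by (rule strip_integrals_residue[OF h(1,2) G_hol[unfolded S_def] small])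
  ultimately have "- siegel_line_integral (real N + 1 / 2) s - - siegel_line_integral (real m + 1 / 2) s = 2 * pi * \<i> * residue G 0"
    by (rule LIMSEQ_unique)
  then show ?thesis by (simp add: residue N_def)
qed

lemma riemann_aux_dirichlet_plus_tail:
  "riemann_aux s = (\<Sum>n=1..N. of_nat n powr (- s)) + siegel_line_integral (real N + 1 / 2) s"
proof (induction N)
  case 0
  then show ?case by (simp add: riemann_aux_eq)
next
  case (Suc N)
  then show ?case using siegel_line_shift[of N s] by (simp add: algebra_simps)
qed

section \<open>The integral near its saddle point\<close>

text \<open>
  The angle of \<open>1 - w + iw\<close> is at least \<open>w\<close>: taking tangents this is
  \<open>sin w \<le> w (cos w + sin w)\<close>, which holds as \<open>cos w + sin w \<ge> 1\<close>.
\<close>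

lemma le_arctan_ratio:
  fixes w :: real
  assumes "0 \<le> w" "w < 1"
  shows "w \<le> arctan (w / (1 - w))"
proof -
  have w2: "w < pi / 2" using assms pi_ge_two by linarith
  have c: "cos w > 0" using assms w2 by (intro cos_gt_zero_pi) auto
  have s: "sin w \<ge> 0" using assms pi_ge_two by (intro sin_ge_zero) auto
  have "1 ^ 2 \<le> (cos w + sin w) ^ 2"
    using c s by (simp add: power2_sum)
  then have "1 \<le> cos w + sin w" by (rule power2_le_imp_le) (use c s in auto)
  then have "w * 1 \<le> w * (cos w + sin w)" using assms by (intro mult_left_mono) auto
  moreover have "sin w \<le> w" using assms by (intro sin_x_le_x)
  ultimately have "sin w * (1 - w) \<le> w * cos w" by (simp add: algebra_simps)
  then have "tan w \<le> w / (1 - w)" using c assms by (simp add: tan_def field_simps)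
  then have "arctan (tan w) \<le> arctan (w / (1 - w))" by (rule arctan_monotone')
  moreover have "arctan (tan w) = w" by (rule arctan_tan) (use assms w2 in linarith)+
  ultimately show ?thesis by simp
qed

text \<open>
  The argument along a line of slope \<open>1\<close>, to second order at the point where it meets the real axis,
  but valid on the whole line. The coefficient \<open>1 / 2\<close> of the quadratic term matters: when
  multiplied by \<open>t = 2\<pi>\<tau>\<^sup>2\<close> it must stay below the \<open>2\<pi>\<close> of the Gaussian factor \<open>e\<^bsup>\<pi>ix\<^sup>2\<^esup>\<close>.
\<close>

lemma Arg_diagonal_le:
  assumes y: "y > 0"
  shows "Arg (Complex (y - b) (- b)) \<le> - b / y + b\<^sup>2 / (2 * y\<^sup>2)"
proof -
  define w where "w = b / y"
  have b: "b = w * y" using y by (simp add: w_def)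
  have goal: "- b / y + b\<^sup>2 / (2 * y\<^sup>2) = - w + w\<^sup>2 / 2"
    using y by (simp add: w_def power_divide)
  show ?thesis
  proof (cases "w < 1")
    case True
    have pos: "y - b > 0" using True y by (simp add: b)
    have q: "- b / (y - b) = - w / (1 - w)"
      using y True by (simp add: b field_simps)
    have "Arg (Complex (y - b) (- b)) = arctan (- w / (1 - w))"
      using pos q by (simp add: arg_conv_arctan)
    also have "\<dots> \<le> - w"
    proof (cases "w \<ge> 0")
      case True
      with \<open>w < 1\<close> show ?thesis using le_arctan_ratio[of w] by (simp add: arctan_minus)
    next
      case False
      then have "0 \<le> - w / (1 - w)" by (intro divide_nonneg_nonneg) auto
      then have "arctan (- w / (1 - w)) \<le> - w / (1 - w)" by (rule arctan_le_self)
      also have "\<dots> \<le> - w / 1" using False by (intro divide_left_mono) auto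
      finally show ?thesis by simp
    qed
    also have "- w \<le> - w + w\<^sup>2 / 2" by simp
    finally show ?thesis unfolding goal .
  next
    case False
    then have bp: "b > 0" "y - b \<le> 0" using y mult_right_mono[of 1 w y] by (simp_all add: b)
    define z where "z = Complex (y - b) (- b)"
    have z: "z \<noteq> 0" "Re z \<le> 0" "Im z < 0" using bp by (auto simp: z_def complex_eq_iff)
    have "Arg z \<le> - (pi / 2)"
      using z arctan_ubound[of "Im z / Re z"] by (simp add: Arg_eq_Im_Ln Im_Ln_eq)
    also have "\<dots> \<le> - 1" using pi_ge_two by simp
    also have "\<dots> \<le> - w + w\<^sup>2 / 2" using zero_le_power2[of "w - 1"] by (simp add: power2_eq_square algebra_simps)
    finally show ?thesis unfolding goal z_def .
  qed
qed

text \<open>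
  The exponent of \<open>|x\<^bsup>-it\<^esup> e\<^bsup>\<pi>ix\<^sup>2\<^esup>|\<close>. As the line crosses the real axis within \<open>1 / 2\<close> of the
  saddle point \<open>\<tau>\<close>, the linear terms of the two factors cancel up to a bounded multiple of \<open>|b|\<close>,
  where \<open>b = - Im x\<close>, and the quadratic terms leave a negative multiple of \<open>b\<^sup>2\<close>.
\<close>

lemma saddle_exponent_le:
  assumes tau: "\<tau> \<ge> 1" and y: "\<bar>y - \<tau>\<bar> \<le> 1 / 2" "y \<ge> 3 / 2" and t: "t = 2 * pi * \<tau>\<^sup>2"
  shows "t * Arg (slanted_line y u) - 2 * pi * Re (slanted_line y u) * Im (slanted_line y u) \<le> 64 - 1 / 8 * u\<^sup>2"
proof -
  define b where "b = u / sqrt 2"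
  define \<kappa> where "\<kappa> = \<tau> / y"
  have x: "slanted_line y u = Complex (y - b) (- b)" by (simp add: slanted_line_eq b_def)
  have k: "0 \<le> \<kappa>" "\<kappa> \<le> 4 / 3" using tau y by (auto simp: \<kappa>_def field_simps abs_if split: if_splits)
  have tau_k: "\<tau> = \<kappa> * y" using y by (simp add: \<kappa>_def)
  have t0: "t \<ge> 0" by (simp add: t)
  have "t * Arg (slanted_line y u) - 2 * pi * Re (slanted_line y u) * Im (slanted_line y u)
      \<le> t * (- b / y + b\<^sup>2 / (2 * y\<^sup>2)) + 2 * pi * (y - b) * b"
    using mult_left_mono[OF Arg_diagonal_le[of y b] t0] y by (simp add: x)
  also have "\<dots> = 2 * pi * (b * ((y - \<tau>) * (1 + \<kappa>)) - b\<^sup>2 * (1 - \<kappa>\<^sup>2 / 2))"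
    unfolding t tau_k using y by (simp add: field_simps power2_eq_square)
  also have "\<dots> \<le> 2 * pi * (7 / 6 * \<bar>b\<bar> - b\<^sup>2 * (1 / 9))"
  proof -
    have "b * ((y - \<tau>) * (1 + \<kappa>)) \<le> \<bar>b\<bar> * (1 / 2 * (7 / 3))"
    proof -
      have "b * ((y - \<tau>) * (1 + \<kappa>)) \<le> \<bar>b\<bar> * (\<bar>y - \<tau>\<bar> * (1 + \<kappa>))"
        using abs_ge_self[of "b * ((y - \<tau>) * (1 + \<kappa>))"] k by (simp add: abs_mult)
      also have "\<dots> \<le> \<bar>b\<bar> * (1 / 2 * (7 / 3))"
        using y k by (intro mult_left_mono mult_mono) auto
      finally show ?thesis .
    qed
    moreover have "b\<^sup>2 * (1 / 9) \<le> b\<^sup>2 * (1 - \<kappa>\<^sup>2 / 2)"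
    proof -
      have "\<kappa>\<^sup>2 \<le> (4 / 3)\<^sup>2" using k by (intro power_mono) auto
      then show ?thesis by (intro mult_left_mono) (auto simp: power2_eq_square)
    qed
    ultimately show ?thesis by (intro mult_left_mono) auto
  qed
  also have "\<dots> = pi * (7 / 3) * \<bar>b\<bar> - pi * (2 / 9 * b\<^sup>2)" by (simp add: algebra_simps)
  also have "\<dots> \<le> 8 * \<bar>b\<bar> - 1 / 2 * b\<^sup>2"
  proof -
    have "pi * (7 / 3) \<le> 8" using pi_approx by simp
    then have "pi * (7 / 3) * \<bar>b\<bar> \<le> 8 * \<bar>b\<bar>" by (intro mult_right_mono) auto
    moreover have "3 * (2 / 9 * b\<^sup>2) \<le> pi * (2 / 9 * b\<^sup>2)" using pi_gt3 by (intro mult_right_mono) auto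
    ultimately show ?thesis using zero_le_power2[of b] by linarith
  qed
  also have "\<dots> \<le> 64 - 1 / 4 * b\<^sup>2"
  proof -
    have "0 \<le> (\<bar>b\<bar> / 2 - 8)\<^sup>2" by simp
    then show ?thesis by (simp add: power2_eq_square algebra_simps abs_mult[symmetric])
  qed
  also have "\<dots> = 64 - 1 / 8 * u\<^sup>2" by (simp add: b_def power_divide)
  finally show ?thesis .
qed

definition cutoff_length :: "real \<Rightarrow> nat" where
  "cutoff_length t = nat \<lfloor>sqrt (t / (2 * pi))\<rfloor>"

text \<open>
  The integral that remains when \<open>R(s)\<close> is approximated by the sum of \<open>n\<^sup>-\<^sup>s\<close> over
  \<open>n \<le> sqrt (t / 2\<pi>)\<close>. By the bound on the exponent, only the factor \<open>|x|\<^sup>-\<^sup>\<sigma>\<close> depends on \<open>t\<close>, and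
  \<open>|x|\<close> has at least order \<open>sqrt t\<close> on the line.
\<close>

lemma siegel_tail_bound:
  obtains C where "C > 0" "\<And>s. 0 \<le> Re s \<Longrightarrow> Re s \<le> 6 \<Longrightarrow> 2 * pi \<le> Im s \<Longrightarrow>
     norm (siegel_line_integral (real (cutoff_length (Im s)) + 1 / 2) s) \<le> C * Im s powr (- Re s / 2)"
proof
  define I where "I = (LINT u::real|lborel. exp (64 - 1 / 8 * u\<^sup>2))"
  have int: "integrable lborel (\<lambda>u::real. exp (64 - 1 / 8 * u\<^sup>2))" by (rule integrable_gaussian) simp
  have I0: "I \<ge> 0" unfolding I_def by (rule Bochner_Integration.integral_nonneg) simp
  define C where "C = (16 * pi) ^ 3 * I + 1"
  show "C > 0" using I0 by (simp add: C_def add_nonneg_pos)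
  fix s
  assume s: "0 \<le> Re s" "Re s \<le> 6" and s_im: "2 * pi \<le> Im s"
  define t where "t = Im s"
  define N where "N = cutoff_length t"
  have t: "t = Im s" "2 * pi \<le> t" using s_im by (simp_all add: t_def)
  define \<tau> where "\<tau> = sqrt (t / (2 * pi))"
  define y where "y = real N + 1 / 2"
  have tau: "\<tau> \<ge> 1" using t by (simp add: \<tau>_def)
  have tpos: "t > 0" using t pi_gt_zero by linarith
  have t_eq: "t = 2 * pi * \<tau>\<^sup>2" using tpos by (simp add: \<tau>_def)
  have NN: "real N \<le> \<tau>" "\<tau> < real N + 1" "real N \<ge> 1"
  proof -
    have "1 \<le> \<lfloor>\<tau>\<rfloor>" using tau by simp
    moreover have "real N = of_int \<lfloor>\<tau>\<rfloor>" using tau unfolding N_def cutoff_length_def \<tau>_def[symmetric] by simp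
    ultimately show "real N \<le> \<tau>" "\<tau> < real N + 1" "real N \<ge> 1" by linarith+
  qed
  have y: "\<bar>y - \<tau>\<bar> \<le> 1 / 2" "y \<ge> 3 / 2" using NN by (simp_all add: y_def abs_if)
  define m where "m = sqrt (t / (16 * pi))"
  have m: "m > 0" using tpos by (simp add: m_def)
  \<comment> \<open>The distance of the line from the origin is \<open>y / sqrt 2\<close>, and \<open>y \<ge> \<tau> / 2\<close>.\<close>
  have m_le: "m \<le> norm (slanted_line y u)" for u
  proof -
    have "m = \<tau> / (2 * sqrt 2)"
    proof -
      have "t / (16 * pi) = (\<tau> / (2 * sqrt 2))\<^sup>2" by (simp add: t_eq power_divide power_mult_distrib)
      then show ?thesis unfolding m_def using tau by simp
    qed
    also have "\<dots> \<le> y / sqrt 2"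
    proof -
      have "\<tau> \<le> 2 * y" using y tau by (simp add: abs_if split: if_splits)
      then show ?thesis by (simp add: field_simps)
    qed
    also have "\<dots> \<le> norm (slanted_line y u)" using y by (intro slanted_line_norm_ge) auto
    finally show ?thesis .
  qed
  have bound: "norm (siegel_integrand s (slanted_line y u) * (- eighth_root)) \<le> m powr (- Re s) * exp (64 - 1 / 8 * u\<^sup>2)" for u
  proof -
    define x where "x = slanted_line y u"
    have xm: "m \<le> norm x" using m_le by (simp add: x_def)
    moreover from this have "norm x > 0" using m by linarith
    ultimately have "ln m \<le> ln (norm x)" using m by (subst ln_le_cancel_iff)
    then have 1: "- Re s * ln (norm x) \<le> - Re s * ln m" using s by (simp add: mult_left_mono)
    have 2: "Im s * Arg x - 2 * pi * Re x * Im x \<le> 64 - 1 / 8 * u\<^sup>2"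
      unfolding x_def using saddle_exponent_le[OF tau y t_eq] t by simp
    have "norm (siegel_integrand s x) \<le> exp (- Re s * ln m + (64 - 1 / 8 * u\<^sup>2))"
    proof (rule norm_siegel_integrand_le)
      show "x \<noteq> 0" using xm m by auto
      show "norm (sin (of_real pi * x)) \<ge> 1 / 2"
        using sin_norm_half_integer[of N u] by (simp add: x_def y_def)
    qed (use 1 2 in linarith)
    also have "\<dots> = m powr (- Re s) * exp (64 - 1 / 8 * u\<^sup>2)"
      unfolding exp_add powr_def using m by simp
    finally show ?thesis by (simp add: norm_mult x_def)
  qed
  have "norm (siegel_line_integral y s) \<le> (LINT u|lborel. m powr (- Re s) * exp (64 - 1 / 8 * u\<^sup>2))"
    unfolding siegel_line_integral_def
    by (rule Bochner_Integration.integral_norm_bound_integral)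
       (use bound siegel_integrand_integrable[of s N] int in \<open>auto simp: y_def\<close>)
  also have "\<dots> = m powr (- Re s) * I" by (simp add: I_def)
  also have "m powr (- Re s) \<le> t powr (- Re s / 2) * (16 * pi) ^ 3"
  proof -
    have "m powr (- Re s) = (t / (16 * pi)) powr (- Re s / 2)"
      using tpos by (simp add: m_def powr_half_sqrt[symmetric] powr_powr)
    also have "\<dots> = t powr (- Re s / 2) * (16 * pi) powr (Re s / 2)"
      using tpos by (simp add: powr_divide powr_minus field_simps)
    also have "(16 * pi) powr (Re s / 2) \<le> (16 * pi) powr 3"
      using s pi_gt3 by (intro powr_mono) auto
    also have "(16 * pi) powr 3 = (16 * pi) ^ 3" by (simp add: powr_numeral)
    finally show ?thesis by (simp add: mult_left_mono)
  qed
  then have "m powr (- Re s) * I \<le> t powr (- Re s / 2) * (16 * pi) ^ 3 * I"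
    using I0 by (rule mult_right_mono)
  also have "\<dots> \<le> C * t powr (- Re s / 2)"
    by (simp add: C_def algebra_simps)
  finally show "norm (siegel_line_integral (real (cutoff_length (Im s)) + 1 / 2) s) \<le> C * Im s powr (- Re s / 2)"
    by (simp add: y_def N_def t_def)
qed

section \<open>The Moebius function, the number of divisors and sums of powers\<close>

definition moebius_mu :: "nat \<Rightarrow> real" where
  "moebius_mu n = (if squarefree n then (- 1) ^ card (prime_factors n) else 0)"

lemma abs_moebius_le: "\<bar>moebius_mu n\<bar> \<le> 1"
  by (simp add: moebius_mu_def power_abs)

lemma moebius_1 [simp]: "moebius_mu (Suc 0) = 1"
  using squarefree_1[where 'a = nat] by (simp add: moebius_mu_def)

lemma moebius_prime_mult:
  assumes p: "prime p" and d: "squarefree d" "\<not> p dvd d" "d > 0"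
  shows "moebius_mu (p * d) = - moebius_mu d"
proof -
  have "squarefree (p * d)"
    using p d prime_imp_coprime[OF p d(2)] squarefree_mult_coprime[OF _ squarefree_prime d(1), of p] by simp
  moreover have "prime_factors (p * d) = insert p (prime_factors d)"
    using p d by (subst prime_factorization_mult) (auto simp: prime_factorization_prime)
  moreover have "p \<notin> prime_factors d" using d by auto
  ultimately show ?thesis using d by (simp add: moebius_mu_def)
qed

text \<open>
  For a prime \<open>p\<close> dividing \<open>n\<close> the square-free divisors pair off as \<open>d\<close> and \<open>p d\<close> with
  opposite signs.
\<close>

lemma sum_moebius_divisors:
  assumes "n > 1" shows "(\<Sum>d | d dvd n. moebius_mu d) = 0"
proof -
  obtain p where p: "prime p" "p dvd n" using prime_factor_nat[of n] assms by auto
  define A where "A = {d. d dvd n \<and> squarefree d}"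
  have fin: "finite {d. d dvd n}" using assms by (simp add: finite_divisors_nat)
  have finA: "finite A" using fin by (rule finite_subset[rotated]) (auto simp: A_def)
  have pos: "d > 0" if "d dvd n" for d using that assms by (auto intro: Nat.gr0I)
  have "(\<Sum>d | d dvd n. moebius_mu d) = (\<Sum>d\<in>A. moebius_mu d)"
    by (rule sum.mono_neutral_right[OF fin]) (auto simp: A_def moebius_mu_def)
  also have "\<dots> = (\<Sum>d\<in>{d\<in>A. p dvd d}. moebius_mu d) + (\<Sum>d\<in>{d\<in>A. \<not> p dvd d}. moebius_mu d)"
    using finA by (subst sum.union_disjoint[symmetric]) (auto intro!: sum.cong)
  also have "(\<Sum>d\<in>{d\<in>A. p dvd d}. moebius_mu d) = (\<Sum>d\<in>{d\<in>A. \<not> p dvd d}. - moebius_mu d)"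
  proof (rule sum.reindex_bij_witness[of _ "\<lambda>d. p * d" "\<lambda>d. d div p"])
    fix d assume d: "d \<in> {d \<in> A. p dvd d}"
    then obtain e where e: "d = p * e" by (auto elim: dvdE)
    have sf: "squarefree (p * e)" "p * e dvd n" using d by (auto simp: A_def e)
    then have "squarefree e" using squarefree_multD by blast
    moreover have "\<not> p dvd e"
    proof
      assume "p dvd e"
      then have "p ^ 2 dvd p * e" by (auto simp: power2_eq_square)
      then have "p dvd 1" using sf(1) squarefreeD by blast
      then show False using p by simp
    qed
    moreover have "e dvd n" using sf(2) by (metis dvd_mult_right)
    moreover have "d div p = e" using e p(1) by (simp add: prime_gt_0_nat)
    ultimately show "d div p \<in> {d \<in> A. \<not> p dvd d}" "p * (d div p) = d" "- moebius_mu (d div p) = moebius_mu d"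
      using p e pos[of e] moebius_prime_mult[of p e] by (auto simp: A_def)
  next
    fix d assume d: "d \<in> {d \<in> A. \<not> p dvd d}"
    then have "coprime p d" using p prime_imp_coprime by blast
    with d p have "p * d dvd n" by (auto simp: A_def intro: divides_mult)
    moreover have "squarefree (p * d)"
      using p d squarefree_mult_coprime[OF \<open>coprime p d\<close> squarefree_prime] by (simp add: A_def)
    ultimately show "p * d \<in> {d \<in> A. p dvd d}" "p * d div p = d"
      using p by (auto simp: A_def prime_gt_0_nat)
  qed
  finally show ?thesis by (simp add: sum_negf)
qed

definition divisor_count :: "nat \<Rightarrow> real" where
  "divisor_count n = real (card {d. d dvd n})"

lemma divisor_count_nonneg [simp]: "divisor_count n \<ge> 0"
  by (simp add: divisor_count_def)

text \<open>
  Every divisor of \<open>a b\<close> is a product of a divisor of \<open>a\<close> and a divisor of \<open>b\<close>.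
\<close>

lemma divisor_count_mult_le:
  assumes "a > 0" "b > 0"
  shows "divisor_count (a * b) \<le> divisor_count a * divisor_count b"
proof -
  have "{d. d dvd a * b} \<subseteq> (\<lambda>(x, y). x * y) ` ({d. d dvd a} \<times> {d. d dvd b})"
  proof
    fix d assume "d \<in> {d. d dvd a * b}"
    then obtain x y where "d = x * y" "x dvd a" "y dvd b" using division_decomp[of d a b] by auto
    then show "d \<in> (\<lambda>(x, y). x * y) ` ({d. d dvd a} \<times> {d. d dvd b})"
      by (intro image_eqI[of _ _ "(x, y)"]) auto
  qed
  then have "card {d. d dvd a * b} \<le> card ((\<lambda>(x, y). x * y) ` ({d. d dvd a} \<times> {d. d dvd b}))"
    using assms by (intro card_mono) (auto simp: finite_divisors_nat)
  also have "\<dots> \<le> card ({d. d dvd a} \<times> {d. d dvd b})"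
    using assms by (intro card_image_le) (auto simp: finite_divisors_nat)
  finally show ?thesis
    unfolding divisor_count_def of_nat_mult[symmetric] card_cartesian_product of_nat_le_iff .
qed

lemma divisor_count_le_self: "n > 0 \<Longrightarrow> divisor_count n \<le> real n"
proof -
  assume n: "n > 0"
  then have "card {d. d dvd n} \<le> card {1..n}"
    by (intro card_mono) (auto dest: dvd_imp_le intro: Suc_leI Nat.gr0I)
  then show ?thesis by (simp add: divisor_count_def)
qed

text \<open>
  Summing over \<open>k = n m\<close> and letting both \<open>n\<close> and \<open>m\<close> run up to \<open>K\<close> only adds terms. All divisor
  sums are decoupled in this way.
\<close>

lemma sum_divisors_le:
  fixes F :: "nat \<Rightarrow> nat \<Rightarrow> real"
  assumes F: "\<And>n k. F n k \<ge> 0"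
  shows "(\<Sum>k=1..K. \<Sum>n | n dvd k \<and> P n. F n k) \<le> (\<Sum>n | n \<in> {1..K} \<and> P n. \<Sum>m=1..K. F n (n * m))"
proof -
  define A where "A = {n. n \<in> {1..K} \<and> P n}"
  have "(\<Sum>k=1..K. \<Sum>n | n dvd k \<and> P n. F n k) = (\<Sum>k=1..K. \<Sum>n\<in>{n\<in>A. n dvd k}. F n k)"
    by (intro sum.cong refl) (auto simp: A_def Suc_le_eq dest: dvd_imp_le intro!: Nat.gr0I)
  also have "\<dots> = (\<Sum>n\<in>A. \<Sum>k\<in>{k\<in>{1..K}. n dvd k}. F n k)"
    by (rule sum.swap_restrict) (auto simp: A_def)
  also have "\<dots> \<le> (\<Sum>n\<in>A. \<Sum>m=1..K. F n (n * m))"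
  proof (rule sum_mono)
    fix n assume "n \<in> A"
    then have n: "n \<ge> 1" by (simp add: A_def)
    have "{k\<in>{1..K}. n dvd k} \<subseteq> (\<lambda>m. n * m) ` {1..K}"
    proof
      fix k assume "k \<in> {k\<in>{1..K}. n dvd k}"
      then obtain m where m: "k = n * m" "1 \<le> n * m" "n * m \<le> K" by (auto elim: dvdE)
      have "1 * m \<le> n * m" using n by (rule mult_le_mono1)
      then have "m \<le> K" using m(3) by linarith
      moreover have "m \<ge> 1" using m(2) by (cases m) auto
      ultimately have "m \<in> {1..K}" by simp
      then show "k \<in> (\<lambda>m. n * m) ` {1..K}" unfolding m(1) by (rule imageI)
    qed
    then have "(\<Sum>k\<in>{k\<in>{1..K}. n dvd k}. F n k) \<le> (\<Sum>k\<in>(\<lambda>m. n * m) ` {1..K}. F n k)"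
      by (intro sum_mono2) (auto intro: F)
    also have "\<dots> = (\<Sum>m=1..K. F n (n * m))"
      using n by (subst sum.reindex) (auto simp: inj_on_def)
    finally show "(\<Sum>k\<in>{k\<in>{1..K}. n dvd k}. F n k) \<le> (\<Sum>m=1..K. F n (n * m))" .
  qed
  finally show ?thesis by (simp add: A_def)
qed

text \<open>
  With \<open>q = p - 1\<close> and \<open>x = 1 / (K + 1)\<close> this is Bernoulli's inequality
  \<open>(1 - x) powr (- q) \<ge> 1 + q x\<close>.
\<close>

lemma powr_tail_step:
  assumes p: "p > 1" and K: "K \<ge> (1::nat)"
  shows "real (Suc K) powr (- p) \<le> (real K powr (1 - p) - real (Suc K) powr (1 - p)) / (p - 1)"
proof -
  define q where "q = p - 1"
  define x where "x = 1 / real (Suc K)"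
  have x: "0 < x" "x < 1" using K by (auto simp: x_def)
  have q: "q > 0" using p by (simp add: q_def)
  have K_eq: "real K = real (Suc K) * (1 - x)" by (simp add: x_def field_simps)
  \<comment> \<open>Bernoulli's inequality, by way of the exponential function.\<close>
  have "1 + q * x \<le> exp (q * x)" by (rule exp_ge_add_one_self)
  also have "\<dots> \<le> exp (- q * ln (1 - x))"
  proof -
    have "x \<le> - ln (1 - x)" using ln_le_minus_one[of "1 - x"] x by simp
    then have "q * x \<le> q * - ln (1 - x)" using q by (intro mult_left_mono) auto
    then show ?thesis by simp
  qed
  also have "\<dots> = (1 - x) powr (- q)" using x by (simp add: powr_def)
  finally have "real (Suc K) powr (- q) * (1 + q * x) \<le> real (Suc K) powr (- q) * (1 - x) powr (- q)"
    by (intro mult_left_mono) auto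
  also have "\<dots> = real K powr (- q)" unfolding K_eq using x by (simp add: powr_mult)
  finally have "q * (real (Suc K) powr (- q) * x) \<le> real K powr (- q) - real (Suc K) powr (- q)"
    by (simp add: algebra_simps)
  also have "real (Suc K) powr (- q) * x = real (Suc K) powr (- p)"
    by (simp add: x_def q_def powr_diff powr_minus field_simps)
  finally show ?thesis using q by (simp add: q_def field_simps)
qed

lemma sum_powr_tail_le:
  assumes p: "p > 1" and Z: "Z > 0"
  shows "(\<Sum>n | n \<in> {1..K} \<and> Z < real n. real n powr (- p)) \<le> p / (p - 1) * Z powr (1 - p)"
proof -
  define n0 where "n0 = nat \<lfloor>Z\<rfloor> + 1"
  have n0: "n0 \<ge> 1" "Z < real n0" "Z < real n \<Longrightarrow> n0 \<le> n" for n
    using Z by (auto simp: n0_def) linarith+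
  have ind: "n0 \<le> K \<Longrightarrow> (\<Sum>n=n0..K. real n powr (- p)) \<le> real n0 powr (- p) + (real n0 powr (1 - p) - real K powr (1 - p)) / (p - 1)" for K
  proof (induction K rule: nat_induct_at_least)
    case (Suc K)
    have "(\<Sum>n=n0..Suc K. real n powr (- p)) = (\<Sum>n=n0..K. real n powr (- p)) + real (Suc K) powr (- p)"
      using Suc.hyps by simp
    also have "\<dots> \<le> real n0 powr (- p) + (real n0 powr (1 - p) - real K powr (1 - p)) / (p - 1)
        + (real K powr (1 - p) - real (Suc K) powr (1 - p)) / (p - 1)"
      using Suc.hyps n0 by (intro add_mono Suc.IH powr_tail_step p) auto
    also have "\<dots> = real n0 powr (- p) + (real n0 powr (1 - p) - real (Suc K) powr (1 - p)) / (p - 1)"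
      by (simp add: diff_divide_distrib)
    finally show ?case .
  qed simp
  have bound: "real n0 powr (1 - p) \<le> Z powr (1 - p)"
    using n0 Z p by (intro powr_mono2') auto
  have "(\<Sum>n | n \<in> {1..K} \<and> Z < real n. real n powr (- p)) \<le> (\<Sum>n=n0..K. real n powr (- p))"
    by (rule sum_mono2) (use n0 in auto)
  also have "\<dots> \<le> p / (p - 1) * Z powr (1 - p)"
  proof (cases "n0 \<le> K")
    case True
    have "(\<Sum>n=n0..K. real n powr (- p)) \<le> real n0 powr (- p) + (real n0 powr (1 - p) - real K powr (1 - p)) / (p - 1)"
      by (rule ind[OF True])
    also have "\<dots> \<le> real n0 powr (1 - p) + real n0 powr (1 - p) / (p - 1)"
      using n0 p by (intro add_mono powr_mono divide_right_mono) auto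
    also have "\<dots> = p / (p - 1) * real n0 powr (1 - p)" using p by (simp add: field_simps)
    also have "\<dots> \<le> p / (p - 1) * Z powr (1 - p)"
      using p bound by (intro mult_left_mono) auto
    finally show ?thesis .
  qed (use p in auto)
  finally show ?thesis .
qed

lemma sum_powr_bounded:
  assumes p: "1 < p" "p \<le> 2"
  shows "(\<Sum>n=1..K. real n powr (- p)) \<le> 4 / (p - 1)"
proof -
  have "(\<Sum>n=1..K. real n powr (- p)) \<le> (\<Sum>n | n \<in> {1..K} \<and> 1 / 2 < real n. real n powr (- p))"
    by (rule sum_mono2) auto
  also have "\<dots> \<le> p / (p - 1) * (1 / 2) powr (1 - p)"
    by (rule sum_powr_tail_le[OF p(1)]) simp
  also have "(1 / 2 :: real) powr (1 - p) = 2 powr (p - 1)" by (simp add: powr_divide powr_minus[symmetric] powr_diff field_simps)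
  also have "p / (p - 1) * 2 powr (p - 1) \<le> 2 / (p - 1) * 2 powr 1"
    using p by (intro mult_mono divide_right_mono powr_mono) auto
  finally show ?thesis by simp
qed

text \<open>
  Opening one factor \<open>divisor_count k\<close> and using \<open>d(nm) \<le> d(n) d(m)\<close> for the others bounds the sum
  for \<open>j + 1\<close> by the square of the sum for \<open>j\<close>.
\<close>

lemma sum_divisor_count_power_le:
  "(\<Sum>k=1..K. divisor_count k ^ j / real k ^ 2) \<le> 4 ^ (2 ^ j)"
proof (induction j)
  case 0
  then show ?case using sum_powr_bounded[of 2 K] by (simp add: powr_minus powr_numeral inverse_eq_divide)
next
  case (Suc j)
  have "(\<Sum>k=1..K. divisor_count k ^ Suc j / real k ^ 2) =
      (\<Sum>k=1..K. \<Sum>n | n dvd k \<and> True. divisor_count k ^ j / real k ^ 2)"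
    by (simp add: divisor_count_def)
  also have "\<dots> \<le> (\<Sum>n | n \<in> {1..K} \<and> True. \<Sum>m=1..K. divisor_count (n * m) ^ j / real (n * m) ^ 2)"
    by (rule sum_divisors_le) simp
  also have "\<dots> \<le> (\<Sum>n=1..K. \<Sum>m=1..K. (divisor_count n ^ j / real n ^ 2) * (divisor_count m ^ j / real m ^ 2))"
  proof (simp only: simp_thms Collect_mem_eq, intro sum_mono)
    fix n m assume "n \<in> {1..K}" "m \<in> {1..K}"
    then have "divisor_count (n * m) ^ j \<le> (divisor_count n * divisor_count m) ^ j"
      by (intro power_mono divisor_count_mult_le) auto
    then show "divisor_count (n * m) ^ j / real (n * m) ^ 2 \<le> (divisor_count n ^ j / real n ^ 2) * (divisor_count m ^ j / real m ^ 2)"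
      by (simp add: power_mult_distrib divide_right_mono)
  qed
  also have "\<dots> = (\<Sum>n=1..K. divisor_count n ^ j / real n ^ 2) ^ 2"
    by (simp add: power2_eq_square sum_product)
  also have "\<dots> \<le> (4 ^ (2 ^ j)) ^ 2"
    by (intro power_mono Suc.IH sum_nonneg) auto
  also have "\<dots> = 4 ^ (2 ^ Suc j)"
    by (simp add: power_mult[symmetric] mult.commute)
  finally show ?case .
qed

text \<open>
  A single term of the sum of \<open>d(k)\<^sup>j / k\<^sup>2\<close> is bounded by the whole sum, hence \<open>d(n)\<^sup>j\<close> is
  \<open>O(n\<^sup>2)\<close> for every \<open>j\<close>; then take \<open>j\<close>-th roots.
\<close>

lemma divisor_count_bound:
  assumes "\<epsilon> > 0"
  obtains C where "C \<ge> 1" "\<And>n. n > 0 \<Longrightarrow> divisor_count n \<le> C * real n powr \<epsilon>"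
proof -
  obtain j :: nat where "2 / \<epsilon> < real j" using reals_Archimedean2 by blast
  moreover have "2 / \<epsilon> > 0" using assms by simp
  ultimately have j0: "real j > 0" "2 < real j * \<epsilon>" using assms by (linarith, simp add: field_simps)
  then have j: "real j > 0" "2 / real j \<le> \<epsilon>" by (simp_all add: field_simps)
  define C where "C = (4 ^ (2 ^ j) :: real) powr (1 / real j)"
  have C1: "C \<ge> 1" unfolding C_def by (rule ge_one_powr_ge_zero) auto
  have "divisor_count n \<le> C * real n powr \<epsilon>" if n: "n > 0" for n :: nat
  proof -
    have "divisor_count n ^ j / real n ^ 2 \<le> (\<Sum>k=1..n. divisor_count k ^ j / real k ^ 2)"
      by (rule member_le_sum) (use n in auto)
    also have "\<dots> \<le> 4 ^ (2 ^ j)" by (rule sum_divisor_count_power_le)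
    finally have le: "divisor_count n ^ j \<le> 4 ^ (2 ^ j) * real n ^ 2" using n by (simp add: field_simps)
    have dpos: "divisor_count n > 0" using n by (auto simp: divisor_count_def card_gt_0_iff finite_divisors_nat)
    have "divisor_count n ^ j = divisor_count n powr real j" using dpos by (simp only: powr_realpow)
    then have "divisor_count n = (divisor_count n ^ j) powr (1 / real j)"
      using dpos j by (simp add: powr_powr)
    also have "\<dots> \<le> (4 ^ (2 ^ j) * real n ^ 2) powr (1 / real j)"
      by (rule powr_mono2) (use le j in auto)
    also have "\<dots> = C * real n powr (2 / real j)"
    proof -
      have "real n ^ 2 = real n powr 2" using n by (simp add: powr_numeral)
      then have "(real n ^ 2) powr (1 / real j) = real n powr (2 / real j)" by (simp only: powr_powr) simp
      then show ?thesis by (simp only: C_def powr_mult)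
    qed
    also have "\<dots> \<le> C * real n powr \<epsilon>"
      using n j by (intro mult_left_mono powr_mono) (auto simp: C_def)
    finally show ?thesis .
  qed
  with C1 show thesis by (rule that)
qed

lemma sum_inverse_le:
  assumes "K \<ge> 1" shows "(\<Sum>n=1..K. 1 / real n) \<le> 1 + ln (real K)"
proof -
  have "harm (Suc (K - 1)) - ln (real (Suc (K - 1))) \<le> harm (Suc 0) - ln (real (Suc 0))"
    using decseqD[OF decseq_harm_diff_ln, of 0 "K - 1"] by simp
  then show ?thesis using assms by (simp add: harm_def harm_expand inverse_eq_divide)
qed

text \<open>
  The logarithm is a loss for \<open>s < 1\<close>, but it makes the bound uniform up to \<open>s = 1\<close>.
\<close>

lemma sum_powr_le:
  assumes "K \<ge> 1" "s \<le> 1"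
  shows "(\<Sum>n=1..K. real n powr (- s)) \<le> real K powr (1 - s) * (1 + ln (real K))"
proof -
  have "(\<Sum>n=1..K. real n powr (- s)) \<le> (\<Sum>n=1..K. real K powr (1 - s) * (1 / real n))"
  proof (rule sum_mono)
    fix n assume n: "n \<in> {1..K}"
    have "real n powr (- s) = real n powr (1 - s) * (1 / real n)"
      using n by (simp add: powr_diff powr_minus field_simps)
    also have "\<dots> \<le> real K powr (1 - s) * (1 / real n)"
      using n assms by (intro mult_right_mono powr_mono2) auto
    finally show "real n powr (- s) \<le> real K powr (1 - s) * (1 / real n)" .
  qed
  also have "\<dots> \<le> real K powr (1 - s) * (1 + ln (real K))"
    unfolding sum_distrib_left[symmetric] by (intro mult_left_mono sum_inverse_le assms) auto
  finally show ?thesis .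
qed

section \<open>Dirichlet polynomials whose length grows with the height\<close>

text \<open>
  The coefficient of \<open>k\<^sup>-\<^sup>s\<close> in the product of the sum of \<open>n\<^sup>-\<^sup>s\<close> over \<open>n \<le> sqrt (t / 2\<pi>)\<close> with the
  mollifier of length \<open>X\<close>. The first factor depends on the height \<open>t\<close>, so the coefficient is a
  step function of \<open>t\<close> with jumps at the points \<open>2\<pi>n\<^sup>2\<close>.
\<close>

definition cutoff_coeff :: "nat \<Rightarrow> real \<Rightarrow> nat \<Rightarrow> real" where
  "cutoff_coeff X t k = (\<Sum>n | n dvd k \<and> k div n \<le> X \<and> 2 * pi * real n ^ 2 \<le> t. moebius_mu (k div n))"

definition mollifier :: "nat \<Rightarrow> complex \<Rightarrow> complex" where
  "mollifier X s = (\<Sum>d=1..X. of_real (moebius_mu d) * of_nat d powr (- s))"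

lemma le_cutoff_length_iff:
  assumes "t \<ge> 0"
  shows "n \<le> cutoff_length t \<longleftrightarrow> 2 * pi * real n ^ 2 \<le> t"
proof -
  have "n \<le> cutoff_length t \<longleftrightarrow> real n \<le> sqrt (t / (2 * pi))"
    using assms by (simp add: cutoff_length_def le_nat_iff le_floor_iff)
  also have "\<dots> \<longleftrightarrow> sqrt (real n ^ 2) \<le> sqrt (t / (2 * pi))" by simp
  also have "\<dots> \<longleftrightarrow> real n ^ 2 \<le> t / (2 * pi)" by (rule real_sqrt_le_iff)
  also have "\<dots> \<longleftrightarrow> 2 * pi * real n ^ 2 \<le> t" by (simp add: field_simps)
  finally show ?thesis .
qed

lemma cutoff_product:
  assumes t: "t \<ge> 0" and N: "N = cutoff_length t" and K: "N * X \<le> K"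
  shows "(\<Sum>n=1..N. of_nat n powr (- s)) * mollifier X s = (\<Sum>k=1..K. of_real (cutoff_coeff X t k) * of_nat k powr (- s))"
proof -
  have "(\<Sum>k=1..K. of_real (cutoff_coeff X t k) * of_nat k powr (- s)) =
      (\<Sum>k=1..K. \<Sum>n | n dvd k \<and> k div n \<le> X \<and> 2 * pi * real n ^ 2 \<le> t. of_real (moebius_mu (k div n)) * of_nat k powr (- s))"
    by (simp add: cutoff_coeff_def sum_distrib_right)
  also have "\<dots> = (\<Sum>(k, n)\<in>(SIGMA k:{1..K}. {n. n dvd k \<and> k div n \<le> X \<and> 2 * pi * real n ^ 2 \<le> t}).
        of_real (moebius_mu (k div n)) * of_nat k powr (- s))"
    by (rule sum.Sigma) (auto intro: finite_subset[OF _ finite_divisors_nat])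
  also have "\<dots> = (\<Sum>(n, d)\<in>{1..N} \<times> {1..X}. of_nat n powr (- s) * (of_real (moebius_mu d) * of_nat d powr (- s)))"
  proof (rule sum.reindex_bij_witness[of _ "\<lambda>(n, d). (n * d, n)" "\<lambda>(k, n). (n, k div n)"], goal_cases)
    case (1 z)
    then show ?case by auto
  next
    case (2 z)
    then obtain k n where z: "z = (k, n)" "k \<ge> 1" "n dvd k" "k div n \<le> X" "2 * pi * real n ^ 2 \<le> t" by auto
    obtain d where k: "k = n * d" using z(3) by (auto elim: dvdE)
    have nd: "n \<ge> 1" "d \<ge> 1" using z(2) unfolding k by (auto intro: Suc_leI Nat.gr0I)
    have "n \<le> N" using z(5) t N le_cutoff_length_iff by simp
    then show ?case using z nd by (auto simp: k)
  next
    case (3 z)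
    then show ?case by auto
  next
    case (4 z)
    then obtain n d where z: "z = (n, d)" "1 \<le> n" "n \<le> N" "1 \<le> d" "d \<le> X" by auto
    have "n * d \<le> K" using mult_le_mono[OF z(3,5)] K by linarith
    moreover have "1 \<le> n * d" using mult_le_mono[OF z(2,4)] by simp
    moreover have "2 * pi * real n ^ 2 \<le> t" using z(3) t N le_cutoff_length_iff by simp
    ultimately show ?case using z by auto
  next
    case (5 z)
    then obtain k n where z: "z = (k, n)" "k \<ge> 1" "n dvd k" by auto
    obtain d where k: "k = n * d" using z(3) by (auto elim: dvdE)
    have nd: "n \<ge> 1" "d \<ge> 1" using z(2) unfolding k by (auto intro: Suc_leI Nat.gr0I)
    have "complex_of_nat (n * d) powr (- s) = of_nat n powr (- s) * of_nat d powr (- s)"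
      by (simp add: powr_times_real)
    then show ?case using nd by (simp add: z k mult_ac)
  qed
  also have "\<dots> = (\<Sum>n=1..N. of_nat n powr (- s)) * mollifier X s"
    by (simp add: mollifier_def sum_product sum.cartesian_product)
  finally show ?thesis by simp
qed

lemma cutoff_coeff_1:
  assumes "X \<ge> 1" "t \<ge> 2 * pi" shows "cutoff_coeff X t 1 = 1"
proof -
  have "{n. n dvd (1::nat) \<and> 1 div n \<le> X \<and> 2 * pi * real n ^ 2 \<le> t} = {1}"
    using assms by auto
  then show ?thesis by (simp add: cutoff_coeff_def)
qed

lemma abs_cutoff_coeff_le:
  assumes "k > 0" shows "\<bar>cutoff_coeff X t k\<bar> \<le> divisor_count k"
proof -
  have "\<bar>cutoff_coeff X t k\<bar> \<le> (\<Sum>n | n dvd k \<and> k div n \<le> X \<and> 2 * pi * real n ^ 2 \<le> t. 1)"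
    unfolding cutoff_coeff_def by (rule order_trans[OF sum_abs]) (intro sum_mono abs_moebius_le)
  also have "\<dots> \<le> (\<Sum>n | n dvd k. 1)"
    by (rule sum_mono2) (use assms in \<open>auto simp: finite_divisors_nat\<close>)
  finally show ?thesis by (simp add: divisor_count_def)
qed

definition large_divisor_count :: "real \<Rightarrow> nat \<Rightarrow> real" where
  "large_divisor_count Y k = real (card {n. n dvd k \<and> Y < real n})"

text \<open>
  For \<open>k \<le> X\<close> the mollifier imposes no condition. The sum of \<open>\<mu>(k / n)\<close> over all divisors \<open>n\<close>
  vanishes, so the coefficient is minus the sum over the divisors with \<open>2\<pi>n\<^sup>2 > t\<close>. These are few
  when \<open>k\<close> is not much larger than \<open>Y\<close>; that is why \<open>X\<close> will be chosen longer than \<open>Y\<close>.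
\<close>

lemma abs_cutoff_coeff_le_large_divisors:
  assumes k: "1 < k" "k \<le> X" and t: "2 * pi * Y ^ 2 \<le> t" and Y: "Y \<ge> 0"
  shows "\<bar>cutoff_coeff X t k\<bar> \<le> large_divisor_count Y k"
proof -
  define A where "A = {n. n dvd k \<and> 2 * pi * real n ^ 2 \<le> t}"
  define B where "B = {n. n dvd k \<and> \<not> 2 * pi * real n ^ 2 \<le> t}"
  have fin: "finite {n. n dvd k}" using k by (simp add: finite_divisors_nat)
  then have finAB: "finite A" "finite B" by (auto simp: A_def B_def)
  have "(\<Sum>n\<in>A. moebius_mu (k div n)) + (\<Sum>n\<in>B. moebius_mu (k div n)) = (\<Sum>n | n dvd k. moebius_mu (k div n))"
    using finAB by (subst sum.union_disjoint[symmetric]) (auto simp: A_def B_def intro!: sum.cong)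
  also have "\<dots> = (\<Sum>d | d dvd k. moebius_mu d)"
  proof (rule sum.reindex_bij_witness[of _ "\<lambda>d. k div d" "\<lambda>d. k div d"])
    show "k div (k div d) = d" "k div d \<in> {d. d dvd k}" "moebius_mu (k div d) = moebius_mu (k div d)" if "d \<in> {d. d dvd k}" for d
      using that k by (auto elim!: dvdE)
  qed (use k in \<open>auto elim!: dvdE\<close>)
  also have "\<dots> = 0" by (rule sum_moebius_divisors[OF k(1)])
  finally have sum0: "(\<Sum>n\<in>A. moebius_mu (k div n)) = - (\<Sum>n\<in>B. moebius_mu (k div n))" by simp
  have "{n. n dvd k \<and> k div n \<le> X \<and> 2 * pi * real n ^ 2 \<le> t} = A"
    using k order_trans[OF div_le_dividend[of k] k(2)] by (auto simp: A_def)
  then have "cutoff_coeff X t k = - (\<Sum>n\<in>B. moebius_mu (k div n))"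
    using sum0 by (simp add: cutoff_coeff_def)
  then have "\<bar>cutoff_coeff X t k\<bar> \<le> (\<Sum>n\<in>B. \<bar>moebius_mu (k div n)\<bar>)"
    by (simp add: sum_abs)
  also have "\<dots> \<le> (\<Sum>n\<in>B. 1)" by (intro sum_mono abs_moebius_le)
  also have "\<dots> \<le> (\<Sum>n | n dvd k \<and> Y < real n. 1)"
  proof (rule sum_mono2)
    show "B \<subseteq> {n. n dvd k \<and> Y < real n}"
    proof
      fix n assume n: "n \<in> B"
      then have "\<not> 2 * pi * real n ^ 2 \<le> t" by (simp add: B_def)
      then have "2 * pi * Y ^ 2 < 2 * pi * real n ^ 2" using t by linarith
      then have "Y ^ 2 < real n ^ 2" by simp
      then have "Y < real n" by (rule power2_less_imp_less) simp
      then show "n \<in> {n. n dvd k \<and> Y < real n}" using n by (auto simp: B_def)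
    qed
  qed (use fin in auto)
  finally show ?thesis by (simp add: large_divisor_count_def)
qed

lemma cutoff_coeff_eq_0:
  assumes k: "1 < k" "k \<le> X" "real k \<le> Y" and t: "2 * pi * Y ^ 2 \<le> t"
  shows "cutoff_coeff X t k = 0"
proof -
  have "{n. n dvd k \<and> Y < real n} = {}" using k by (auto dest!: dvd_imp_le)
  then have "large_divisor_count Y k = 0" by (simp only: large_divisor_count_def card.empty of_nat_0)
  moreover have "Y \<ge> 0" using k(3) of_nat_0_le_iff[of k] by linarith
  ultimately show ?thesis
    using abs_cutoff_coeff_le_large_divisors[OF k(1,2) t] by simp
qed

lemma integrable_cos_cutoff:
  fixes \<theta> :: real
  shows "(\<lambda>t. if \<tau> \<le> t then cos (\<theta> * t) else 0) integrable_on {W..W'}"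
proof -
  have "(\<lambda>t. cos (\<theta> * t)) integrable_on {max W \<tau>..W'}"
    by (intro integrable_continuous_interval continuous_intros)
  then have "(\<lambda>t. if t \<in> {max W \<tau>..W'} then cos (\<theta> * t) else 0) integrable_on {W..W'}"
    by (subst integrable_restrict_Int) (simp add: Int_absorb1)
  then show ?thesis by (rule integrable_eq) auto
qed

lemma integral_cos_cutoff:
  assumes "\<theta> \<noteq> (0::real)"
  shows "\<bar>integral {W..W'} (\<lambda>t. if \<tau> \<le> t then cos (\<theta> * t) else 0)\<bar> \<le> 2 / \<bar>\<theta>\<bar>"
proof -
  define m where "m = max W \<tau>"
  have "integral {W..W'} (\<lambda>t. if \<tau> \<le> t then cos (\<theta> * t) else 0)
      = integral {W..W'} (\<lambda>t. if t \<in> {m..W'} then cos (\<theta> * t) else 0)"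
    by (rule integral_cong) (auto simp: m_def)
  also have "\<dots> = integral {m..W'} (\<lambda>t. cos (\<theta> * t))"
    by (subst integral_restrict_Int) (simp add: m_def Int_absorb1)
  also have "\<bar>\<dots>\<bar> \<le> 2 / \<bar>\<theta>\<bar>"
  proof (cases "m \<le> W'")
    case True
    have "((\<lambda>t. cos (\<theta> * t)) has_integral (sin (\<theta> * W') / \<theta> - sin (\<theta> * m) / \<theta>)) {m..W'}"
      by (rule fundamental_theorem_of_calculus[OF True])
         (use assms in \<open>auto intro!: derivative_eq_intros simp: has_real_derivative_iff_has_vector_derivative[symmetric]\<close>)
    moreover have "\<bar>sin (\<theta> * W') - sin (\<theta> * m)\<bar> \<le> 2"
      using abs_sin_le_one[of "\<theta> * W'"] abs_sin_le_one[of "\<theta> * m"] by linarith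
    ultimately show ?thesis
      by (simp add: integral_unique diff_divide_distrib[symmetric] abs_divide divide_right_mono)
  qed simp
  finally show ?thesis .
qed

lemma cutoff_coeff_indicator:
  assumes "k > 0"
  shows "cutoff_coeff X t k = (\<Sum>n | n dvd k \<and> k div n \<le> X. if 2 * pi * real n ^ 2 \<le> t then moebius_mu (k div n) else 0)"
proof -
  have "finite {n. n dvd k \<and> k div n \<le> X}" using assms by (auto simp: finite_divisors_nat)
  then show ?thesis
    unfolding cutoff_coeff_def
    by (subst sum.inter_filter[symmetric]) (auto intro!: sum.cong simp: conj_ac)
qed

text \<open>
  Opening both coefficients leaves, for each pair of divisors, a cosine integrated over a final
  segment of the interval, so the step functions cost no more than constant coefficients would.
\<close>

lemma integral_cutoff_coeff_offdiagonal:
  assumes kl: "k > 0" "l > 0"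
  shows "(\<lambda>t. cutoff_coeff X t k * cutoff_coeff X t l * cos (\<theta> * t)) integrable_on {W..W'}" (is "?f integrable_on _")
    and "\<theta> \<noteq> 0 \<Longrightarrow> \<bar>integral {W..W'} (\<lambda>t. cutoff_coeff X t k * cutoff_coeff X t l * cos (\<theta> * t))\<bar>
           \<le> divisor_count k * divisor_count l * (2 / \<bar>\<theta>\<bar>)"
proof -
  define D where "D k = {n. n dvd k \<and> k div n \<le> X}" for k
  define \<tau> where "\<tau> n m = max (2 * pi * real n ^ 2) (2 * pi * real m ^ 2)" for n m :: nat
  define g where "g = (\<lambda>n m t. (moebius_mu (k div n) * moebius_mu (l div m)) * (if \<tau> n m \<le> t then cos (\<theta> * t) else 0))"
  have fin: "finite (D k)" "finite (D l)" using kl by (auto simp: D_def finite_divisors_nat)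
  have eq: "cutoff_coeff X t k * cutoff_coeff X t l * cos (\<theta> * t) = (\<Sum>n\<in>D k. \<Sum>m\<in>D l. g n m t)" for t
  proof -
    have "cutoff_coeff X t k * cutoff_coeff X t l = (\<Sum>n\<in>D k. \<Sum>m\<in>D l.
        (if 2 * pi * real n ^ 2 \<le> t then moebius_mu (k div n) else 0) * (if 2 * pi * real m ^ 2 \<le> t then moebius_mu (l div m) else 0))"
      unfolding cutoff_coeff_indicator[OF kl(1)] cutoff_coeff_indicator[OF kl(2)] D_def[symmetric] by (rule sum_product)
    then show ?thesis
      by (simp only: sum_distrib_right, intro sum.cong refl) (simp add: g_def \<tau>_def)
  qed
  have int: "g n m integrable_on {W..W'}" for n m
    unfolding g_def by (intro integrable_on_mult_right integrable_cos_cutoff)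
  have int2: "(\<lambda>t. \<Sum>m\<in>D l. g n m t) integrable_on {W..W'}" for n
    by (intro integrable_sum fin int)
  show "?f integrable_on {W..W'}"
    unfolding eq by (intro integrable_sum fin int)
  assume th: "\<theta> \<noteq> 0"
  have g_le: "\<bar>integral {W..W'} (g n m)\<bar> \<le> 2 / \<bar>\<theta>\<bar>" for n m
  proof -
    let ?I = "integral {W..W'} (\<lambda>t. if \<tau> n m \<le> t then cos (\<theta> * t) else 0)"
    have "integral {W..W'} (g n m) = (moebius_mu (k div n) * moebius_mu (l div m)) * ?I"
      unfolding g_def by (rule integral_mult_right)
    then have "\<bar>integral {W..W'} (g n m)\<bar> = \<bar>moebius_mu (k div n)\<bar> * \<bar>moebius_mu (l div m)\<bar> * \<bar>?I\<bar>"
      by (simp add: abs_mult)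
    also have "\<dots> \<le> 1 * 1 * (2 / \<bar>\<theta>\<bar>)"
      by (intro mult_mono abs_moebius_le integral_cos_cutoff[OF th]) auto
    finally show ?thesis by simp
  qed
  have "integral {W..W'} ?f = (\<Sum>n\<in>D k. \<Sum>m\<in>D l. integral {W..W'} (g n m))"
    unfolding eq using fin int int2 by (simp add: integral_sum)
  also have "\<bar>\<dots>\<bar> \<le> (\<Sum>n\<in>D k. \<Sum>m\<in>D l. 2 / \<bar>\<theta>\<bar>)"
    by (rule order_trans[OF sum_abs], rule sum_mono, rule order_trans[OF sum_abs], rule sum_mono, rule g_le)
  also have "\<dots> = real (card (D k)) * (real (card (D l)) * (2 / \<bar>\<theta>\<bar>))" by simp
  also have "\<dots> \<le> divisor_count k * (divisor_count l * (2 / \<bar>\<theta>\<bar>))"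
    unfolding divisor_count_def D_def using kl
    by (intro mult_mono of_nat_mono card_mono) (auto simp: finite_divisors_nat)
  finally show "\<bar>integral {W..W'} ?f\<bar> \<le> divisor_count k * divisor_count l * (2 / \<bar>\<theta>\<bar>)"
    by (simp add: mult.assoc)
qed

lemma norm_dirichlet_square:
  fixes a :: "nat \<Rightarrow> real"
  assumes "\<And>k. k \<in> S \<Longrightarrow> k > 0" "finite S"
  shows "norm (\<Sum>k\<in>S. of_real (a k) * of_nat k powr (- Complex \<sigma> t)) ^ 2 =
     (\<Sum>k\<in>S. \<Sum>l\<in>S. real k powr (- \<sigma>) * real l powr (- \<sigma>) * (a k * a l * cos ((ln (real k) - ln (real l)) * t)))" (is "_ = (\<Sum>k\<in>S. \<Sum>l\<in>S. ?R k l)")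
proof -
  define c where "c k = of_real (a k) * complex_of_nat k powr (- Complex \<sigma> t)" for k
  have ck: "c k = of_real (a k * real k powr (- \<sigma>)) * cis (- (ln (real k) * t))" if "k \<in> S" for k
  proof -
    have k: "k > 0" using assms(1)[OF that] .
    have "complex_of_nat k powr (- Complex \<sigma> t) = exp (- Complex \<sigma> t * of_real (ln (real k)))"
      using k by (simp add: powr_def Ln_of_nat)
    also have "- Complex \<sigma> t * of_real (ln (real k)) = of_real (- \<sigma> * ln (real k)) + \<i> * of_real (- (ln (real k) * t))"
      by (simp add: complex_eq_iff)
    also have "exp \<dots> = of_real (real k powr (- \<sigma>)) * cis (- (ln (real k) * t))"
      using k by (simp only: exp_add exp_of_real cis_conv_exp) (simp add: powr_def)
    finally show ?thesis by (simp add: c_def)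
  qed
  have "complex_of_real (norm (sum c S) ^ 2) = sum c S * cnj (sum c S)" by (rule complex_norm_square)
  also have "\<dots> = (\<Sum>k\<in>S. \<Sum>l\<in>S. c k * cnj (c l))" by (simp add: sum_product)
  finally have "norm (sum c S) ^ 2 = Re (\<Sum>k\<in>S. \<Sum>l\<in>S. c k * cnj (c l))" by (metis Re_complex_of_real)
  also have "\<dots> = (\<Sum>k\<in>S. \<Sum>l\<in>S. Re (c k * cnj (c l)))" by simp
  also have "\<dots> = (\<Sum>k\<in>S. \<Sum>l\<in>S. ?R k l)"
  proof (intro sum.cong refl)
    fix k l assume kl: "k \<in> S" "l \<in> S"
    have "Re (c k * cnj (c l)) = (a k * real k powr (- \<sigma>)) * (a l * real l powr (- \<sigma>)) *
        (cos (ln (real k) * t) * cos (ln (real l) * t) + sin (ln (real k) * t) * sin (ln (real l) * t))"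
      unfolding ck[OF kl(1)] ck[OF kl(2)] by (simp add: algebra_simps)
    also have "cos (ln (real k) * t) * cos (ln (real l) * t) + sin (ln (real k) * t) * sin (ln (real l) * t) = cos ((ln (real k) - ln (real l)) * t)"
      by (simp add: left_diff_distrib cos_diff)
    finally show "Re (c k * cnj (c l)) = ?R k l"
      by (simp add: mult_ac)
  qed
  finally show ?thesis unfolding c_def .
qed

definition offdiagonal_sum :: "real \<Rightarrow> nat set \<Rightarrow> real" where
  "offdiagonal_sum \<sigma> S = (\<Sum>k\<in>S. \<Sum>l\<in>S - {k}. real k powr (- \<sigma>) * real l powr (- \<sigma>) *
     (divisor_count k * divisor_count l * (2 / \<bar>ln (real k) - ln (real l)\<bar>)))"

text \<open>
  The mean value theorem for Dirichlet polynomials in its elementary form: the square is expanded and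
  integrated term by term. For \<open>k = l\<close> the sharper bound \<open>A\<close> is used, which reflects the
  cancellation in the coefficients; for \<open>k \<noteq> l\<close> the number of divisors suffices.
\<close>

lemma mean_square_cutoff:
  fixes A :: "nat \<Rightarrow> real" and \<sigma> :: real
  assumes W: "W \<le> W'" and S: "S \<subseteq> {1..K}"
    and A: "\<And>t k. k \<in> S \<Longrightarrow> W \<le> t \<Longrightarrow> t \<le> W' \<Longrightarrow> \<bar>cutoff_coeff X t k\<bar> \<le> A k"
  defines "D \<equiv> \<lambda>t. norm (\<Sum>k\<in>S. of_real (cutoff_coeff X t k) * of_nat k powr (- Complex \<sigma> t)) ^ 2"
  shows "D integrable_on {W..W'}"
    and "integral {W..W'} D \<le> (W' - W) * (\<Sum>k\<in>S. A k ^ 2 * real k powr (- 2 * \<sigma>))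
       + offdiagonal_sum \<sigma> S" (is "_ \<le> ?B")
proof -
  have finS: "finite S" using S finite_subset by blast
  have pos: "k > 0" if "k \<in> S" for k using that S by auto
  define G where "G = (\<lambda>k l t. cutoff_coeff X t k * cutoff_coeff X t l * cos ((ln (real k) - ln (real l)) * t))"
  define w where "w k l = real k powr (- \<sigma>) * real l powr (- \<sigma>)" for k l :: nat
  have D_eq: "D = (\<lambda>t. \<Sum>k\<in>S. \<Sum>l\<in>S. w k l * G k l t)"
    unfolding D_def G_def w_def by (rule ext, rule norm_dirichlet_square[OF pos finS])
  have ln_ne: "ln (real k) - ln (real l) \<noteq> 0" if "k \<in> S" "l \<in> S" "k \<noteq> l" for k l
    using pos[OF that(1)] pos[OF that(2)] that(3) by simp
  have Gint: "G k l integrable_on {W..W'}" if "k \<in> S" "l \<in> S" for k l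
    unfolding G_def by (intro integral_cutoff_coeff_offdiagonal pos that)
  have Gint': "(\<lambda>t. w k l * G k l t) integrable_on {W..W'}" if "k \<in> S" "l \<in> S" for k l
    using integrable_on_cmult_left[OF Gint[OF that], of "w k l"] by simp
  show "D integrable_on {W..W'}"
    unfolding D_eq by (intro integrable_sum finS Gint')
  have "integral {W..W'} D = (\<Sum>k\<in>S. \<Sum>l\<in>S. w k l * integral {W..W'} (G k l))"
  proof -
    have "integral {W..W'} D = (\<Sum>k\<in>S. integral {W..W'} (\<lambda>t. \<Sum>l\<in>S. w k l * G k l t))"
      unfolding D_eq by (intro integral_sum finS integrable_sum Gint')
    also have "\<dots> = (\<Sum>k\<in>S. \<Sum>l\<in>S. integral {W..W'} (\<lambda>t. w k l * G k l t))"
      by (intro sum.cong refl integral_sum finS Gint')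
    finally show ?thesis by (simp only: integral_mult_right)
  qed
  also have "\<dots> = (\<Sum>k\<in>S. w k k * integral {W..W'} (G k k)) + (\<Sum>k\<in>S. \<Sum>l\<in>S - {k}. w k l * integral {W..W'} (G k l))"
    unfolding sum.distrib[symmetric] using finS by (intro sum.cong refl sum.remove)
  also have "\<dots> \<le> (\<Sum>k\<in>S. (W' - W) * (A k ^ 2 * real k powr (- 2 * \<sigma>)))
     + offdiagonal_sum \<sigma> S"
    unfolding offdiagonal_sum_def
  proof (intro add_mono sum_mono)
    fix k assume k: "k \<in> S"
    have "integral {W..W'} (G k k) \<le> integral {W..W'} (\<lambda>_. A k ^ 2)"
    proof (rule integral_le[OF Gint[OF k k]])
      fix t assume t: "t \<in> {W..W'}"
      then have "\<bar>cutoff_coeff X t k\<bar> \<le> A k" using A[OF k] by simp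
      then have "\<bar>cutoff_coeff X t k\<bar> ^ 2 \<le> A k ^ 2" by (rule power_mono) simp
      then show "G k k t \<le> A k ^ 2" by (simp add: G_def power2_eq_square)
    qed (rule integrable_const_ivl)
    also have "\<dots> = (W' - W) * A k ^ 2" using W by simp
    finally have "w k k * integral {W..W'} (G k k) \<le> w k k * ((W' - W) * A k ^ 2)"
      by (rule mult_left_mono) (simp add: w_def)
    also have "w k k * ((W' - W) * A k ^ 2) = (W' - W) * (A k ^ 2 * real k powr (- 2 * \<sigma>))"
    proof -
      have "w k k = real k powr (- 2 * \<sigma>)" by (simp add: w_def powr_add[symmetric])
      then show ?thesis by (simp only: mult_ac)
    qed
    finally show "w k k * integral {W..W'} (G k k) \<le> (W' - W) * (A k ^ 2 * real k powr (- 2 * \<sigma>))" .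
  next
    fix k l assume "k \<in> S" "l \<in> S - {k}"
    then have "\<bar>integral {W..W'} (G k l)\<bar> \<le> divisor_count k * divisor_count l * (2 / \<bar>ln (real k) - ln (real l)\<bar>)"
      unfolding G_def by (intro integral_cutoff_coeff_offdiagonal(2) pos ln_ne) auto
    then show "w k l * integral {W..W'} (G k l) \<le> real k powr (- \<sigma>) * real l powr (- \<sigma>) *
            (divisor_count k * divisor_count l * (2 / \<bar>ln (real k) - ln (real l)\<bar>))"
      unfolding w_def by (intro mult_left_mono) auto
  qed
  finally show "integral {W..W'} D \<le> ?B"
    by (simp add: sum_distrib_left)
qed

section \<open>Bounds for the diagonal and non-diagonal sums\<close>

lemma sum_inverse_distance_le:
  assumes "k \<in> {1..K}"
  shows "(\<Sum>l=1..K. 1 / \<bar>real k - real l\<bar>) \<le> 2 * (1 + ln (real K))"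
proof -
  have K: "K \<ge> 1" using assms by auto
  have split: "{1..K} = {1..<k} \<union> ({k} \<union> {k<..K})" using assms by auto
  have "(\<Sum>l=1..K. 1 / \<bar>real k - real l\<bar>) = (\<Sum>l\<in>{1..<k}. 1 / \<bar>real k - real l\<bar>) + (\<Sum>l\<in>{k<..K}. 1 / \<bar>real k - real l\<bar>)"
    unfolding split by (subst sum.union_disjoint) auto
  also have "(\<Sum>l\<in>{1..<k}. 1 / \<bar>real k - real l\<bar>) = (\<Sum>j\<in>{1..<k}. 1 / real j)"
    by (rule sum.reindex_bij_witness[of _ "\<lambda>j. k - j" "\<lambda>l. k - l"]) (auto simp: of_nat_diff)
  also have "\<dots> \<le> (\<Sum>j=1..K. 1 / real j)" by (rule sum_mono2) (use assms in auto)
  also have "(\<Sum>l\<in>{k<..K}. 1 / \<bar>real k - real l\<bar>) = (\<Sum>j\<in>{1..K - k}. 1 / real j)"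
    by (rule sum.reindex_bij_witness[of _ "\<lambda>j. k + j" "\<lambda>l. l - k"]) (auto simp: of_nat_diff)
  also have "\<dots> \<le> (\<Sum>j=1..K. 1 / real j)" by (rule sum_mono2) auto
  finally show ?thesis using sum_inverse_le[OF K] by simp
qed

lemma inverse_log_ratio_le:
  assumes "0 < k" "k < l"
  shows "1 / \<bar>ln (real k) - ln (real l)\<bar> \<le> 1 + real k / (real l - real k)"
proof -
  have kl: "0 < real k" "real k < real l" using assms by auto
  have "ln (real k / real l) \<le> real k / real l - 1"
    using kl by (intro ln_le_minus_one) auto
  then have le: "(real l - real k) / real l \<le> ln (real l) - ln (real k)"
    using kl by (simp add: ln_div diff_divide_distrib)
  have pos: "(real l - real k) / real l > 0" using kl by simp
  have "\<bar>ln (real k) - ln (real l)\<bar> = ln (real l) - ln (real k)" using kl by simp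
  then have "1 / \<bar>ln (real k) - ln (real l)\<bar> \<le> 1 / ((real l - real k) / real l)"
    using le pos by (simp only:) (intro frac_le, auto)
  also have "\<dots> = 1 + real k / (real l - real k)" using kl by (simp add: field_simps)
  finally show ?thesis .
qed

text \<open>
  Separates the terms in which \<open>k\<close> and \<open>l\<close> are far apart, where the inverse logarithm is bounded,
  from the Hilbert-type contribution of neighbouring \<open>k\<close> and \<open>l\<close>.
\<close>

lemma offdiagonal_term_le:
  assumes "k > 0" "l > 0" "k \<noteq> l" and a: "1 / 2 \<le> a"
  shows "real k powr (- a) * real l powr (- a) * (1 / \<bar>ln (real k) - ln (real l)\<bar>)
    \<le> real k powr (- a) * real l powr (- a) + (real k powr (1 - 2 * a) + real l powr (1 - 2 * a)) * (1 / \<bar>real k - real l\<bar>)"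
  using assms(1-3)
proof (induction k l rule: linorder_wlog)
  case (sym k l)
  then show ?case by (simp only: abs_minus_commute[of "real l"] abs_minus_commute[of "ln (real l)"] ac_simps simp_thms)
next
  case (le k l)
  then have kl: "0 < k" "k < l" by auto
  define w where "w = real k powr (- a) * real l powr (- a)"
  define d where "d = 1 / \<bar>real k - real l\<bar>"
  have "w * real k \<le> real k powr (- a) * real k powr (- a) * real k"
    unfolding w_def using kl a by (intro mult_right_mono mult_left_mono powr_mono2') auto
  also have "\<dots> = real k powr (1 - 2 * a)" using kl by (simp add: powr_add[symmetric] powr_mult_base mult.commute)
  finally have "w * real k * d \<le> real k powr (1 - 2 * a) * d" by (rule mult_right_mono) (simp add: d_def)
  moreover have "0 \<le> real l powr (1 - 2 * a) * d" by (simp add: d_def)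
  moreover have "w * (1 / \<bar>ln (real k) - ln (real l)\<bar>) \<le> w * (1 + real k * d)"
    using inverse_log_ratio_le[OF kl] kl by (intro mult_left_mono) (simp_all add: w_def d_def)
  ultimately have "w * (1 / \<bar>ln (real k) - ln (real l)\<bar>) \<le> w + (real k powr (1 - 2 * a) + real l powr (1 - 2 * a)) * d"
    by (simp add: algebra_simps)
  then show ?case by (simp only: w_def d_def)
qed

text \<open>
  The exponent \<open>2 - 2 a\<close> is that of the square of the trivial bound for the sum of \<open>k powr (- a)\<close>: for a
  polynomial of length \<open>K\<close> the non-diagonal terms are essentially of this size. For
  \<open>K\<close> slightly larger than \<open>T\<close> this still beats \<open>T\<^sup>3\<^sup>/\<^sup>2\<^sup>-\<^sup>a\<close> if \<open>a > 1 / 2\<close>.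
\<close>

lemma offdiagonal_sum_le:
  assumes K: "K \<ge> 1" and a: "1 / 2 \<le> a" "a \<le> 1" "a \<le> \<sigma>" and S: "S \<subseteq> {1..K}"
    and C: "C \<ge> 1" "\<And>n. n > 0 \<Longrightarrow> divisor_count n \<le> C * real n powr \<epsilon>" and eps: "\<epsilon> \<ge> 0"
  shows "offdiagonal_sum \<sigma> S
      \<le> 10 * C ^ 2 * real K powr (2 - 2 * a + 2 * \<epsilon>) * (1 + ln (real K)) ^ 2"
proof -
  define L where "L = 1 + ln (real K)"
  define B where "B = C * real K powr \<epsilon>"
  define I where "I k l = 1 / \<bar>real k - real l\<bar>" for k l :: nat
  define V where "V = (\<Sum>k=1..K. \<Sum>l=1..K. real k powr (1 - 2 * a) * I k l)"
  have L: "L \<ge> 0" using K by (simp add: L_def)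
  have B: "B \<ge> 0" using C by (simp add: B_def)
  have dB: "divisor_count n \<le> B" if "n \<in> {1..K}" for n
  proof -
    have "divisor_count n \<le> C * real n powr \<epsilon>" using C(2)[of n] that by simp
    also have "\<dots> \<le> B" unfolding B_def using that C eps by (intro mult_left_mono powr_mono2) auto
    finally show ?thesis .
  qed
  have term_le: "real k powr (- \<sigma>) * real l powr (- \<sigma>) * (divisor_count k * divisor_count l * (2 / \<bar>ln (real k) - ln (real l)\<bar>))
      \<le> 2 * B ^ 2 * (real k powr (- a) * real l powr (- a) + (real k powr (1 - 2 * a) + real l powr (1 - 2 * a)) * I k l)"
    if kl: "k \<in> {1..K}" "l \<in> {1..K}" "k \<noteq> l" for k l
  proof -
    have "real k powr (- \<sigma>) * real l powr (- \<sigma>) * (divisor_count k * divisor_count l * (2 / \<bar>ln (real k) - ln (real l)\<bar>))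
      \<le> real k powr (- a) * real l powr (- a) * (B * B * (2 / \<bar>ln (real k) - ln (real l)\<bar>))"
      using kl a B by (intro mult_mono powr_mono dB) auto
    also have "\<dots> = 2 * B ^ 2 * (real k powr (- a) * real l powr (- a) * (1 / \<bar>ln (real k) - ln (real l)\<bar>))"
      by (simp add: power2_eq_square)
    also have "\<dots> \<le> 2 * B ^ 2 * (real k powr (- a) * real l powr (- a) + (real k powr (1 - 2 * a) + real l powr (1 - 2 * a)) * I k l)"
      unfolding I_def using offdiagonal_term_le[OF _ _ kl(3) a(1)] kl(1,2) by (intro mult_left_mono) auto
    finally show ?thesis .
  qed
  define H where "H k l = 2 * B ^ 2 * (real k powr (- a) * real l powr (- a) + (real k powr (1 - 2 * a) + real l powr (1 - 2 * a)) * I k l)" for k l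
  have H0: "H k l \<ge> 0" for k l unfolding H_def I_def by (intro mult_nonneg_nonneg add_nonneg_nonneg) auto
  have finS: "finite S" using S finite_subset by blast
  have "offdiagonal_sum \<sigma> S \<le> (\<Sum>k\<in>S. \<Sum>l\<in>S - {k}. H k l)"
    unfolding offdiagonal_sum_def H_def by (intro sum_mono term_le) (use S in auto)
  also have "\<dots> \<le> (\<Sum>k\<in>S. \<Sum>l=1..K. H k l)"
    by (intro sum_mono sum_mono2) (use S H0 in auto)
  also have "\<dots> \<le> (\<Sum>k=1..K. \<Sum>l=1..K. H k l)"
    by (rule sum_mono2) (use S H0 in \<open>auto intro!: sum_nonneg\<close>)
  also have "\<dots> = 2 * B ^ 2 * ((\<Sum>k=1..K. \<Sum>l=1..K. real k powr (- a) * real l powr (- a))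
      + V + (\<Sum>k=1..K. \<Sum>l=1..K. real l powr (1 - 2 * a) * I k l))"
    by (simp add: H_def V_def sum_distrib_left sum.distrib algebra_simps)
  also have "(\<Sum>k=1..K. \<Sum>l=1..K. real l powr (1 - 2 * a) * I k l) = V"
    unfolding V_def by (subst sum.swap) (simp add: I_def abs_minus_commute)
  also have "(\<Sum>k=1..K. \<Sum>l=1..K. real k powr (- a) * real l powr (- a)) = (\<Sum>k=1..K. real k powr (- a)) ^ 2"
    by (simp only: power2_eq_square sum_product)
  also have "2 * B ^ 2 * ((\<Sum>k=1..K. real k powr (- a)) ^ 2
      + V + V)
      \<le> 2 * B ^ 2 * (real K powr (2 - 2 * a) * L ^ 2 + 2 * (real K powr (2 - 2 * a) * L ^ 2) + 2 * (real K powr (2 - 2 * a) * L ^ 2))"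
  proof -
    have "(\<Sum>k=1..K. real k powr (- a)) ^ 2 \<le> (real K powr (1 - a) * L) ^ 2"
      unfolding L_def by (intro power_mono sum_powr_le K a sum_nonneg) auto
    also have "\<dots> = real K powr (2 - 2 * a) * L ^ 2"
    proof -
      have "real K powr (2 - 2 * a) = real K powr (1 - a) * real K powr (1 - a)" by (simp add: powr_add[symmetric])
      then show ?thesis by (simp add: power2_eq_square)
    qed
    finally have 1: "(\<Sum>k=1..K. real k powr (- a)) ^ 2 \<le> real K powr (2 - 2 * a) * L ^ 2" .
    have "V \<le> (\<Sum>k=1..K. real k powr (1 - 2 * a) * (2 * L))"
      unfolding V_def sum_distrib_left[symmetric] I_def L_def by (intro sum_mono mult_left_mono sum_inverse_distance_le) auto
    also have "\<dots> = 2 * L * (\<Sum>k=1..K. real k powr (- (2 * a - 1)))" by (simp add: sum_distrib_left mult_ac)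
    also have "\<dots> \<le> 2 * L * (real K powr (1 - (2 * a - 1)) * L)"
      unfolding L_def using L[unfolded L_def] a by (intro mult_left_mono sum_powr_le K) auto
    also have "\<dots> = 2 * (real K powr (2 - 2 * a) * L ^ 2)" by (simp add: power2_eq_square)
    finally have 2: "V \<le> 2 * (real K powr (2 - 2 * a) * L ^ 2)" .
    show ?thesis by (intro mult_left_mono add_mono 1 2) auto
  qed
  also have "\<dots> = 10 * C ^ 2 * (real K powr \<epsilon> * real K powr \<epsilon> * real K powr (2 - 2 * a)) * L ^ 2"
    by (simp add: B_def power2_eq_square)
  also have "real K powr \<epsilon> * real K powr \<epsilon> * real K powr (2 - 2 * a) = real K powr (2 - 2 * a + 2 * \<epsilon>)"
    by (simp add: powr_add[symmetric] algebra_simps)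
  finally show ?thesis by (simp only: L_def)
qed

text \<open>
  The tail over \<open>n m > Y\<close> is summed over \<open>m > Y / n\<close> first, which gives \<open>Y powr (1 - p)\<close> times
  \<open>1 / n\<close>; the sum over \<open>n\<close> costs one logarithm.
\<close>

lemma sum_divisor_count_tail_le:
  assumes p: "1 < p" "p \<le> 2" and Y: "Y > 0" and X: "X \<ge> 1"
  shows "(\<Sum>n | n \<in> {1..X} \<and> Y < real n. divisor_count n * real n powr (- p)) \<le> 2 / (p - 1) * Y powr (1 - p) * (1 + ln (real X))"
proof -
  define h where "h k = (if Y < real k then real k powr (- p) else 0)" for k :: nat
  have "(\<Sum>n | n \<in> {1..X} \<and> Y < real n. divisor_count n * real n powr (- p))
      = (\<Sum>k=1..X. if Y < real k then divisor_count k * real k powr (- p) else 0)"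
    by (subst sum.inter_filter[symmetric]) auto
  also have "\<dots> = (\<Sum>k=1..X. \<Sum>n | n dvd k \<and> True. h k)"
    by (intro sum.cong refl) (simp add: divisor_count_def h_def)
  also have "\<dots> \<le> (\<Sum>n | n \<in> {1..X} \<and> True. \<Sum>m=1..X. h (n * m))"
    by (rule sum_divisors_le) (simp add: h_def)
  also have "\<dots> = (\<Sum>n=1..X. \<Sum>m=1..X. h (n * m))"
    by (simp only: simp_thms Collect_mem_eq)
  also have "\<dots> \<le> (\<Sum>n=1..X. 2 / (p - 1) * Y powr (1 - p) * (1 / real n))"
  proof (rule sum_mono)
    fix n assume n: "n \<in> {1..X}"
    have "(\<Sum>m=1..X. h (n * m)) =
        (\<Sum>m=1..X. if Y / real n < real m then real n powr (- p) * real m powr (- p) else 0)"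
      using n by (intro sum.cong refl) (auto simp: h_def powr_mult field_simps)
    also have "\<dots> = real n powr (- p) * (\<Sum>m | m \<in> {1..X} \<and> Y / real n < real m. real m powr (- p))"
      unfolding sum_distrib_left by (subst sum.inter_filter[symmetric]) auto
    also have "\<dots> \<le> real n powr (- p) * (p / (p - 1) * (Y / real n) powr (1 - p))"
      using n Y p by (intro mult_left_mono sum_powr_tail_le) auto
    also have "\<dots> = p / (p - 1) * Y powr (1 - p) * (real n powr (- p) / real n powr (1 - p))"
      using n Y by (simp add: powr_divide)
    also have "real n powr (- p) / real n powr (1 - p) = 1 / real n"
      using n by (simp add: powr_diff powr_minus field_simps)
    also have "p / (p - 1) * Y powr (1 - p) * (1 / real n) \<le> 2 / (p - 1) * Y powr (1 - p) * (1 / real n)"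
      using p by (intro mult_right_mono divide_right_mono) auto
    finally show "(\<Sum>m=1..X. h (n * m)) \<le> 2 / (p - 1) * Y powr (1 - p) * (1 / real n)" .
  qed
  also have "\<dots> = 2 / (p - 1) * Y powr (1 - p) * (\<Sum>n=1..X. 1 / real n)" by (simp add: sum_distrib_left)
  also have "\<dots> \<le> 2 / (p - 1) * Y powr (1 - p) * (1 + ln (real X))"
    using p by (intro mult_left_mono sum_inverse_le X) auto
  finally show ?thesis .
qed

text \<open>
  One of the two factors is opened as a sum over divisors \<open>n > Y\<close> of \<open>k = n m\<close>, the other one is
  replaced by \<open>d(k) \<le> d(n) d(m)\<close>. The sum over \<open>m\<close> converges, so only one logarithm is lost, where
  the sum of \<open>d(k)\<^sup>2\<close> over \<open>k > Y\<close> would lose three.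
\<close>

lemma large_divisor_square_sum_le:
  assumes p: "1 < p" "p \<le> 2" and Y: "Y > 0" and X: "X \<ge> 1"
  shows "(\<Sum>k=1..X. large_divisor_count Y k ^ 2 * real k powr (- p)) \<le> 32 / (p - 1) ^ 3 * Y powr (1 - p) * (1 + ln (real X))"
proof -
  have "(\<Sum>k=1..X. large_divisor_count Y k ^ 2 * real k powr (- p))
      \<le> (\<Sum>k=1..X. \<Sum>n | n dvd k \<and> Y < real n. divisor_count k * real k powr (- p))"
  proof (rule sum_mono)
    fix k assume k: "k \<in> {1..X}"
    have "large_divisor_count Y k \<le> divisor_count k"
      unfolding large_divisor_count_def divisor_count_def using k
      by (intro of_nat_mono card_mono) (auto simp: finite_divisors_nat)
    then have "large_divisor_count Y k * large_divisor_count Y k * real k powr (- p) \<le> large_divisor_count Y k * divisor_count k * real k powr (- p)"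
      by (intro mult_right_mono mult_left_mono) (auto simp: large_divisor_count_def)
    then show "large_divisor_count Y k ^ 2 * real k powr (- p) \<le> (\<Sum>n | n dvd k \<and> Y < real n. divisor_count k * real k powr (- p))"
      by (simp add: large_divisor_count_def power2_eq_square)
  qed
  also have "\<dots> \<le> (\<Sum>n | n \<in> {1..X} \<and> Y < real n. \<Sum>m=1..X. divisor_count (n * m) * real (n * m) powr (- p))"
    by (rule sum_divisors_le) simp
  also have "\<dots> \<le> (\<Sum>n | n \<in> {1..X} \<and> Y < real n. \<Sum>m=1..X. (divisor_count n * real n powr (- p)) * (divisor_count m * real m powr (- p)))"
  proof (intro sum_mono)
    fix n m assume "n \<in> {n \<in> {1..X}. Y < real n}" "m \<in> {1..X}"
    then have "divisor_count (n * m) * real (n * m) powr (- p) \<le> (divisor_count n * divisor_count m) * (real n powr (- p) * real m powr (- p))"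
      by (intro mult_mono divisor_count_mult_le) (auto simp: powr_mult)
    then show "divisor_count (n * m) * real (n * m) powr (- p) \<le> (divisor_count n * real n powr (- p)) * (divisor_count m * real m powr (- p))"
      by (simp only: mult_ac)
  qed
  also have "\<dots> = (\<Sum>n | n \<in> {1..X} \<and> Y < real n. divisor_count n * real n powr (- p)) * (\<Sum>m=1..X. divisor_count m * real m powr (- p))"
    by (simp only: sum_product)
  also have "\<dots> \<le> (2 / (p - 1) * Y powr (1 - p) * (1 + ln (real X))) * (4 / (p - 1)) ^ 2"
  proof (rule mult_mono[OF sum_divisor_count_tail_le[OF assms]])
    have "(\<Sum>m=1..X. divisor_count m * real m powr (- p)) = (\<Sum>k=1..X. \<Sum>n | n dvd k \<and> True. real k powr (- p))"
      by (simp add: divisor_count_def)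
    also have "\<dots> \<le> (\<Sum>n | n \<in> {1..X} \<and> True. \<Sum>m=1..X. real (n * m) powr (- p))"
      by (rule sum_divisors_le) simp
    also have "\<dots> = (\<Sum>n=1..X. real n powr (- p)) ^ 2"
      unfolding power2_eq_square sum_product by (simp only: simp_thms Collect_mem_eq) (simp add: powr_mult)
    also have "\<dots> \<le> (4 / (p - 1)) ^ 2"
      by (intro power_mono sum_powr_bounded p sum_nonneg) auto
    finally show "(\<Sum>m=1..X. divisor_count m * real m powr (- p)) \<le> (4 / (p - 1)) ^ 2" .
  qed (use p X in \<open>auto intro!: sum_nonneg mult_nonneg_nonneg\<close>)
  also have "\<dots> = 32 / (p - 1) ^ 3 * Y powr (1 - p) * (1 + ln (real X))"
    by (simp add: power_divide power3_eq_cube power2_eq_square mult.assoc)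
  finally show ?thesis .
qed

lemma divisor_square_tail_le:
  assumes C: "C \<ge> 1" "\<And>n. n > 0 \<Longrightarrow> divisor_count n \<le> C * real n powr \<epsilon>"
    and q: "1 < p - 2 * \<epsilon>" and p: "p \<le> 2" "\<epsilon> \<ge> 0" and Z: "Z > 0"
  shows "(\<Sum>k | k \<in> {1..K} \<and> Z < real k. divisor_count k ^ 2 * real k powr (- p)) \<le> 2 * C ^ 2 / (p - 2 * \<epsilon> - 1) * Z powr (1 - (p - 2 * \<epsilon>))"
proof -
  define q where "q = p - 2 * \<epsilon>"
  have "(\<Sum>k | k \<in> {1..K} \<and> Z < real k. divisor_count k ^ 2 * real k powr (- p)) \<le> (\<Sum>k | k \<in> {1..K} \<and> Z < real k. C ^ 2 * real k powr (- q))"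
  proof (rule sum_mono)
    fix k assume k: "k \<in> {k \<in> {1..K}. Z < real k}"
    then have "divisor_count k ^ 2 \<le> (C * real k powr \<epsilon>) ^ 2" by (intro power_mono C) auto
    then have "divisor_count k ^ 2 * real k powr (- p) \<le> (C * real k powr \<epsilon>) ^ 2 * real k powr (- p)" by (rule mult_right_mono) simp
    also have "\<dots> = C ^ 2 * (real k powr \<epsilon> * real k powr \<epsilon> * real k powr (- p))" by (simp add: power2_eq_square)
    also have "real k powr \<epsilon> * real k powr \<epsilon> * real k powr (- p) = real k powr (- q)" by (simp add: q_def powr_add[symmetric])
    finally show "divisor_count k ^ 2 * real k powr (- p) \<le> C ^ 2 * real k powr (- q)" .
  qed
  also have "\<dots> = C ^ 2 * (\<Sum>k | k \<in> {1..K} \<and> Z < real k. real k powr (- q))" by (simp add: sum_distrib_left)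
  also have "\<dots> \<le> C ^ 2 * (q / (q - 1) * Z powr (1 - q))"
    using q Z unfolding q_def by (intro mult_left_mono sum_powr_tail_le) auto
  also have "\<dots> \<le> C ^ 2 * (2 / (q - 1) * Z powr (1 - q))"
    using q p unfolding q_def by (intro mult_left_mono mult_right_mono divide_right_mono) auto
  also have "\<dots> = 2 * C ^ 2 / (q - 1) * Z powr (1 - q)" by simp
  finally show ?thesis unfolding q_def .
qed

section \<open>The mean square of the mollified function\<close>

text \<open>
  The parameter \<open>g\<close> is positive and \<open>1 / 2 + 2 g\<close> is the left edge of the region in which zeros
  are counted. The length exceeds \<open>sqrt T\<close> by the factor \<open>T powr (g / 4)\<close>.
\<close>

definition mollifier_length :: "real \<Rightarrow> real \<Rightarrow> nat" where
  "mollifier_length g T = nat \<lfloor>T powr (1 / 2 + g / 4)\<rfloor>"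

definition mollified_defect :: "real \<Rightarrow> real \<Rightarrow> complex \<Rightarrow> complex" where
  "mollified_defect g T s = riemann_aux s * mollifier (mollifier_length g T) s - 1"

lemma mollifier_holomorphic: "mollifier X holomorphic_on UNIV"
  unfolding mollifier_def by (intro holomorphic_intros) auto

lemma mollified_defect_holomorphic: "mollified_defect g T holomorphic_on UNIV"
  unfolding mollified_defect_def
  by (intro holomorphic_intros riemann_aux_holomorphic mollifier_holomorphic)

lemma norm_of_nat_powr: "n > 0 \<Longrightarrow> norm (of_nat n powr (- s) :: complex) = real n powr (- Re s)"
  by (simp add: norm_powr_real_powr)

lemma norm_mollifier_le: "norm (mollifier X s) \<le> (\<Sum>d=1..X. real d powr (- Re s))"
  unfolding mollifier_def
proof (rule sum_norm_le)
  fix d assume d: "d \<in> {1..X}"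
  show "norm (of_real (moebius_mu d) * of_nat d powr (- s)) \<le> real d powr (- Re s)"
    using d mult_right_mono[OF abs_moebius_le[of d], of "real d powr (- Re s)"]
    by (simp add: norm_mult norm_of_nat_powr)
qed

text \<open>
  The term \<open>k = 1\<close> of the product has coefficient \<open>1\<close> and is cancelled by the \<open>- 1\<close>.
\<close>

lemma defect_decomposition:
  assumes t: "Im s \<ge> 2 * pi" and N: "N = cutoff_length (Im s)" and X: "X \<ge> 1" and K: "N * X \<le> K" "K \<ge> 1"
  shows "riemann_aux s * mollifier X s - 1 =
    (\<Sum>k=2..K. of_real (cutoff_coeff X (Im s) k) * of_nat k powr (- s)) + siegel_line_integral (real N + 1 / 2) s * mollifier X s"
proof -
  have "Im s \<ge> 0" using t pi_gt_zero by linarith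
  note prod = cutoff_product[OF this N K(1), of s]
  have "{1..K} = insert 1 {2..K}" using K by auto
  then have "(\<Sum>k=1..K. of_real (cutoff_coeff X (Im s) k) * of_nat k powr (- s)) =
     of_real (cutoff_coeff X (Im s) 1) * of_nat 1 powr (- s) + (\<Sum>k=2..K. of_real (cutoff_coeff X (Im s) k) * of_nat k powr (- s))"
    by simp
  also have "cutoff_coeff X (Im s) 1 = 1" by (rule cutoff_coeff_1[OF X t])
  finally show ?thesis
    unfolding riemann_aux_dirichlet_plus_tail[of s N] distrib_right prod by simp
qed

lemma divide_powr_minus: "x \<ge> 0 \<Longrightarrow> y > 0 \<Longrightarrow> (x / y) powr (- e) = x powr (- e) * y powr (e::real)"
  by (simp add: powr_divide powr_minus field_simps)

lemma exp_log_scale: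
  assumes "ln T > 0" "T > (0::real)" shows "T powr (1 / ln T) \<le> 3"
  using assms exp_le by (simp add: powr_def)

text \<open>
  The Dirichlet polynomial has length \<open>K\<close> at all heights up to \<open>3 T\<close>, because
  \<open>sqrt (3 T / 2\<pi>) \<le> sqrt T\<close>.
\<close>

lemma parameter_bounds:
  assumes g: "0 < g" "g \<le> 1 / 4" and T: "T \<ge> 16" and t: "t \<le> 3 * T" "t \<ge> 0"
  defines "X \<equiv> mollifier_length g T" and "K \<equiv> nat \<lfloor>T powr (1 + g / 4)\<rfloor>"
  shows "X \<ge> 1" "real X \<le> T powr (1 / 2 + g / 4)" "real X \<le> T" "K \<ge> 1" "real K \<le> T powr (1 + g / 4)" "real K \<le> T ^ 2"
    "cutoff_length t * X \<le> K"
proof -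
  have Z1: "T powr (1 / 2 + g / 4) \<ge> 1" "T powr (1 + g / 4) \<ge> 1"
    using T g by (intro ge_one_powr_ge_zero; simp)+
  show X: "X \<ge> 1" "real X \<le> T powr (1 / 2 + g / 4)"
    using Z1 by (simp_all add: X_def mollifier_length_def le_nat_iff)
  have "T powr (1 / 2 + g / 4) \<le> T powr 1" using T g by (intro powr_mono) auto
  then show "real X \<le> T" using X T by simp
  show K: "K \<ge> 1" "real K \<le> T powr (1 + g / 4)"
    using Z1 by (simp_all add: K_def le_nat_iff)
  have "T powr (1 + g / 4) \<le> T powr 2" using T g by (intro powr_mono) auto
  then show "real K \<le> T ^ 2" using K T by (simp add: powr_numeral)
  define N where "N = cutoff_length t"
  have "real N \<le> sqrt (t / (2 * pi))" using t by (simp add: N_def cutoff_length_def)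
  also have "\<dots> \<le> sqrt T"
  proof (rule real_sqrt_le_mono)
    have "t \<le> 2 * pi * T" using t T pi_gt3 mult_right_mono[of 3 "2 * pi" T] by linarith
    then show "t / (2 * pi) \<le> T" by (simp add: field_simps)
  qed
  also have "\<dots> = T powr (1 / 2)" using T by (simp add: powr_half_sqrt)
  finally have "real N * real X \<le> T powr (1 / 2) * T powr (1 / 2 + g / 4)"
    using X by (intro mult_mono) auto
  also have "\<dots> = T powr (1 + g / 4)" by (simp add: powr_add[symmetric])
  finally have "real (N * X) \<le> T powr (1 + g / 4)" by simp
  then show "N * X \<le> K" unfolding K_def by (simp add: le_nat_iff le_floor_iff)
qed

text \<open>
  The exponents of \<open>T\<close> in, respectively, the non-diagonal terms, the contribution of the tail of
  the Siegel integral, the admissible exponent of the divisor bound and the diagonal terms beyond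
  the length of the mollifier. The target exponent is \<open>1 - 2 g\<close>; the first two inequalities leave a
  surplus of \<open>g / 2\<close> that absorbs logarithms.
\<close>

lemma exponent_inequalities:
  assumes g: "0 < g" "g \<le> (1 / 4 :: real)"
  shows "(1 + g / 4) * (1 - 3 * g + g\<^sup>2) \<le> 1 - 2 * g - g / 2"
    and "- (1 / 2 + 3 / 2 * g) + (1 / 2 + g / 4) * (1 - 3 * g) \<le> - 2 * g - g / 2"
    and "g\<^sup>2 \<le> g / 4" and "\<delta> \<ge> 0 \<Longrightarrow> (1 / 2 + g / 4) * - (4 * g - 2 * \<delta> - g\<^sup>2) \<le> - 2 * g + 2 * \<delta>"
proof -
  show g2: "g\<^sup>2 \<le> g / 4" using mult_left_mono[OF g(2), of g] g by (simp add: power2_eq_square)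
  have g3: "g * g\<^sup>2 \<le> g\<^sup>2" using mult_right_mono[of g 1 "g\<^sup>2"] g by simp
  have "(1 + g / 4) * (1 - 3 * g + g\<^sup>2) = 1 - 11 / 4 * g + 1 / 4 * g\<^sup>2 + 1 / 4 * (g * g\<^sup>2)"
    by (simp add: algebra_simps power2_eq_square)
  then show "(1 + g / 4) * (1 - 3 * g + g\<^sup>2) \<le> 1 - 2 * g - g / 2" using g2 g3 g by linarith
  have "- (1 / 2 + 3 / 2 * g) + (1 / 2 + g / 4) * (1 - 3 * g) = - (11 / 4) * g - 3 / 4 * g\<^sup>2"
    by (simp add: algebra_simps power2_eq_square)
  then show "- (1 / 2 + 3 / 2 * g) + (1 / 2 + g / 4) * (1 - 3 * g) \<le> - 2 * g - g / 2"
    using g zero_le_power2[of g] by linarith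
  assume d: "\<delta> \<ge> 0"
  have "(1 / 2 + g / 4) * - (4 * g - 2 * \<delta> - g\<^sup>2) = - 2 * g + \<delta> + 1 / 2 * (g * \<delta>) - 1 / 2 * g\<^sup>2 + 1 / 4 * (g * g\<^sup>2)"
    by (simp add: algebra_simps power2_eq_square)
  moreover have "g * \<delta> \<le> \<delta>" using mult_right_mono[of g 1 \<delta>] g d by simp
  ultimately show "(1 / 2 + g / 4) * - (4 * g - 2 * \<delta> - g\<^sup>2) \<le> - 2 * g + 2 * \<delta>"
    using g3 zero_le_power2[of g] d by linarith
qed

text \<open>
  The last inequality lets a surplus of \<open>g / 2\<close> in an exponent of \<open>T\<close> absorb two logarithms; the
  second one keeps \<open>1 / ln T\<close> below the distances that depend on \<open>g\<close>.
\<close>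

definition large_height :: "real \<Rightarrow> real \<Rightarrow> bool" where
  "large_height g T \<longleftrightarrow> T \<ge> 16 \<and> ln T \<ge> 2 / g \<and> (1 + 2 * ln T) ^ 2 \<le> T powr (g / 2)"

lemma large_heightD:
  assumes "large_height g T" "0 < g" "g \<le> 1 / 4"
  shows "T \<ge> 16" "ln T \<ge> 2 / g" "(1 + 2 * ln T) ^ 2 \<le> T powr (g / 2)" "ln T \<ge> 8"
  using assms order_trans[of 8 "2 / g" "ln T"] by (simp_all add: large_height_def field_simps)

lemma eventually_large_height:
  assumes "g > 0"
  obtains T0 where "\<And>T. T \<ge> T0 \<Longrightarrow> large_height g T"
proof -
  have "eventually (\<lambda>T::real. ln T \<ge> 2 / g) at_top"
    using ln_at_top by (simp add: filterlim_at_top)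
  moreover have "eventually (\<lambda>T::real. (1 + 2 * ln T) ^ 2 \<le> T powr (g / 2)) at_top"
    using assms by real_asymp
  ultimately have "eventually (\<lambda>T. large_height g T) at_top"
    using eventually_ge_at_top[of "16::real"] by eventually_elim (auto simp: large_height_def)
  then show ?thesis using that by (auto simp: eventually_at_top_linorder)
qed

text \<open>
  Up to the length \<open>X\<close> of the mollifier the coefficients are bounded by the number of divisors larger
  than \<open>Y\<close>, and this part has the true order of magnitude. Beyond \<open>X\<close> the bound
  \<open>O(k powr (g\<^sup>2 / 2))\<close> for the number of divisors suffices, since \<open>X\<close> exceeds \<open>sqrt T\<close> by a power
  of \<open>T\<close>. Moving \<open>\<sigma>\<close> to the left by \<open>1 / ln T\<close> changes powers of \<open>T\<close> by bounded factors only.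
\<close>

lemma diagonal_bound:
  assumes g: "0 < g" "g \<le> 1 / 4" and large: "large_height g T"
    and C: "C \<ge> 1" "\<And>n. n > 0 \<Longrightarrow> divisor_count n \<le> C * real n powr (g\<^sup>2 / 2)"
    and sigma: "1 / 2 + 2 * g - 1 / ln T \<le> \<sigma>"
  defines "X \<equiv> mollifier_length g T" and "Y \<equiv> sqrt (T / (4 * pi))"
  shows "(\<Sum>k=2..K. (if k \<le> X then large_divisor_count Y k else divisor_count k) ^ 2 * real k powr (- 2 * \<sigma>))
     \<le> (312 / g ^ 3 + 9 * C ^ 2 / g) * T powr (- 2 * g) * ln T" (is "?S \<le> _ * ?T * _")
proof -
  note T = large_heightD[OF large g]
  define \<delta> where "\<delta> = 1 / ln T"
  define p where "p = 1 + 4 * g - 2 * \<delta>"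
  let ?q = "p - 2 * (g\<^sup>2 / 2)"
  define u where "u k = large_divisor_count Y k ^ 2 * real k powr (- p)" for k
  define v where "v k = divisor_count k ^ 2 * real k powr (- p)" for k
  define Z where "Z = T powr (1 / 2 + g / 4)"
  note lnT = T(4)
  have delta: "0 < \<delta>" "\<delta> \<le> g / 2" using lnT T g by (auto simp: \<delta>_def field_simps)
  have Td: "T powr \<delta> \<le> 3" unfolding \<delta>_def using exp_log_scale[of T] lnT T by simp
  have p: "1 < p" "p \<le> 2" "2 * g \<le> p - 1" using delta g by (auto simp: p_def)
  have g2: "g\<^sup>2 \<le> g / 4" by (rule exponent_inequalities(3)[OF g])
  have q: "1 < ?q" "2 * g \<le> ?q - 1" using g2 delta g by (auto simp: p_def)
  have X: "X \<ge> 1" "real X \<le> T" using parameter_bounds(1,3)[OF g T(1), of 0] T by (simp_all add: X_def)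
  have Ypos: "Y > 0" using T by (simp add: Y_def)
  have Zpos: "Z > 0" using T by (simp add: Z_def)
  have logX: "1 + ln (real X) \<le> 2 * ln T"
  proof -
    have "ln (real X) \<le> ln T" using X T by (subst ln_le_cancel_iff) auto
    then show ?thesis using lnT by linarith
  qed
  have "?S
     \<le> (\<Sum>k=2..K. (if k \<le> X then u k else 0) + (if Z < real k then v k else 0))"
  proof (rule sum_mono)
    fix k assume k: "k \<in> {2..K}"
    have pw: "real k powr (- 2 * \<sigma>) \<le> real k powr (- p)"
      using k sigma by (intro powr_mono) (auto simp: p_def \<delta>_def)
    have "Z < real k" if "\<not> k \<le> X" using that unfolding X_def mollifier_length_def Z_def[symmetric] by linarith
    then show "(if k \<le> X then large_divisor_count Y k else divisor_count k) ^ 2 * real k powr (- 2 * \<sigma>) \<le>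
      (if k \<le> X then u k else 0) + (if Z < real k then v k else 0)"
      unfolding u_def v_def
      using mult_left_mono[OF pw, of "large_divisor_count Y k ^ 2"] mult_left_mono[OF pw, of "divisor_count k ^ 2"]
      by (auto intro!: add_increasing2)
  qed
  also have "\<dots> \<le> (\<Sum>k=1..X. u k) + (\<Sum>k | k \<in> {1..K} \<and> Z < real k. v k)"
    unfolding sum.distrib
  proof (rule add_mono)
    have eq: "(\<Sum>k=2..K. if P k then f k else 0) = (\<Sum>k\<in>{k\<in>{2..K}. P k}. f k)" for P and f :: "nat \<Rightarrow> real"
      by (rule sum.inter_filter[symmetric]) simp
    show "(\<Sum>k=2..K. if k \<le> X then u k else 0) \<le> (\<Sum>k=1..X. u k)"
      unfolding eq by (rule sum_mono2) (auto simp: u_def)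
    show "(\<Sum>k=2..K. if Z < real k then v k else 0) \<le> (\<Sum>k | k \<in> {1..K} \<and> Z < real k. v k)"
      unfolding eq by (rule sum_mono2) (auto simp: v_def)
  qed
  also have "\<dots> \<le> 32 / (p - 1) ^ 3 * Y powr (1 - p) * (1 + ln (real X)) + 2 * C ^ 2 / (?q - 1) * Z powr (1 - ?q)"
    unfolding u_def v_def
    by (intro add_mono large_divisor_square_sum_le divisor_square_tail_le C p q Ypos Zpos X) simp_all
  also have "\<dots> \<le> 32 / (2 * g) ^ 3 * (39 * ?T) * (2 * ln T) + 2 * C ^ 2 / (2 * g) * (9 * ?T)"
  proof (intro add_mono mult_mono)
    show "32 / (p - 1) ^ 3 \<le> 32 / (2 * g) ^ 3"
      using p g by (intro divide_left_mono power_mono mult_pos_pos zero_less_power) auto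
    show "2 * C\<^sup>2 / (?q - 1) \<le> 2 * C\<^sup>2 / (2 * g)"
      using q g by (intro divide_left_mono mult_pos_pos) auto
    show "Y powr (1 - p) \<le> 39 * ?T"
    proof -
      have "Y powr (1 - p) = (T / (4 * pi)) powr (- (2 * g - \<delta>))"
      proof -
        have "Y = (T / (4 * pi)) powr (1 / 2)" using T by (simp add: Y_def powr_half_sqrt)
        moreover have "1 / 2 * (1 - p) = - (2 * g - \<delta>)" by (simp add: p_def field_simps)
        ultimately show ?thesis by (simp only: powr_powr)
      qed
      also have "\<dots> = T powr (- (2 * g - \<delta>)) * (4 * pi) powr (2 * g - \<delta>)"
        using T by (intro divide_powr_minus) auto
      also have "T powr (- (2 * g - \<delta>)) = ?T * T powr \<delta>" by (simp add: powr_add[symmetric])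
      also have "?T * T powr \<delta> * (4 * pi) powr (2 * g - \<delta>) \<le> ?T * 3 * 13"
      proof (intro mult_mono Td order_refl)
        have "(4 * pi) powr (2 * g - \<delta>) \<le> (4 * pi) powr 1" using delta g pi_gt3 by (intro powr_mono) auto
        then show "(4 * pi) powr (2 * g - \<delta>) \<le> 13" using pi_approx by simp
      qed auto
      finally show ?thesis by simp
    qed
    show "Z powr (1 - ?q) \<le> 9 * ?T"
    proof -
      have "Z powr (1 - ?q) = T powr ((1 / 2 + g / 4) * - (4 * g - 2 * \<delta> - g\<^sup>2))"
        unfolding Z_def powr_powr by (simp add: p_def algebra_simps)
      also have "\<dots> \<le> T powr (- 2 * g + 2 * \<delta>)"
        using T delta by (intro powr_mono exponent_inequalities(4)[OF g]) auto
      also have "\<dots> = ?T * (T powr \<delta> * T powr \<delta>)" by (simp add: powr_add[symmetric])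
      also have "\<dots> \<le> ?T * (3 * 3)" by (intro mult_left_mono mult_mono Td) auto
      finally show ?thesis by simp
    qed
  qed (use logX p g X lnT in auto)
  also have "\<dots> = 312 / g ^ 3 * ?T * ln T + 9 * C ^ 2 / g * ?T * 1"
    by (simp add: power_mult_distrib mult_ac)
  also have "\<dots> \<le> 312 / g ^ 3 * ?T * ln T + 9 * C ^ 2 / g * ?T * ln T"
    using lnT g by (intro add_left_mono mult_left_mono) auto
  also have "\<dots> = (312 / g ^ 3 + 9 * C ^ 2 / g) * ?T * ln T" by (simp add: distrib_right)
  finally show ?thesis .
qed

lemma offdiagonal_bound:
  assumes g: "0 < g" "g \<le> 1 / 4" and large: "large_height g T"
    and C: "C \<ge> 1" "\<And>n. n > 0 \<Longrightarrow> divisor_count n \<le> C * real n powr (g\<^sup>2 / 2)"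
    and sigma: "1 / 2 + 3 / 2 * g \<le> \<sigma>"
  defines "K \<equiv> nat \<lfloor>T powr (1 + g / 4)\<rfloor>"
  shows "offdiagonal_sum \<sigma> {2..K}
     \<le> 10 * C ^ 2 * T powr (1 - 2 * g)"
proof -
  note T = large_heightD[OF large g]
  have K: "K \<ge> 1" "real K \<le> T powr (1 + g / 4)" "real K \<le> T ^ 2"
    using parameter_bounds(4,5,6)[OF g T(1), of 0] T by (simp_all add: K_def)
  define \<theta> where "\<theta> = 1 - 3 * g + g\<^sup>2"
  have th: "\<theta> \<ge> 0" using g zero_le_power2[of g] unfolding \<theta>_def by linarith
  have lnK: "0 \<le> ln (real K)" "ln (real K) \<le> 2 * ln T"
  proof -
    show "0 \<le> ln (real K)" using K by simp
    have "ln (real K) \<le> ln (T ^ 2)" using K T by (subst ln_le_cancel_iff) auto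
    then show "ln (real K) \<le> 2 * ln T" using T by (simp add: ln_realpow)
  qed
  have "offdiagonal_sum \<sigma> {2..K}
     \<le> 10 * C ^ 2 * real K powr (2 - 2 * (1 / 2 + 3 / 2 * g) + 2 * (g\<^sup>2 / 2)) * (1 + ln (real K)) ^ 2"
    by (rule offdiagonal_sum_le[OF K(1) _ _ sigma _ C]) (use g in auto)
  also have "2 - 2 * (1 / 2 + 3 / 2 * g) + 2 * (g\<^sup>2 / 2) = \<theta>" by (simp add: \<theta>_def)
  also have "10 * C ^ 2 * real K powr \<theta> * (1 + ln (real K)) ^ 2 \<le> 10 * C ^ 2 * T powr (1 - 2 * g - g / 2) * T powr (g / 2)"
  proof (intro mult_mono)
    have "real K powr \<theta> \<le> (T powr (1 + g / 4)) powr \<theta>" using K th by (intro powr_mono2) auto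
    also have "\<dots> = T powr ((1 + g / 4) * \<theta>)" by (simp add: powr_powr)
    also have "\<dots> \<le> T powr (1 - 2 * g - g / 2)"
      unfolding \<theta>_def using T by (intro powr_mono exponent_inequalities(1)[OF g]) auto
    finally show "real K powr \<theta> \<le> T powr (1 - 2 * g - g / 2)" .
    have "(1 + ln (real K)) ^ 2 \<le> (1 + 2 * ln T) ^ 2" using lnK by (intro power_mono) auto
    also have "\<dots> \<le> T powr (g / 2)" by (rule T(3))
    finally show "(1 + ln (real K)) ^ 2 \<le> T powr (g / 2)" .
  qed auto
  also have "\<dots> = 10 * C ^ 2 * T powr (1 - 2 * g)" by (simp add: mult.assoc powr_add[symmetric])
  finally show ?thesis .
qed

text \<open>
  The tail of the Siegel integral is so small that the trivial bound for the mollifier suffices.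
\<close>

lemma tail_times_mollifier_bound:
  assumes g: "0 < g" "g \<le> 1 / 4" and large: "large_height g T"
    and s: "1 / 2 + 3 / 2 * g \<le> Re s" "T / 2 \<le> t"
    and J: "CJ > 0" "norm J \<le> CJ * t powr (- Re s / 2)"
  shows "norm (J * mollifier (mollifier_length g T) s) ^ 2 \<le> 2 * CJ ^ 2 * T powr (- 2 * g)"
proof -
  note T = large_heightD[OF large g]
  define X where "X = mollifier_length g T"
  define a where "a = 1 / 2 + 3 / 2 * g"
  have X: "X \<ge> 1" "real X \<le> T powr (1 / 2 + g / 4)" "real X \<le> T"
    using parameter_bounds(1,2,3)[OF g T(1), of 0] T by (simp_all add: X_def)
  have lnX: "0 \<le> ln (real X)" "ln (real X) \<le> ln T"
    using X T by simp (use X T in \<open>subst ln_le_cancel_iff, auto\<close>)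
  have a: "a \<le> 1" "a \<ge> 0" "a \<le> Re s" using g s by (auto simp: a_def)
  have "norm (mollifier X s) \<le> (\<Sum>d=1..X. real d powr (- Re s))" by (rule norm_mollifier_le)
  also have "\<dots> \<le> (\<Sum>d=1..X. real d powr (- a))" using a by (intro sum_mono powr_mono) auto
  also have "\<dots> \<le> real X powr (1 - a) * (1 + ln (real X))" by (rule sum_powr_le[OF X(1) a(1)])
  also have "\<dots> \<le> T powr ((1 / 2 + g / 4) * (1 - a)) * (1 + 2 * ln T)"
  proof (intro mult_mono)
    have "real X powr (1 - a) \<le> (T powr (1 / 2 + g / 4)) powr (1 - a)" using X a by (intro powr_mono2) auto
    then show "real X powr (1 - a) \<le> T powr ((1 / 2 + g / 4) * (1 - a))" by (simp add: powr_powr)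
  qed (use lnX in auto)
  finally have M: "norm (mollifier X s) \<le> T powr ((1 / 2 + g / 4) * (1 - a)) * (1 + 2 * ln T)" .
  have "norm J ^ 2 \<le> (CJ * t powr (- Re s / 2)) ^ 2" by (intro power_mono J) auto
  also have "\<dots> = CJ ^ 2 * t powr (- Re s)" by (simp add: power2_eq_square powr_add[symmetric])
  also have "t powr (- Re s) \<le> t powr (- a)" using a s T by (intro powr_mono) auto
  also have "t powr (- a) \<le> (T / 2) powr (- a)" using a s T by (intro powr_mono2') auto
  also have "\<dots> = T powr (- a) * 2 powr a" using T by (intro divide_powr_minus) auto
  also have "2 powr a \<le> 2 powr 1" using a by (intro powr_mono) auto
  finally have J2: "norm J ^ 2 \<le> CJ ^ 2 * (2 * T powr (- a))" using J(1) by (simp add: mult_left_mono mult_right_mono mult_ac)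
  have "norm (J * mollifier X s) ^ 2 = norm J ^ 2 * norm (mollifier X s) ^ 2" by (simp add: norm_mult power_mult_distrib)
  also have "\<dots> \<le> (CJ ^ 2 * (2 * T powr (- a))) * (T powr ((1 / 2 + g / 4) * (1 - a)) * (1 + 2 * ln T)) ^ 2"
    by (intro mult_mono J2 power_mono M) auto
  also have "\<dots> = 2 * CJ ^ 2 * (T powr (- a) * T powr ((1 / 2 + g / 4) * (1 - 3 * g))) * (1 + 2 * ln T) ^ 2"
  proof -
    have "(T powr ((1 / 2 + g / 4) * (1 - a))) ^ 2 = T powr ((1 / 2 + g / 4) * (1 - 3 * g))"
      by (simp add: power2_eq_square powr_add[symmetric] a_def algebra_simps)
    then show ?thesis by (simp add: power_mult_distrib)
  qed
  also have "\<dots> \<le> 2 * CJ ^ 2 * T powr (- 2 * g - g / 2) * T powr (g / 2)"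
  proof (intro mult_mono T(3) order_refl)
    have "T powr (- a) * T powr ((1 / 2 + g / 4) * (1 - 3 * g)) = T powr (- a + (1 / 2 + g / 4) * (1 - 3 * g))"
      by (rule powr_add[symmetric])
    also have "\<dots> \<le> T powr (- 2 * g - g / 2)"
      unfolding a_def using T by (intro powr_mono exponent_inequalities(2)[OF g]) auto
    finally show "T powr (- a) * T powr ((1 / 2 + g / 4) * (1 - 3 * g)) \<le> T powr (- 2 * g - g / 2)" .
  qed auto
  also have "\<dots> = 2 * CJ ^ 2 * T powr (- 2 * g)" by (simp add: mult.assoc powr_add[symmetric])
  finally show ?thesis by (simp add: X_def)
qed

text \<open>
  The interval is wider than the window \<open>T \<le> t \<le> 2 T\<close> in which zeros will be counted, so that it
  contains the heights of all points of the discs used there.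
\<close>

lemma mean_square_mollified_defect:
  assumes g: "0 < g" "g \<le> 1 / 4"
  obtains C T0 where "C > 0" "T0 \<ge> 16"
    "\<And>T \<sigma>. T \<ge> T0 \<Longrightarrow> 1 / 2 + 2 * g - 1 / ln T \<le> \<sigma> \<Longrightarrow> \<sigma> \<le> 6 \<Longrightarrow>
      integral {T / 2..3 * T} (\<lambda>t. norm (mollified_defect g T (Complex \<sigma> t)) ^ 2) \<le> C * T powr (1 - 2 * g) * ln T"
proof -
  obtain CJ where CJ: "CJ > 0" and J: "\<And>s. 0 \<le> Re s \<Longrightarrow> Re s \<le> 6 \<Longrightarrow> 2 * pi \<le> Im s \<Longrightarrow>
     norm (siegel_line_integral (real (cutoff_length (Im s)) + 1 / 2) s) \<le> CJ * Im s powr (- Re s / 2)"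
    using siegel_tail_bound by metis
  have "g\<^sup>2 / 2 > 0" using g by simp
  then obtain Cd where Cd: "Cd \<ge> 1" "\<And>n. n > 0 \<Longrightarrow> divisor_count n \<le> Cd * real n powr (g\<^sup>2 / 2)"
    using divisor_count_bound by blast
  obtain T0 where T0: "\<And>T. T \<ge> T0 \<Longrightarrow> large_height g T"
    using eventually_large_height[OF g(1)] by blast
  define D where "D = 312 / g ^ 3 + 9 * Cd ^ 2 / g"
  define C where "C = 2 * (3 * D + 10 * Cd ^ 2) + 12 * CJ ^ 2"
  have D: "D > 0" unfolding D_def using g Cd by (intro add_pos_nonneg divide_pos_pos divide_nonneg_nonneg) auto
  have C: "C > 0" unfolding C_def using D by (intro add_pos_nonneg mult_pos_pos) auto
  have main: "integral {T / 2..3 * T} (\<lambda>t. norm (mollified_defect g T (Complex \<sigma> t)) ^ 2) \<le> C * T powr (1 - 2 * g) * ln T"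
    if TT0: "T \<ge> T0" and sigma: "1 / 2 + 2 * g - 1 / ln T \<le> \<sigma>" "\<sigma> \<le> 6" for T \<sigma>
  proof -
    let ?I = "{T / 2..3 * T}" and ?E = "10 * Cd ^ 2 * T powr (1 - 2 * g)"
    let ?F = "\<lambda>t. norm (mollified_defect g T (Complex \<sigma> t)) ^ 2"
    note large = T0[OF TT0]
    note T = large_heightD[OF large g]
    note lnT = T(4)
    have "1 / ln T \<le> g / 2" using lnT T g by (simp add: field_simps)
    then have sigma_a: "1 / 2 + 3 / 2 * g \<le> \<sigma>" using sigma by linarith
    define X where "X = mollifier_length g T"
    define K where "K = nat \<lfloor>T powr (1 + g / 4)\<rfloor>"
    define Y where "Y = sqrt (T / (4 * pi))"
    define S where "S t = (\<Sum>k=2..K. of_real (cutoff_coeff X t k) * complex_of_nat k powr (- Complex \<sigma> t))" for t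
    define A where "A k = (if k \<le> X then large_divisor_count Y k else divisor_count k)" for k
    have Y: "Y \<ge> 0" "2 * pi * Y ^ 2 = T / 2" using T by (auto simp: Y_def)
    have coeff: "\<bar>cutoff_coeff X t k\<bar> \<le> A k" if "k \<in> {2..K}" "T / 2 \<le> t" for k t
      using that Y abs_cutoff_coeff_le_large_divisors[of k X Y t] abs_cutoff_coeff_le[of k X t] by (auto simp: A_def)
    \<comment> \<open>\<open>Y\<close> is the cut-off \<open>sqrt (t / 2\<pi>)\<close> at the lower end \<open>t = T / 2\<close> of the interval, so that the bound by
      divisors larger than \<open>Y\<close> holds throughout.\<close>
    note ms = mean_square_cutoff[of "T / 2" "3 * T" "{2..K}" K X A \<sigma>, OF _ _ coeff]
    have S_int: "(\<lambda>t. norm (S t) ^ 2) integrable_on ?I"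
      unfolding S_def by (rule ms(1)) (use T in auto)
    have "integral ?I (\<lambda>t. norm (S t) ^ 2) \<le> (3 * T - T / 2) * (\<Sum>k=2..K. A k ^ 2 * real k powr (- 2 * \<sigma>))
       + offdiagonal_sum \<sigma> {2..K}"
      unfolding S_def by (rule ms(2)) (use T in auto)
    also have "\<dots> \<le> (3 * T) * (D * T powr (- 2 * g) * ln T) + ?E"
    proof (intro add_mono mult_mono)
      show "(\<Sum>k=2..K. A k ^ 2 * real k powr (- 2 * \<sigma>)) \<le> D * T powr (- 2 * g) * ln T"
        unfolding A_def D_def X_def Y_def by (rule diagonal_bound[OF g large Cd sigma(1)])
      show "offdiagonal_sum \<sigma> {2..K} \<le> ?E"
        unfolding K_def by (rule offdiagonal_bound[OF g large Cd sigma_a])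
    qed (use T in \<open>auto intro!: sum_nonneg\<close>)
    also have "(3 * T) * (D * T powr (- 2 * g) * ln T) = 3 * D * T powr (1 - 2 * g) * ln T"
      using T by (simp add: powr_diff powr_minus field_simps)
    also have "?E \<le> ?E * ln T"
      using mult_left_mono[of 1 "ln T" "?E"] lnT by simp
    finally have S_le: "integral ?I (\<lambda>t. norm (S t) ^ 2) \<le> (3 * D + 10 * Cd ^ 2) * T powr (1 - 2 * g) * ln T"
      by (simp add: distrib_right)
    define E where "E = 2 * CJ ^ 2 * T powr (- 2 * g)"
    have pointwise: "norm (mollified_defect g T (Complex \<sigma> t)) ^ 2 \<le> 2 * norm (S t) ^ 2 + 2 * E"
      if t: "t \<in> ?I" for t
    proof -
      define s where "s = Complex \<sigma> t"
      define N where "N = cutoff_length t"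
      define J where "J = siegel_line_integral (real N + 1 / 2) s"
      have t2: "2 * pi \<le> t" using t T pi_less_4 by simp
      note par = parameter_bounds[OF g T(1), of t]
      have NK: "N * X \<le> K" "K \<ge> 1" "X \<ge> 1" using par t T unfolding N_def X_def K_def by auto
      have dec: "mollified_defect g T s = S t + J * mollifier X s"
        unfolding mollified_defect_def X_def[symmetric] S_def J_def s_def
        using defect_decomposition[of "Complex \<sigma> t" N X K] t2 NK N_def by simp
      have "norm J \<le> CJ * t powr (- Re s / 2)"
        using J[of s] sigma sigma_a g t2 by (simp add: J_def s_def N_def)
      then have E: "norm (J * mollifier X s) ^ 2 \<le> E"
        unfolding E_def X_def using t sigma_a by (intro tail_times_mollifier_bound[OF g large _ _ CJ, of _ t]) (auto simp: s_def)
      have "norm (mollified_defect g T s) ^ 2 \<le> (norm (S t) + norm (J * mollifier X s)) ^ 2"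
        unfolding dec by (intro power_mono norm_triangle_ineq) auto
      also have "\<dots> \<le> 2 * norm (S t) ^ 2 + 2 * norm (J * mollifier X s) ^ 2"
        using sum_squares_bound[of "norm (S t)" "norm (J * mollifier X s)"] by (simp add: power2_sum)
      also have "\<dots> \<le> 2 * norm (S t) ^ 2 + 2 * E" using E by simp
      finally show ?thesis by (simp add: s_def)
    qed
    have cont: "continuous_on A ?F" for A
    proof -
      have "continuous_on A (\<lambda>t. mollified_defect g T (Complex \<sigma> t))"
        by (rule continuous_on_compose2[OF holomorphic_on_imp_continuous_on[OF mollified_defect_holomorphic]])
           (auto simp: Complex_eq intro!: continuous_intros)
      then show ?thesis by (intro continuous_intros)
    qed
    have "integral ?I ?F \<le> integral ?I (\<lambda>t. 2 * norm (S t) ^ 2 + 2 * E)"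
      by (intro integral_le integrable_continuous_interval cont pointwise integrable_add integrable_on_mult_right S_int integrable_const_ivl)
    also have "\<dots> = 2 * integral ?I (\<lambda>t. norm (S t) ^ 2) + (3 * T - T / 2) * (2 * E)"
      using S_int T by (subst integral_add) (auto intro!: integrable_on_mult_right)
    also have "\<dots> \<le> 2 * ((3 * D + 10 * Cd ^ 2) * T powr (1 - 2 * g) * ln T) + (3 * T) * (2 * E)"
      using T by (intro add_mono mult_left_mono mult_right_mono S_le) (auto simp: E_def)
    also have "(3 * T) * (2 * E) = 12 * CJ ^ 2 * T powr (1 - 2 * g)"
      using T by (simp add: E_def powr_diff powr_minus field_simps)
    also have "\<dots> \<le> 12 * CJ ^ 2 * T powr (1 - 2 * g) * ln T"
      using mult_left_mono[of 1 "ln T" "12 * CJ ^ 2 * T powr (1 - 2 * g)"] lnT by simp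
    finally show ?thesis by (simp add: C_def algebra_simps)
  qed
  show thesis by (rule that[of C "max 16 T0"]) (use C main in auto)
qed

text \<open>
  On the line of real part \<open>3\<close>, which carries the centres of the discs, the coefficients vanish for
  \<open>1 < k \<le> Y\<close> and the series over \<open>k > Y\<close> is \<open>O(1 / Y)\<close>.
\<close>

lemma mollified_defect_small:
  assumes g: "0 < g" "g \<le> 1 / 4"
  obtains T0 where "\<And>T t. T \<ge> T0 \<Longrightarrow> T \<le> t \<Longrightarrow> t \<le> 2 * T \<Longrightarrow> norm (mollified_defect g T (Complex 3 t)) \<le> 1 / 2"
proof -
  obtain CJ where CJ: "CJ > 0" and J: "\<And>s. 0 \<le> Re s \<Longrightarrow> Re s \<le> 6 \<Longrightarrow> 2 * pi \<le> Im s \<Longrightarrow>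
     norm (siegel_line_integral (real (cutoff_length (Im s)) + 1 / 2) s) \<le> CJ * Im s powr (- Re s / 2)"
    using siegel_tail_bound by metis
  have "eventually (\<lambda>T::real. 16 \<le> T \<and> 2 * sqrt (T / (4 * pi)) powr (- 1) + CJ * T powr (- 3 / 2) * 4 \<le> 1 / 2) at_top"
  proof (intro eventually_conj eventually_ge_at_top)
    show "eventually (\<lambda>T::real. 2 * sqrt (T / (4 * pi)) powr (- 1) + CJ * T powr (- 3 / 2) * 4 \<le> 1 / 2) at_top"
      using CJ by real_asymp
  qed
  then obtain T0 where T0: "\<And>T. T \<ge> T0 \<Longrightarrow> 16 \<le> T \<and> 2 * sqrt (T / (4 * pi)) powr (- 1) + CJ * T powr (- 3 / 2) * 4 \<le> 1 / 2"
    by (auto simp: eventually_at_top_linorder)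
  show thesis
  proof (rule that)
    fix T t assume TT: "T \<ge> T0" and t: "T \<le> t" "t \<le> 2 * T"
    have T: "T \<ge> 16" "2 * sqrt (T / (4 * pi)) powr (- 1) + CJ * T powr (- 3 / 2) * 4 \<le> 1 / 2" using T0[OF TT] by auto
    define s where "s = Complex 3 t"
    define X where "X = mollifier_length g T"
    define K where "K = nat \<lfloor>T powr (1 + g / 4)\<rfloor>"
    define Y where "Y = sqrt (T / (4 * pi))"
    define N where "N = cutoff_length t"
    define S where "S = (\<Sum>k=2..K. of_real (cutoff_coeff X t k) * complex_of_nat k powr (- s))"
    have Ypos: "Y > 0" using T by (simp add: Y_def)
    have Y2: "2 * pi * Y ^ 2 \<le> t" using T t by (simp add: Y_def)
    have t2: "2 * pi \<le> t" using t T pi_less_4 by simp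
    have par: "N * X \<le> K" "K \<ge> 1" "X \<ge> 1" using parameter_bounds[OF g T(1), of t] t T unfolding N_def X_def K_def by auto
    have YX: "k \<le> X" if "real k \<le> Y" for k
    proof -
      have "Y \<le> sqrt T" unfolding Y_def using T pi_gt3 by (intro real_sqrt_le_mono) (simp add: field_simps)
      also have "\<dots> = T powr (1 / 2)" using T by (simp add: powr_half_sqrt)
      also have "\<dots> \<le> T powr (1 / 2 + g / 4)" using T g by (intro powr_mono) auto
      finally have "real k \<le> T powr (1 / 2 + g / 4)" using that by simp
      then show ?thesis by (simp add: X_def mollifier_length_def le_nat_iff le_floor_iff)
    qed
    have "mollified_defect g T s = S
        + siegel_line_integral (real N + 1 / 2) s * mollifier X s"
      unfolding mollified_defect_def X_def[symmetric]
      using defect_decomposition[of s N X K] t2 par N_def by (simp add: s_def S_def)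
    also have "norm \<dots> \<le> 2 * Y powr (- 1) + CJ * T powr (- 3 / 2) * 4"
    proof (rule norm_triangle_le[OF add_mono])
      have "norm S
          \<le> (\<Sum>k=2..K. if Y < real k then real k powr (- 2) else 0)"
        unfolding S_def
      proof (rule sum_norm_le)
        fix k assume k: "k \<in> {2..K}"
        show "norm (of_real (cutoff_coeff X t k) * complex_of_nat k powr (- s)) \<le> (if Y < real k then real k powr (- 2) else 0)"
        proof (cases "Y < real k")
          case True
          have "norm (of_real (cutoff_coeff X t k) * complex_of_nat k powr (- s)) = \<bar>cutoff_coeff X t k\<bar> * real k powr (- 3)"
            using k by (simp add: norm_mult norm_of_nat_powr s_def)
          also have "\<dots> \<le> real k * real k powr (- 3)"
            using abs_cutoff_coeff_le[of k X t] divisor_count_le_self[of k] k by (intro mult_right_mono) auto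
          also have "\<dots> = real k powr (- 2)" using k by (simp add: powr_mult_base)
          finally show ?thesis using True by simp
        next
          case False
          then have "cutoff_coeff X t k = 0"
            using k YX[of k] Y2 by (intro cutoff_coeff_eq_0[where Y = Y]) auto
          then show ?thesis using False by simp
        qed
      qed
      also have "\<dots> = (\<Sum>k\<in>{k\<in>{2..K}. Y < real k}. real k powr (- 2))"
        by (rule sum.inter_filter[symmetric]) simp
      also have "\<dots> \<le> (\<Sum>k | k \<in> {1..K} \<and> Y < real k. real k powr (- 2))"
        by (rule sum_mono2) auto
      also have "\<dots> \<le> 2 * Y powr (- 1)" using sum_powr_tail_le[of 2 Y K] Ypos by simp
      finally show "norm S \<le> 2 * Y powr (- 1)" .
      have "norm (mollifier X s) \<le> (\<Sum>d=1..X. real d powr (- 3))"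
        using norm_mollifier_le[of X s] by (simp add: s_def)
      also have "\<dots> \<le> (\<Sum>d=1..X. real d powr (- 2))" by (intro sum_mono powr_mono) auto
      also have "\<dots> \<le> 4" using sum_powr_bounded[of 2 X] by simp
      finally have M: "norm (mollifier X s) \<le> 4" .
      have "norm (siegel_line_integral (real N + 1 / 2) s) \<le> CJ * t powr (- 3 / 2)"
      proof -
        have "norm (siegel_line_integral (real N + 1 / 2) s) \<le> CJ * t powr (- Re s / 2)"
          using J[of s] t2 by (simp add: s_def N_def)
        then show ?thesis by (simp add: s_def)
      qed
      also have "\<dots> \<le> CJ * T powr (- 3 / 2)" using CJ T t by (intro mult_left_mono powr_mono2') auto
      finally show "norm (siegel_line_integral (real N + 1 / 2) s * mollifier X s) \<le> CJ * T powr (- 3 / 2) * 4"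
        unfolding norm_mult using M CJ by (intro mult_mono) auto
    qed
    also have "\<dots> \<le> 1 / 2" using T(2) by (simp add: Y_def)
    finally show "norm (mollified_defect g T (Complex 3 t)) \<le> 1 / 2" by (simp add: s_def)
  qed
qed

section \<open>Zeros in dyadic windows\<close>

text \<open>
  The circle means are integrated over the heights of the centres first: each point of the circle
  then traces a vertical segment, which lies in the strip where the mean square is known.
\<close>

lemma circle_mean_square_le:
  assumes f: "f holomorphic_on UNIV" and r: "0 < r" "r \<le> T / 2" and T: "T > 0"
    and B: "\<And>\<sigma>. x - r \<le> \<sigma> \<Longrightarrow> \<sigma> \<le> x + r \<Longrightarrow> integral {T / 2..3 * T} (\<lambda>t. norm (f (Complex \<sigma> t)) ^ 2) \<le> B"
  defines "I \<equiv> \<lambda>t. integral {0..1} (\<lambda>u. norm (f (circlepath (Complex x t) r u)) ^ 2)"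
  shows "I integrable_on {T..2 * T}" and "integral {T..2 * T} I \<le> B"
proof -
  have fc: "continuous_on A (\<lambda>p. norm (f (h p)) ^ 2)" if "continuous_on A h" for A :: "'a::topological_space set" and h
    by (intro continuous_intros continuous_on_compose2[OF holomorphic_on_imp_continuous_on[OF f] that]) auto
  define F where "F = (\<lambda>t u. norm (f (circlepath (Complex x t) r u)) ^ 2)"
  have I_F: "I = (\<lambda>t. integral {0..1} (F t))" by (simp add: I_def F_def)
  have point: "circlepath (Complex x t) r u = Complex (x + r * cos (2 * pi * u)) (t + r * sin (2 * pi * u))" for t u
  proof -
    have "exp (2 * of_real pi * \<i> * of_real u) = cis (2 * pi * u)" by (simp add: cis_conv_exp mult_ac)
    then show ?thesis by (simp add: circlepath complex_eq_iff)
  qed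
  have cont2: "continuous_on A (\<lambda>p. F (fst p) (snd p))" for A :: "(real \<times> real) set"
    unfolding F_def point by (rule fc) (auto simp: Complex_eq intro!: continuous_intros)
  have cont_uv: "continuous_on A (\<lambda>(t, u). F t u)" for A :: "(real \<times> real) set"
    using cont2[of A] by (simp add: case_prod_unfold)
  show "I integrable_on {T..2 * T}"
    unfolding I_F using integral_continuous_on_param[of "{T..2 * T}" 0 1, OF cont_uv]
    by (intro integrable_continuous_interval) simp
  have "integral {T..2 * T} I = integral {0..1} (\<lambda>u. integral {T..2 * T} (\<lambda>t. F t u))"
    unfolding I_F using integral_swap_continuous[OF cont_uv, of T "2 * T" 0 1] by simp
  also have "\<dots> \<le> integral {0..1} (\<lambda>u::real. B)"
  proof (rule integral_le)
    have "continuous_on {0..1} (\<lambda>u. integral (cbox T (2 * T)) (\<lambda>t. F t u))"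
    proof (rule integral_continuous_on_param)
      show "continuous_on ({0..1} \<times> cbox T (2 * T)) (\<lambda>(u, t). F t u)"
        unfolding F_def point case_prod_unfold by (rule fc) (auto simp: Complex_eq intro!: continuous_intros)
    qed
    then show "(\<lambda>u. integral {T..2 * T} (\<lambda>t. F t u)) integrable_on {0..1}"
      by (intro integrable_continuous_interval) simp
    fix u :: real
    define \<sigma> where "\<sigma> = x + r * cos (2 * pi * u)"
    define c where "c = r * sin (2 * pi * u)"
    have c: "\<bar>c\<bar> \<le> r" unfolding c_def abs_mult using r mult_left_mono[of "\<bar>sin (2 * pi * u)\<bar>" 1 r] by simp
    have cosr: "\<bar>r * cos (2 * pi * u)\<bar> \<le> r" unfolding abs_mult using r mult_left_mono[of "\<bar>cos (2 * pi * u)\<bar>" 1 r] by simp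
    define h where "h = (\<lambda>t. norm (f (Complex \<sigma> t)) ^ 2)"
    have hc: "continuous_on A h" for A unfolding h_def by (rule fc) (auto simp: Complex_eq intro!: continuous_intros)
    have "integral {T..2 * T} (\<lambda>t. F t u) = integral {T..2 * T} (h \<circ> (+) c)"
      unfolding F_def point by (simp add: h_def \<sigma>_def c_def o_def add.commute)
    also have "\<dots> = integral {T + c..2 * T + c} h" by (rule integral_shift_Icc_real)
    also have "\<dots> \<le> integral {T / 2..3 * T} h"
      by (rule integral_subset_le) (use c r T in \<open>auto intro!: integrable_continuous_interval hc simp: h_def[THEN fun_cong]\<close>)
    also have "\<dots> \<le> B" unfolding h_def by (rule B) (use cosr in \<open>auto simp: \<sigma>_def\<close>)
    finally show "integral {T..2 * T} (\<lambda>t. F t u) \<le> B" .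
  qed (rule integrable_const_ivl)
  also have "\<dots> = B" by simp
  finally show "integral {T..2 * T} I \<le> B" .
qed

lemma window_indicator_integral:
  fixes T \<gamma> \<delta> :: real
  assumes "T < \<gamma>" "\<gamma> \<le> 2 * T" "0 < \<delta>" "2 * \<delta> \<le> T"
  shows "(\<lambda>t. if \<bar>\<gamma> - t\<bar> \<le> \<delta> then 1 else 0 :: real) integrable_on {T..2 * T}"
    and "\<delta> \<le> integral {T..2 * T} (\<lambda>t. if \<bar>\<gamma> - t\<bar> \<le> \<delta> then 1 else 0)"
proof -
  define a b where "a = max T (\<gamma> - \<delta>)" and "b = min (2 * T) (\<gamma> + \<delta>)"
  have ab: "a \<le> b" "\<delta> \<le> b - a" "{a..b} \<subseteq> {T..2 * T}" using assms by (auto simp: a_def b_def)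
  have "((\<lambda>t. 1::real) has_integral (b - a)) {a..b}" using has_integral_const_real[of "1::real" a b] ab by simp
  then have "((\<lambda>t. if t \<in> {a..b} then 1 else 0 :: real) has_integral (b - a)) {T..2 * T}"
    using ab by (subst has_integral_restrict) auto
  then have *: "((\<lambda>t. if \<bar>\<gamma> - t\<bar> \<le> \<delta> then 1 else 0 :: real) has_integral (b - a)) {T..2 * T}"
    by (rule has_integral_eq[rotated]) (auto simp: a_def b_def abs_le_iff)
  show "(\<lambda>t. if \<bar>\<gamma> - t\<bar> \<le> \<delta> then 1 else 0 :: real) integrable_on {T..2 * T}"
    using * by (rule has_integral_integrable)
  show "\<delta> \<le> integral {T..2 * T} (\<lambda>t. if \<bar>\<gamma> - t\<bar> \<le> \<delta> then 1 else 0)"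
    using * ab by (simp add: integral_unique)
qed

text \<open>
  Here \<open>b\<close> is the distance of the centre from the line \<open>\<sigma> = \<alpha>\<close> and \<open>d\<close> that of a zero to the right of
  this line whose height differs from that of the centre by at most \<open>\<delta>\<close>. Since
  \<open>(b + \<delta>)\<^sup>2\<close> exceeds \<open>b\<^sup>2 + \<delta>\<^sup>2\<close> by \<open>2 b \<delta>\<close>, the weight of the zero is at least of order \<open>\<delta>\<close>.
\<close>

lemma log_radius_ratio_ge:
  fixes b \<delta> d :: real
  assumes b: "2 \<le> b" "b \<le> 5 / 2" and d: "0 < \<delta>" "\<delta> \<le> 1" and x: "0 < d" "d ^ 2 \<le> b ^ 2 + \<delta> ^ 2"
  shows "\<delta> / 4 \<le> ln (((b + \<delta>) / d) ^ 2)"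
proof -
  have b2: "b ^ 2 \<le> 25 / 4" using power_mono[of b "5/2" 2] b by (simp add: power2_eq_square)
  have d2: "\<delta> ^ 2 \<le> 1" using d by (simp add: power_le_one)
  have "(1 + \<delta> / 2) * d ^ 2 \<le> (1 + \<delta> / 2) * (b ^ 2 + \<delta> ^ 2)" using d x by (intro mult_left_mono) auto
  also have "\<dots> = b ^ 2 + \<delta> ^ 2 + \<delta> / 2 * (b ^ 2 + \<delta> ^ 2)" by (simp add: algebra_simps)
  also have "\<dots> \<le> b ^ 2 + \<delta> ^ 2 + \<delta> / 2 * 8" using b2 d2 d by (intro add_left_mono mult_left_mono) auto
  also have "\<dots> \<le> b ^ 2 + \<delta> ^ 2 + 2 * b * \<delta>" using mult_right_mono[of 2 b \<delta>] b d by simp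
  also have "\<dots> = (b + \<delta>) ^ 2" by (simp add: power2_sum)
  finally have ge: "1 + \<delta> / 2 \<le> ((b + \<delta>) / d) ^ 2" using x by (simp add: power_divide field_simps)
  have "\<delta> / 4 \<le> 1 - 1 / (1 + \<delta> / 2)" using d by (simp add: field_simps mult_left_le_one_le power2_eq_square)
  also have "\<dots> \<le> ln (1 + \<delta> / 2)"
    using ln_le_minus_one[of "1 / (1 + \<delta> / 2)"] d by (simp add: ln_div)
  also have "\<dots> \<le> ln (((b + \<delta>) / d) ^ 2)"
    using ge d by (subst ln_le_cancel_iff) (auto intro: less_le_trans[of 0 "1 + \<delta> / 2"])
  finally show ?thesis .
qed

lemma riemann_aux_nonzero_somewhere: "\<exists>s. riemann_aux s \<noteq> 0"
proof -
  obtain T0 where T0: "\<And>T t. T \<ge> T0 \<Longrightarrow> T \<le> t \<Longrightarrow> t \<le> 2 * T \<Longrightarrow> norm (mollified_defect (1 / 4) T (Complex 3 t)) \<le> 1 / 2"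
    using mollified_defect_small[of "1 / 4"] by (metis order_refl zero_less_divide_1_iff zero_less_numeral)
  define T where "T = max T0 1"
  have "norm (mollified_defect (1 / 4) T (Complex 3 T)) \<le> 1 / 2" by (rule T0) (auto simp: T_def)
  then have "riemann_aux (Complex 3 T) \<noteq> 0" by (auto simp: mollified_defect_def)
  then show ?thesis by blast
qed

text \<open>
  An entire function that does not vanish identically has finitely many zeros in a compact set; that
  \<open>riemann_aux\<close> does not vanish identically follows from \<open>|R M - 1| \<le> 1 / 2\<close> far up on the line of real
  part \<open>3\<close>.
\<close>

lemma finite_riemann_aux_zeros: "finite (riemann_aux_zeros \<alpha> T)"
proof -
  obtain w where w: "riemann_aux w \<noteq> 0" using riemann_aux_nonzero_somewhere by blast
  show ?thesis
  proof (cases "\<exists>\<rho>. riemann_aux \<rho> = 0")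
    case True
    then obtain \<rho> where "riemann_aux \<rho> = 0" by blast
    with w have "\<not> riemann_aux constant_on UNIV" by (metis UNIV_I constant_on_def)
    then have "finite {z \<in> cbox (Complex \<alpha> 0) (Complex 1 T). riemann_aux z = 0}"
      by (intro holomorphic_compact_finite_zeros[OF riemann_aux_holomorphic]) auto
    then show ?thesis
      by (rule finite_subset[rotated]) (auto simp: riemann_aux_zeros_def in_cbox_complex_iff)
  qed (auto simp: riemann_aux_zeros_def)
qed

text \<open>
  With \<open>\<delta> = 1 / ln T\<close>, every zero in the window contributes at least \<open>\<delta> / 4\<close> for a set of centres
  \<open>3 + i t\<close> of measure at least \<open>\<delta>\<close>, while the integral of four times the circle means is
  \<open>O(T powr (1 - 2 g) * ln T)\<close>.
\<close>

lemma zeros_in_window_bound: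
  assumes g: "0 < g" "g \<le> 1 / 4"
  obtains C T0 where "C > 0" "T0 \<ge> 2" "\<And>T. T \<ge> T0 \<Longrightarrow>
     real (riemann_aux_N (1 / 2 + 2 * g) (2 * T)) \<le> real (riemann_aux_N (1 / 2 + 2 * g) T) + C * T powr (1 - 2 * g) * ln T ^ 3"
proof -
  define \<alpha> where "\<alpha> = 1 / 2 + 2 * g"
  obtain C1 T1 where C1: "C1 > 0" "T1 \<ge> 16" and ms: "\<And>T \<sigma>. T \<ge> T1 \<Longrightarrow> 1 / 2 + 2 * g - 1 / ln T \<le> \<sigma> \<Longrightarrow> \<sigma> \<le> 6 \<Longrightarrow>
      integral {T / 2..3 * T} (\<lambda>t. norm (mollified_defect g T (Complex \<sigma> t)) ^ 2) \<le> C1 * T powr (1 - 2 * g) * ln T"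
    using mean_square_mollified_defect[OF g] by metis
  obtain T2 where small: "\<And>T t. T \<ge> T2 \<Longrightarrow> T \<le> t \<Longrightarrow> t \<le> 2 * T \<Longrightarrow> norm (mollified_defect g T (Complex 3 t)) \<le> 1 / 2"
    using mollified_defect_small[OF g] by metis
  obtain T3 where T3: "\<And>T. T \<ge> T3 \<Longrightarrow> large_height g T"
    using eventually_large_height[OF g(1)] by blast
  define T0 where "T0 = max (max T1 T2) T3"
  obtain w where w: "riemann_aux w \<noteq> 0" using riemann_aux_nonzero_somewhere by blast
  have main: "real (riemann_aux_N \<alpha> (2 * T)) \<le> real (riemann_aux_N \<alpha> T) + 16 * C1 * T powr (1 - 2 * g) * ln T ^ 3" if "T \<ge> T0" for T
  proof -
    have TT: "T \<ge> T1" "T \<ge> T2" "T \<ge> T3" using that by (auto simp: T0_def)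
    note T = large_heightD[OF T3[OF TT(3)] g]
    note lnT = T(4)
    define \<delta> where "\<delta> = 1 / ln T"
    have d: "0 < \<delta>" "\<delta> \<le> g / 2" using lnT T g by (auto simp: \<delta>_def field_simps)
    define b where "b = 3 - \<alpha>"
    define r where "r = b + \<delta>"
    have b: "2 \<le> b" "b \<le> 5 / 2" "r \<le> 3" using g d by (auto simp: b_def \<alpha>_def r_def)
    define f where "f = mollified_defect g T"
    define Z where "Z = riemann_aux_zeros \<alpha> (2 * T) - riemann_aux_zeros \<alpha> T"
    define m where "m \<rho> = nat (zorder riemann_aux \<rho>)" for \<rho>
    define I where "I = (\<lambda>t. integral {0..1} (\<lambda>u. norm (f (circlepath (Complex 3 t) r u)) ^ 2))"
    define close where "close \<rho> t = (if \<bar>Im \<rho> - t\<bar> \<le> \<delta> then 1 else 0 :: real)" for \<rho> t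
    have finZ: "finite Z" unfolding Z_def using finite_riemann_aux_zeros by auto
    have Zin: "riemann_aux \<rho> = 0" "\<alpha> \<le> Re \<rho>" "Re \<rho> \<le> 1" "T < Im \<rho>" "Im \<rho> \<le> 2 * T" if "\<rho> \<in> Z" for \<rho>
      using that T by (auto simp: Z_def riemann_aux_zeros_def)
    have f_hol: "f holomorphic_on UNIV" unfolding f_def by (rule mollified_defect_holomorphic)
    have window: "\<delta> / 4 * (\<Sum>\<rho>\<in>Z. real (m \<rho>) * close \<rho> t) \<le> 4 * I t" if t: "t \<in> {T..2 * T}" for t
    proof -
      \<comment> \<open>Zeros farther than \<open>r\<close> from the centre would enter the sum with negative weight, so only those at nearly
        the height of the centre are kept.\<close>
      define Zt where "Zt = {\<rho>\<in>Z. \<bar>Im \<rho> - t\<bar> \<le> \<delta>}"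
      have cZ: "Complex 3 t \<notin> Zt" using Zin(3)[of "Complex 3 t"] by (auto simp: Zt_def)
      have mult: "entire_multiple_of_power (\<lambda>z. 1 + f z) \<rho> (m \<rho>)" for \<rho>
      proof -
        have "entire_multiple_of_power (\<lambda>z. riemann_aux z * mollifier (mollifier_length g T) z) \<rho> (m \<rho>)"
          unfolding m_def by (intro entire_multiple_mult zorder_entire_multiple[OF riemann_aux_holomorphic w] mollifier_holomorphic)
        then show ?thesis by (simp add: f_def mollified_defect_def)
      qed
      have "\<delta> / 4 * (\<Sum>\<rho>\<in>Z. real (m \<rho>) * close \<rho> t) = (\<Sum>\<rho>\<in>Zt. real (m \<rho>) * (\<delta> / 4))"
        unfolding sum_distrib_left Zt_def using finZ by (subst sum.inter_filter) (auto intro!: sum.cong simp: close_def)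
      also have "\<dots> \<le> (\<Sum>\<rho>\<in>Zt. real (m \<rho>) * ln ((r / norm (\<rho> - Complex 3 t)) ^ 2))"
      proof (intro sum_mono mult_left_mono)
        fix \<rho> assume rho: "\<rho> \<in> Zt"
        have "norm (\<rho> - Complex 3 t) ^ 2 = (Re \<rho> - 3) ^ 2 + (Im \<rho> - t) ^ 2" by (simp add: cmod_power2)
        also have "\<dots> \<le> b ^ 2 + \<delta> ^ 2"
        proof (rule add_mono)
          have "\<bar>Re \<rho> - 3\<bar> ^ 2 \<le> b ^ 2" using Zin[of \<rho>] rho by (intro power_mono) (auto simp: b_def Zt_def)
          then show "(Re \<rho> - 3) ^ 2 \<le> b ^ 2" by simp
          have "\<bar>Im \<rho> - t\<bar> ^ 2 \<le> \<delta> ^ 2" using rho by (intro power_mono) (auto simp: Zt_def)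
          then show "(Im \<rho> - t) ^ 2 \<le> \<delta> ^ 2" by simp
        qed
        finally have le: "norm (\<rho> - Complex 3 t) ^ 2 \<le> b ^ 2 + \<delta> ^ 2" .
        have "0 < norm (\<rho> - Complex 3 t)" using rho cZ by auto
        from log_radius_ratio_ge[OF b(1,2) d(1) _ this le]
        show "\<delta> / 4 \<le> ln ((r / norm (\<rho> - Complex 3 t)) ^ 2)" using d g by (simp add: r_def)
      qed auto
      also have "\<dots> \<le> 4 * integral {0..1} (\<lambda>u. norm (f (circlepath (Complex 3 t) r u)) ^ 2)"
      proof (rule weighted_zeros_le_mean_square[OF f_hol _ _ mult cZ])
        show "norm (f (Complex 3 t)) \<le> 1 / 2" unfolding f_def by (rule small) (use TT t in auto)
      qed (use b d finZ in \<open>auto simp: Zt_def r_def\<close>)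
      finally show ?thesis by (simp add: I_def)
    qed
    have close_int: "close \<rho> integrable_on {T..2 * T}" "\<delta> \<le> integral {T..2 * T} (close \<rho>)" if "\<rho> \<in> Z" for \<rho>
      using window_indicator_integral[of T "Im \<rho>" \<delta>] Zin[OF that] d g T by (auto simp: close_def[abs_def])
    have I: "I integrable_on {T..2 * T}" "integral {T..2 * T} I \<le> C1 * T powr (1 - 2 * g) * ln T"
    proof -
      have r: "0 < r" "r \<le> T / 2" "T > 0" using b d T by (auto simp: r_def)
      have "integral {T / 2..3 * T} (\<lambda>t. norm (f (Complex \<sigma> t)) ^ 2) \<le> C1 * T powr (1 - 2 * g) * ln T"
        if "3 - r \<le> \<sigma>" "\<sigma> \<le> 3 + r" for \<sigma>
        unfolding f_def by (rule ms[OF TT(1)]) (use that b in \<open>auto simp: r_def b_def \<alpha>_def \<delta>_def\<close>)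
      note circle = circle_mean_square_le[OF f_hol r this]
      show "I integrable_on {T..2 * T}" unfolding I_def by (rule circle(1)) auto
      show "integral {T..2 * T} I \<le> C1 * T powr (1 - 2 * g) * ln T" unfolding I_def by (rule circle(2)) auto
    qed
    have sum_int: "(\<lambda>t. \<Sum>\<rho>\<in>Z. real (m \<rho>) * close \<rho> t) integrable_on {T..2 * T}"
      by (intro integrable_sum finZ integrable_on_mult_right close_int)
    have "\<delta> / 4 * (\<Sum>\<rho>\<in>Z. real (m \<rho>) * \<delta>) \<le> \<delta> / 4 * (\<Sum>\<rho>\<in>Z. real (m \<rho>) * integral {T..2 * T} (close \<rho>))"
      using d by (intro mult_left_mono sum_mono close_int) auto
    also have "\<dots> = integral {T..2 * T} (\<lambda>t. \<delta> / 4 * (\<Sum>\<rho>\<in>Z. real (m \<rho>) * close \<rho> t))"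
      by (subst integral_mult_right, subst integral_sum) (auto intro!: finZ integrable_on_mult_right close_int)
    also have "\<dots> \<le> integral {T..2 * T} (\<lambda>t. 4 * I t)"
      by (intro integral_le window integrable_on_mult_right sum_int I)
    also have "\<dots> \<le> 4 * (C1 * T powr (1 - 2 * g) * ln T)" using I(2) by simp
    finally have "\<delta> / 4 * (\<Sum>\<rho>\<in>Z. real (m \<rho>) * \<delta>) \<le> 4 * (C1 * T powr (1 - 2 * g) * ln T)" .
    moreover have "\<delta> / 4 * (\<Sum>\<rho>\<in>Z. real (m \<rho>) * \<delta>) = \<delta> ^ 2 * (\<Sum>\<rho>\<in>Z. real (m \<rho>)) / 4"
      by (simp add: sum_distrib_right[symmetric] power2_eq_square)
    ultimately have "\<delta> ^ 2 * (\<Sum>\<rho>\<in>Z. real (m \<rho>)) \<le> 16 * C1 * T powr (1 - 2 * g) * ln T"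
      by simp
    then have "(\<Sum>\<rho>\<in>Z. real (m \<rho>)) \<le> 16 * C1 * T powr (1 - 2 * g) * ln T ^ 3"
      using lnT by (simp add: \<delta>_def field_simps power2_eq_square power3_eq_cube)
    moreover have "real (riemann_aux_N \<alpha> (2 * T)) = (\<Sum>\<rho>\<in>Z. real (m \<rho>)) + real (riemann_aux_N \<alpha> T)"
    proof -
      have "riemann_aux_zeros \<alpha> T \<subseteq> riemann_aux_zeros \<alpha> (2 * T)" using T by (auto simp: riemann_aux_zeros_def)
      from sum.subset_diff[OF this finite_riemann_aux_zeros, of m]
      show ?thesis by (simp add: riemann_aux_N_def m_def[abs_def] Z_def)
    qed
    ultimately show ?thesis by simp
  qed
  show thesis
    by (rule that[of "16 * C1" T0]) (use main C1 in \<open>auto simp: \<alpha>_def T0_def\<close>)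
qed

text \<open>
  As \<open>(1 / 2) powr e \<le> 3 / 4\<close>, a constant \<open>K \<ge> 3 C\<close> reproduces itself when the height is
  doubled.
\<close>

lemma dyadic_growth:
  fixes N :: "real \<Rightarrow> real"
  assumes mono: "\<And>S T. S \<le> T \<Longrightarrow> N S \<le> N T" and T0: "T0 \<ge> 2" and e: "e \<ge> 1 / 2" and C: "C \<ge> 0"
    and step: "\<And>T. T \<ge> T0 \<Longrightarrow> N (2 * T) \<le> N T + C * T powr e * ln T ^ 3"
  shows "\<exists>K>0. \<forall>T\<ge>2. N T \<le> K * T powr e * ln T ^ 3"
proof -
  define K where "K = max (max (3 * C) (N (2 * T0) / ln 2 ^ 3)) 1"
  have K: "K \<ge> 3 * C" "K \<ge> N (2 * T0) / ln 2 ^ 3" "K \<ge> 1" by (auto simp: K_def)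
  have ind: "2 \<le> T \<Longrightarrow> T \<le> 2 ^ n * (2 * T0) \<Longrightarrow> N T \<le> K * T powr e * ln T ^ 3" for n T
  proof (induction n arbitrary: T)
    case 0
    have "N T \<le> N (2 * T0)" using 0 by (intro mono) auto
    also have "\<dots> \<le> K * ln 2 ^ 3" using K(2) by (simp add: field_simps)
    also have "\<dots> \<le> K * (T powr e * ln T ^ 3)"
    proof -
      have "ln 2 ^ 3 \<le> ln T ^ 3" using 0 by (intro power_mono) auto
      moreover have "1 \<le> T powr e" using 0 e by (intro ge_one_powr_ge_zero) auto
      ultimately have "1 * ln 2 ^ 3 \<le> T powr e * ln T ^ 3" by (intro mult_mono) auto
      then show ?thesis using K by (intro mult_left_mono) auto
    qed
    finally show ?case by (simp add: mult.assoc)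
  next
    case (Suc n)
    show ?case
    proof (cases "T \<le> 2 * T0")
      case True
      then have "T \<le> 1 * (2 * T0)" by simp
      also have "1 * (2 * T0) \<le> 2 ^ n * (2 * T0)" using T0 by (intro mult_right_mono) auto
      finally have "T \<le> 2 ^ n * (2 * T0)" by simp
      then show ?thesis using Suc by blast
    next
      case False
      define S where "S = T / 2"
      have S: "S \<ge> T0" "S \<ge> 2" "T = 2 * S" "S \<le> 2 ^ n * (2 * T0)" using False T0 Suc.prems by (auto simp: S_def)
      have ln: "0 \<le> ln S" "ln S \<le> ln T" using S by auto
      have half: "S powr e \<le> 3 / 4 * T powr e"
      proof -
        have "(1 / 2 :: real) powr e \<le> (1 / 2) powr (1 / 2)" using e by (intro powr_mono') auto
        also have "(1 / 2 :: real) powr (1 / 2) \<le> 3 / 4"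
        proof -
          have "sqrt (1 / 2) \<le> 3 / 4" by (rule real_le_lsqrt) (auto simp: power2_eq_square)
          moreover have "(1 / 2 :: real) powr (1 / 2) = sqrt (1 / 2)" by (rule powr_half_sqrt) simp
          ultimately show ?thesis by simp
        qed
        finally have "T powr e * (1 / 2) powr e \<le> T powr e * (3 / 4)" by (intro mult_left_mono) auto
        moreover have "S powr e = T powr e * (1 / 2) powr e" using S by (simp add: powr_mult[symmetric])
        ultimately show ?thesis by (simp add: mult.commute)
      qed
      have "N T \<le> N S + C * S powr e * ln S ^ 3" using step[OF S(1)] S(3) by simp
      also have "\<dots> \<le> K * S powr e * ln S ^ 3 + C * S powr e * ln S ^ 3" using Suc.IH[OF S(2,4)] by simp
      also have "\<dots> = (K + C) * (S powr e * ln S ^ 3)" by (simp add: algebra_simps)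
      also have "\<dots> \<le> (4 / 3 * K) * (3 / 4 * T powr e * ln T ^ 3)"
        using K C half ln by (intro mult_mono power_mono) auto
      also have "\<dots> = K * T powr e * ln T ^ 3" by simp
      finally show ?thesis .
    qed
  qed
  have "N T \<le> K * T powr e * ln T ^ 3" if T: "T \<ge> 2" for T
  proof -
    obtain n where "T < 2 ^ n" using real_arch_pow[of 2 T] by auto
    also have "(2::real) ^ n \<le> 2 ^ n * (2 * T0)" using T0 by simp
    finally show ?thesis by (intro ind[OF T] less_imp_le)
  qed
  then show ?thesis using K by (intro exI[of _ K]) auto
qed

lemma riemann_aux_N_mono:
  assumes "S \<le> T" shows "riemann_aux_N \<alpha> S \<le> riemann_aux_N \<alpha> T"
  unfolding riemann_aux_N_def
  by (rule sum_mono2[OF finite_riemann_aux_zeros]) (use assms in \<open>auto simp: riemann_aux_zeros_def\<close>)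

theorem theorem10:
  fixes \<alpha> :: real
  assumes "1 / 2 < \<alpha>" and "\<alpha> \<le> 1"
  shows "\<exists>C>0. \<forall>T\<ge>2. finite (riemann_aux_zeros \<alpha> T) \<and>
           real (riemann_aux_N \<alpha> T) \<le> C * T powr (3 / 2 - \<alpha>) * ln T ^ 3"
proof -
  define g where "g = (\<alpha> - 1 / 2) / 2"
  have g: "0 < g" "g \<le> 1 / 4" and eq: "1 / 2 + 2 * g = \<alpha>" "1 - 2 * g = 3 / 2 - \<alpha>"
    using assms by (auto simp: g_def field_simps)
  obtain C T0 where C: "C > 0" "T0 \<ge> 2" and step: "\<And>T. T \<ge> T0 \<Longrightarrow>
     real (riemann_aux_N \<alpha> (2 * T)) \<le> real (riemann_aux_N \<alpha> T) + C * T powr (3 / 2 - \<alpha>) * ln T ^ 3"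
    using zeros_in_window_bound[OF g] unfolding eq by metis
  have "\<exists>K>0. \<forall>T\<ge>2. real (riemann_aux_N \<alpha> T) \<le> K * T powr (3 / 2 - \<alpha>) * ln T ^ 3"
    by (rule dyadic_growth[where C = C, OF _ C(2)]) (use C assms step riemann_aux_N_mono in auto)
  then show ?thesis using finite_riemann_aux_zeros by blast
qed

end
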